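(* Let $n\geq 2$, let $\lambda_1,\ldots,\lambda_{n-1}$ be non-zero integers, let $\mu_{j,t}=\mu_{t,j}$, $j,t=1,\ldots,n-1$, be integers, let $\mathscr{C}H_n$ be the compact Heisenberg CR manifold determined by $(\lambda_j)$ and $L\to\mathscr{C}H_n$ the generalized Sasakian CR line bundle determined by $(\lambda_j)$ and $(\mu_{j,t})$. If the matrix $(\mu_{j,t})_{j,t=1}^{n-1}$ is positive definite and conditions $Y(0)$, $Y(1)$ hold on $\mathscr{C}H_n$, then there are a constant $c>0$ independent of $k$ and a $k_0$ such that for all $k\geq k_0$, $$\dim H^0_b(\mathscr{C}H_n,L^k)\geq c\,k^n .$$
   Context: $\mathscr{C}H_n=(\mathbb{C}^{n-1}\times\mathbb{R})/\sim$, where $(z,\theta)\sim(\tilde z,\tilde\theta)$ if $\tilde z-z=(\alpha_1,\ldots,\alpha_{n-1})\in\sqrt{2\pi}\,\mathbb{Z}^{n-1}+i\sqrt{2\pi}\,\mathbb{Z}^{n-1}$ and $\tilde\theta-\theta-i\sum_{j=1}^{n-1}\lambda_j(z_j\overline\alpha_j-\overline z_j\alpha_j)\in\pi\mathbb{Z}$. It is a compact manifold of dimension $2n-1$ with CR structure $T^{1,0}\mathscr{C}H_n$ spanned by $\frac{\partial}{\partial z_j}+i\lambda_j\overline z_j\frac{\partial}{\partial\theta}$, $j=1,\ldots,n-1$. With $T=\frac{\partial}{\partial\theta}$ and a Hermitian metric making these vector fields, their conjugates and $-T$ orthonormal, the Levi form is $\mathcal{L}_p=\sum_{j=1}^{n-1}\lambda_j\,dz_j\wedge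 d\overline z_j$, i.e. it has eigenvalues $\lambda_1,\ldots,\lambda_{n-1}$ at every point. Condition $Y(q)$ holds at $p$ if $\mathcal{L}_p$ has at least $\max(q+1,n-q)$ (nonzero) eigenvalues of the same sign or at least $\min(q+1,n-q)$ pairs of eigenvalues with opposite signs. $L=(\mathbb{C}^{n-1}\times\mathbb{R}\times\mathbb{C})/\equiv$, where $(z,\theta,\eta)\equiv(\tilde z,\tilde\theta,\tilde\eta)$ if $(z,\theta)\sim(\tilde z,\tilde\theta)$ and $$\tilde\eta\exp\Big(\tilde\theta+i\sum_{j=1}^{n-1}\lambda_j|\tilde z_j|^2\Big)=\eta\exp\Big(\theta+i\sum_{j=1}^{n-1}\lambda_j|z_j|^2\Big)\exp\Big(\sum_{j,t=1}^{n-1}\mu_{j,t}(z_j\overline\alpha_t+\tfrac12\alpha_j\overline\alpha_t)\Big),$$ with $\alpha=\tilde z-z$. The induced transition functions are CR functions annihilated by $T$. $L^k$ is the $k$-th tensor power of $L$, and $H^0_b(\mathscr{C}H_n,L^k)$ is the space of its smooth CR sections: smooth sections given, in the local trivializations of $L^k$ coming from the coordinates $(z,\theta,\eta)$, by functions $f(z,\theta)$ with $\big(\frac{\partial}{\partial\overline z_j}-i\lambda_jz_j\frac{\partial}{\partial\theta}\big)f=0$, $j=1,\ldots,n-1$. *)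

theory Defs
  imports "HOL-Analysis.Analysis" "HOL-Library.Function_Algebras"
begin

text \<open>
  Throughout, the finite type \<open>'m\<close> indexes \<open>j = 1, \<dots>, n - 1\<close>, so that
  \<open>(complex ^ 'm) \<times> real\<close> is the universal covering space \<open>C^(n-1) \<times> R\<close> with coordinates
  \<open>(z, \<theta>)\<close>, and \<open>(complex ^ 'm) \<times> real \<times> complex\<close> carries the coordinates
  \<open>(z, \<theta>, \<eta>)\<close>.
\<close>

section \<open>The compact Heisenberg CR manifold\<close>

definition heis_lattice :: "(complex ^ 'm::finite) set" where
  "heis_lattice = {\<alpha>. \<exists>a b :: 'm \<Rightarrow> int. \<forall>j.
     \<alpha> $ j = of_real (sqrt (2 * pi)) * of_int (a j) + \<i> * of_real (sqrt (2 * pi)) * of_int (b j)}"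

definition heis_rel ::
    "('m::finite \<Rightarrow> int) \<Rightarrow> (((complex ^ 'm) \<times> real) \<times> ((complex ^ 'm) \<times> real)) set" where
  "heis_rel lam = {((z, \<theta>), (z', \<theta>')). z' - z \<in> heis_lattice \<and>
     (\<exists>m::int. complex_of_real (\<theta>' - \<theta>)
        - \<i> * (\<Sum>j\<in>UNIV. of_int (lam j) * (z $ j * cnj ((z' - z) $ j) - cnj (z $ j) * (z' - z) $ j))
        = complex_of_real pi * of_int m)}"

definition heis_manifold :: "('m::finite \<Rightarrow> int) \<Rightarrow> ((complex ^ 'm) \<times> real) set set" where
  "heis_manifold lam = UNIV // heis_rel lam"


section \<open>The generalized Sasakian line bundle and its tensor powers\<close>

definition sasaki_rel ::
    "('m::finite \<Rightarrow> int) \<Rightarrow> ('m \<Rightarrow> 'm \<Rightarrow> int) \<Rightarrow>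
      (((complex ^ 'm) \<times> real \<times> complex) \<times> ((complex ^ 'm) \<times> real \<times> complex)) set" where
  "sasaki_rel lam mu = {((z, \<theta>, \<eta>), (z', \<theta>', \<eta>')).
     ((z, \<theta>), (z', \<theta>')) \<in> heis_rel lam \<and>
     \<eta>' * exp (of_real \<theta>' + \<i> * (\<Sum>j\<in>UNIV. of_int (lam j) * of_real ((cmod (z' $ j))\<^sup>2)))
     = \<eta> * exp (of_real \<theta> + \<i> * (\<Sum>j\<in>UNIV. of_int (lam j) * of_real ((cmod (z $ j))\<^sup>2)))
         * exp (\<Sum>j\<in>UNIV. \<Sum>t\<in>UNIV. of_int (mu j t) *
             (z $ j * cnj ((z' - z) $ t) + 1 / 2 * (z' - z) $ j * cnj ((z' - z) $ t)))}"

definition sasaki_bundle ::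
    "('m::finite \<Rightarrow> int) \<Rightarrow> ('m \<Rightarrow> 'm \<Rightarrow> int) \<Rightarrow> ((complex ^ 'm) \<times> real \<times> complex) set set" where
  "sasaki_bundle lam mu = UNIV // sasaki_rel lam mu"

text \<open>
  If \<open>g\<close> is the transition factor of the bundle between two points of the covering space,
  i.e. \<open>(z, \<theta>, 1)\<close> and \<open>(z', \<theta>', g)\<close> are identified, then the transition factor of the
  \<open>k\<close>-th tensor power is \<open>g ^ k\<close>: the coordinate \<open>\<eta>\<close> over \<open>(z, \<theta>)\<close> stands for
  \<open>\<eta>\<close> times the \<open>k\<close>-fold tensor power of the class of \<open>(z, \<theta>, 1)\<close>.
\<close>

definition sasaki_power_rel ::
    "('m::finite \<Rightarrow> int) \<Rightarrow> ('m \<Rightarrow> 'm \<Rightarrow> int) \<Rightarrow> nat \<Rightarrow>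
      (((complex ^ 'm) \<times> real \<times> complex) \<times> ((complex ^ 'm) \<times> real \<times> complex)) set" where
  "sasaki_power_rel lam mu k = {((z, \<theta>, \<eta>), (z', \<theta>', \<eta>')).
     \<exists>g. ((z, \<theta>, 1), (z', \<theta>', g)) \<in> sasaki_rel lam mu \<and> \<eta>' = \<eta> * g ^ k}"

definition sasaki_power ::
    "('m::finite \<Rightarrow> int) \<Rightarrow> ('m \<Rightarrow> 'm \<Rightarrow> int) \<Rightarrow> nat \<Rightarrow> ((complex ^ 'm) \<times> real \<times> complex) set set" where
  "sasaki_power lam mu k = UNIV // sasaki_power_rel lam mu k"

text \<open>
  The projection of the bundle maps the class of \<open>(z, \<theta>, \<eta>)\<close> to the class of \<open>(z, \<theta>)\<close>;
  hence \<open>e\<close> lies over \<open>p\<close> iff all representatives of \<open>e\<close> have their base coordinates in \<open>p\<close>.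
\<close>

definition is_section ::
    "('m::finite \<Rightarrow> int) \<Rightarrow> ('m \<Rightarrow> 'm \<Rightarrow> int) \<Rightarrow> nat \<Rightarrow>
      (((complex ^ 'm) \<times> real) set \<Rightarrow> ((complex ^ 'm) \<times> real \<times> complex) set) \<Rightarrow> bool" where
  "is_section lam mu k s \<longleftrightarrow> (\<forall>p \<in> heis_manifold lam.
     s p \<in> sasaki_power lam mu k \<and> (\<forall>(z, \<theta>, \<eta>) \<in> s p. (z, \<theta>) \<in> p))"

definition represents ::
    "('m::finite \<Rightarrow> int) \<Rightarrow> ('m \<Rightarrow> 'm \<Rightarrow> int) \<Rightarrow> nat \<Rightarrow> ((complex ^ 'm) \<times> real \<Rightarrow> complex) \<Rightarrow>
      (((complex ^ 'm) \<times> real) set \<Rightarrow> ((complex ^ 'm) \<times> real \<times> complex) set) \<Rightarrow> bool" where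
  "represents lam mu k f s \<longleftrightarrow>
     (\<forall>z \<theta>. s (heis_rel lam `` {(z, \<theta>)}) = sasaki_power_rel lam mu k `` {(z, \<theta>, f (z, \<theta>))})"


section \<open>Smooth CR sections\<close>

fun k_smooth :: "nat \<Rightarrow> ('a::real_normed_vector \<Rightarrow> 'b::real_normed_vector) \<Rightarrow> bool" where
  "k_smooth 0 f \<longleftrightarrow> continuous_on UNIV f"
| "k_smooth (Suc r) f \<longleftrightarrow>
     (\<forall>x. f differentiable (at x)) \<and> (\<forall>v. k_smooth r (\<lambda>x. frechet_derivative f (at x) v))"

definition smooth :: "('a::real_normed_vector \<Rightarrow> 'b::real_normed_vector) \<Rightarrow> bool" where
  "smooth f \<longleftrightarrow> (\<forall>r. k_smooth r f)"

definition d_theta :: "((complex ^ 'm::finite) \<times> real \<Rightarrow> complex) \<Rightarrow> (complex ^ 'm) \<times> real \<Rightarrow> complex" where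
  "d_theta f x = frechet_derivative f (at x) (0, 1)"

text \<open>The Wirtinger derivative with respect to the conjugate of \<open>z $ j\<close>.\<close>

definition d_zbar ::
    "'m \<Rightarrow> ((complex ^ 'm::finite) \<times> real \<Rightarrow> complex) \<Rightarrow> (complex ^ 'm) \<times> real \<Rightarrow> complex" where
  "d_zbar j f x = (frechet_derivative f (at x) (axis j 1, 0)
                   + \<i> * frechet_derivative f (at x) (axis j \<i>, 0)) / 2"

definition is_CR :: "('m::finite \<Rightarrow> int) \<Rightarrow> ((complex ^ 'm) \<times> real \<Rightarrow> complex) \<Rightarrow> bool" where
  "is_CR lam f \<longleftrightarrow>
     (\<forall>j z \<theta>. d_zbar j f (z, \<theta>) - \<i> * of_int (lam j) * z $ j * d_theta f (z, \<theta>) = 0)"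

text \<open>
  A section and its coordinate function determine each other, and the vector space operations
  in the fibres are those of the coordinate \<open>\<eta>\<close>. The complex vector space of smooth CR
  sections is therefore taken to consist of the coordinate functions, with pointwise operations.
\<close>

definition CR_sections ::
    "('m::finite \<Rightarrow> int) \<Rightarrow> ('m \<Rightarrow> 'm \<Rightarrow> int) \<Rightarrow> nat \<Rightarrow> ((complex ^ 'm) \<times> real \<Rightarrow> complex) set" where
  "CR_sections lam mu k =
     {f. (\<exists>s. is_section lam mu k s \<and> represents lam mu k f s) \<and> smooth f \<and> is_CR lam f}"

definition scale_fun :: "complex \<Rightarrow> ('a \<Rightarrow> complex) \<Rightarrow> 'a \<Rightarrow> complex" where
  "scale_fun c f = (\<lambda>x. c * f x)"

interpretation cfun: vector_space scale_fun
  by unfold_locales (auto simp: scale_fun_def fun_eq_iff algebra_simps)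


section \<open>Levi form, condition Y(q), positive definiteness\<close>

text \<open>
  The matrix of the Levi form at \<open>p\<close> with respect to the orthonormal frame
  \<open>\<partial>/\<partial>z_j + i \<lambda>_j cnj z_j \<partial>/\<partial>\<theta>\<close> of the CR structure; it does not depend on \<open>p\<close>.
\<close>

definition levi_matrix ::
    "('m::finite \<Rightarrow> int) \<Rightarrow> ((complex ^ 'm) \<times> real) set \<Rightarrow> complex ^ 'm ^ 'm" where
  "levi_matrix lam p = (\<chi> j t. if j = t then of_int (lam j) else 0)"

definition eigenspace :: "complex ^ 'm ^ 'm \<Rightarrow> real \<Rightarrow> (complex ^ 'm::finite) set" where
  "eigenspace A x = {v. A *v v = complex_of_real x *s v}"

text \<open>The number, with multiplicity, of eigenvalues of a Hermitian matrix that lie in \<open>X\<close>.\<close>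

definition eigenvalue_count :: "complex ^ 'm ^ 'm::finite \<Rightarrow> real set \<Rightarrow> nat" where
  "eigenvalue_count A X = (\<Sum>x | x \<in> X \<and> eigenspace A x \<noteq> {0}. vec.dim (eigenspace A x))"

text \<open>
  Condition \<open>Y(q)\<close> for the Levi matrix \<open>A\<close> of a CR manifold of dimension \<open>2 n - 1\<close>, for
  \<open>0 \<le> q \<le> n - 1\<close>. The pairs of eigenvalues of opposite signs are disjoint pairs, as usual.
\<close>

definition condition_Y :: "nat \<Rightarrow> nat \<Rightarrow> complex ^ 'm ^ 'm::finite \<Rightarrow> bool" where
  "condition_Y n q A \<longleftrightarrow>
     (let n_pos = eigenvalue_count A {0<..}; n_neg = eigenvalue_count A {..<0} in
       n_pos \<ge> max (q + 1) (n - q) \<or> n_neg \<ge> max (q + 1) (n - q) \<or>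
       min n_pos n_neg \<ge> min (q + 1) (n - q))"

definition positive_definite :: "real ^ 'm ^ 'm::finite \<Rightarrow> bool" where
  "positive_definite A \<longleftrightarrow> transpose A = A \<and> (\<forall>v. v \<noteq> 0 \<longrightarrow> v \<bullet> (A *v v) > 0)"

end

theory Submission
  imports Defs "HOL-Complex_Analysis.Conformal_Mappings"
begin

text \<open>
  Put \<open>w = \<theta> + i \<Sum> \<lambda>_j |z_j|^2\<close>, a CR function. For a CR section \<open>f\<close> of \<open>L^k\<close> and an integer \<open>m\<close>,
  the mean of \<open>f exp ((k - 2 i m) w)\<close> over a fibre circle is an entire function of \<open>z\<close>; the
  transformation law of \<open>f\<close> makes it a theta function for the matrix \<open>M_m = k \<mu> + 4 m diag \<lambda>\<close>.
  Conversely a theta function \<open>h\<close> for \<open>M_m\<close> gives the CR section \<open>exp (- (k - 2 i m) w) h\<close>.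

  Condition \<open>Y(0)\<close> forces the \<open>\<lambda>_j\<close> to have both signs. Hence \<open>M_m\<close> has a negative diagonal entry for
  \<open>|m|\<close> large, and by Liouville's theorem the mode \<open>m\<close> vanishes; each of the finitely many other
  modes is determined by finitely many values (Schwarz lemma). So the space of sections is
  finite-dimensional, which is needed because \<open>dim\<close> is \<open>0\<close> for infinite-dimensional spaces.

  For \<open>0 \<le> m \<le> \<epsilon> k\<close> the matrix \<open>M_m\<close> is bounded below by a multiple of \<open>k\<close>, so there are of the order of
  \<open>k^(n-1)\<close> classes of frequencies \<open>p\<close> modulo \<open>2 M_m\<close>, each carrying a theta series. These are of the
  order of \<open>k^n\<close> independent sections.
\<close>

section \<open>Smooth functions and exponential series\<close>

text \<open>The transition functions of \<open>L^k\<close> carry the factor exp (- k (w' - w)), so a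
  section is multiplied by exp (- k pi) when \<theta> grows by pi. Multiplying by exp (k w) makes it
  periodic, and exp (- 2 i m w) is the character exp (- 2 i m \<theta>) of the fibre circle
  continued to a CR function. Over a lattice step \<alpha> the function w changes, modulo pi, by i
  (2 S (z, cnj \<alpha>) + S (\<alpha>, cnj \<alpha>)), where S (u, v) is the sum of the \<lambda>_j
  u_j v_j. Multiplied by - 2 i m this is the theta exponent of 4 m diag \<lambda>; this is the
  origin of the 4 in M_m. Integrality matters twice: it makes the exponentials of the theta
  exponents cocycles on the lattice, and it forces a negative diagonal entry of M_m to be at most -
  1, which gives quadratic decay. Independence needs no inner product. Rotation in \<theta>
  separates the modes, certain translations in z separate the frequency classes inside one mode, and
  both times the argument is that joint eigenfunctions with different eigenvalues are
  independent.\<close>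

lemma k_smooth_SucI:
  assumes "\<And>x. (f has_derivative f' x) (at x)" "\<And>v. k_smooth r (\<lambda>x. f' x v)"
  shows "k_smooth (Suc r) f"
proof -
  have "frechet_derivative f (at x) = f' x" for x
    using assms(1) frechet_derivative_at by metis
  with assms show ?thesis by (auto simp: differentiable_def)
qed

lemma k_smooth_Suc_has_derivative:
  assumes "k_smooth (Suc r) f"
  shows "(f has_derivative frechet_derivative f (at x)) (at x)"
  using assms frechet_derivative_works by auto

lemma k_smooth_SucD: "k_smooth (Suc r) f \<Longrightarrow> k_smooth r f"
proof (induction r arbitrary: f)
  case 0
  then have "continuous (at x) f" for x
    using k_smooth_Suc_has_derivative[OF 0] has_derivative_continuous by blast
  then show ?case by (simp add: continuous_at_imp_continuous_on)
next
  case (Suc r)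
  then show ?case by (metis k_smooth.simps(2))
qed

lemma k_smooth_const: "k_smooth r (\<lambda>x. c)"
proof (induction r arbitrary: c)
  case (Suc r)
  show ?case by (rule k_smooth_SucI[where f' = "\<lambda>x v. 0"]) (auto intro: Suc)
qed auto

lemma k_smooth_bounded_linear: "bounded_linear f \<Longrightarrow> k_smooth r f"
proof (cases r)
  case (Suc r')
  assume "bounded_linear f"
  then show ?thesis unfolding Suc
    by (intro k_smooth_SucI[where f' = "\<lambda>x. f"])
      (auto intro: k_smooth_const bounded_linear_imp_has_derivative)
qed (auto intro: linear_continuous_on)

lemma k_smooth_add:
  "k_smooth r f \<Longrightarrow> k_smooth r g \<Longrightarrow> k_smooth r (\<lambda>x. f x + g x)"
proof (induction r arbitrary: f g)
  case (Suc r)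
  then show ?case
    by (intro k_smooth_SucI[OF has_derivative_add[OF
        k_smooth_Suc_has_derivative[OF Suc.prems(1)] k_smooth_Suc_has_derivative[OF Suc.prems(2)]]])
      auto
qed (auto intro: continuous_intros)

lemma k_smooth_mult:
  fixes f g :: "'a::real_normed_vector \<Rightarrow> 'b::real_normed_algebra"
  shows "k_smooth r f \<Longrightarrow> k_smooth r g \<Longrightarrow> k_smooth r (\<lambda>x. f x * g x)"
proof (induction r arbitrary: f g)
  case (Suc r)
  show ?case
    by (rule k_smooth_SucI[OF has_derivative_mult[OF
        k_smooth_Suc_has_derivative[OF Suc.prems(1)] k_smooth_Suc_has_derivative[OF Suc.prems(2)]]])
      (intro k_smooth_add Suc.IH k_smooth_SucD[OF Suc.prems(1)] k_smooth_SucD[OF Suc.prems(2)],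
        use Suc.prems in auto)
qed (auto intro: continuous_intros)

lemma has_derivative_cexp:
  fixes f :: "'a::real_normed_vector \<Rightarrow> complex"
  assumes "(f has_derivative f') (at x within S)"
  shows "((\<lambda>x. exp (f x)) has_derivative (\<lambda>v. f' v * exp (f x))) (at x within S)"
  using has_derivative_compose[OF assms has_field_derivative_imp_has_derivative[OF DERIV_exp]]
  by (simp add: mult.commute)

lemma k_smooth_exp:
  fixes f :: "'a::real_normed_vector \<Rightarrow> complex"
  shows "k_smooth r f \<Longrightarrow> k_smooth r (\<lambda>x. exp (f x))"
proof (induction r arbitrary: f)
  case (Suc r)
  show ?case
    by (rule k_smooth_SucI[OF has_derivative_cexp[OF k_smooth_Suc_has_derivative[OF Suc.prems]]])
      (intro k_smooth_mult Suc.IH k_smooth_SucD[OF Suc.prems], use Suc.prems in simp)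
qed (auto intro: continuous_intros)

lemma k_smooth_sum:
  "(\<And>i. i \<in> I \<Longrightarrow> k_smooth r (f i)) \<Longrightarrow> k_smooth r (\<lambda>x. \<Sum>i\<in>I. f i x)"
  by (induction I rule: infinite_finite_induct) (auto intro: k_smooth_const k_smooth_add)

lemma smooth_has_derivative:
  "smooth f \<Longrightarrow> (f has_derivative frechet_derivative f (at x)) (at x)"
  unfolding smooth_def using k_smooth_Suc_has_derivative by blast

lemma smooth_continuous_on: "smooth f \<Longrightarrow> continuous_on S f"
  unfolding smooth_def using k_smooth.simps(1) continuous_on_subset by blast

lemma smooth_continuous_on_derivative:
  "smooth f \<Longrightarrow> continuous_on S (\<lambda>x. frechet_derivative f (at x) v)"
  unfolding smooth_def by (metis k_smooth.simps continuous_on_subset subset_UNIV)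

lemma smooth_const: "smooth (\<lambda>x. c)"
  and smooth_bounded_linear: "bounded_linear f \<Longrightarrow> smooth f"
  by (auto simp: smooth_def intro: k_smooth_const k_smooth_bounded_linear)

lemma smooth_add: "smooth f \<Longrightarrow> smooth g \<Longrightarrow> smooth (\<lambda>x. f x + g x)"
  by (auto simp: smooth_def intro: k_smooth_add)

lemma smooth_mult:
  fixes f g :: "'a::real_normed_vector \<Rightarrow> 'b::real_normed_algebra"
  shows "smooth f \<Longrightarrow> smooth g \<Longrightarrow> smooth (\<lambda>x. f x * g x)"
  by (auto simp: smooth_def intro: k_smooth_mult)

lemma smooth_exp:
  fixes f :: "'a::real_normed_vector \<Rightarrow> complex"
  shows "smooth f \<Longrightarrow> smooth (\<lambda>x. exp (f x))"
  by (auto simp: smooth_def intro: k_smooth_exp)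

lemma smooth_sum: "(\<And>i. i \<in> I \<Longrightarrow> smooth (f i)) \<Longrightarrow> smooth (\<lambda>x. \<Sum>i\<in>I. f i x)"
  by (auto simp: smooth_def intro: k_smooth_sum)

section \<open>Exponential series of linear functionals\<close>

lemma exp_ge_self: "x \<le> exp (x::real)"
  using exp_ge_add_one_self[of x] by linarith

lemma exp_series_summable_bound:
  fixes l :: "nat \<Rightarrow> 'a::real_normed_vector \<Rightarrow> complex"
  assumes le: "\<And>n x. norm (l n x) \<le> K n * norm x" and K: "\<And>n. K n \<ge> 0"
    and x: "norm x \<le> R"
  shows "norm (a n * exp (l n x)) \<le> norm (a n) * exp (R * K n)"
proof -
  have "Re (l n x) \<le> norm (l n x)" by (rule complex_Re_le_cmod)
  also have "\<dots> \<le> K n * norm x" by (rule le)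
  also have "\<dots> \<le> R * K n" using mult_left_mono[OF x K[of n]] by (simp add: mult.commute)
  finally show ?thesis by (simp add: norm_mult mult_left_mono)
qed

text \<open>The factor \<open>norm (l n v)\<close> is absorbed through K \<le> exp K, at the price
  of replacing \<open>R\<close> by \<open>R + 1\<close>. This is why summability is later demanded
  for all \<open>R\<close>.\<close>

lemma exp_series_derivative_bound:
  fixes l :: "nat \<Rightarrow> 'a::real_normed_vector \<Rightarrow> complex"
  assumes le: "\<And>n x. norm (l n x) \<le> K n * norm x" and K: "\<And>n. K n \<ge> 0"
    and x: "norm x \<le> R"
  shows "norm (a n * l n v * exp (l n x)) \<le> norm (a n) * exp ((R + 1) * K n) * norm v"
proof -
  have "norm (a n * l n v * exp (l n x)) = norm (l n v) * norm (a n * exp (l n x))"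
    by (simp add: norm_mult)
  also have "\<dots> \<le> (K n * norm v) * (norm (a n) * exp (R * K n))"
    by (intro mult_mono le exp_series_summable_bound[OF le K x]) (auto simp: K)
  also have "\<dots> \<le> (exp (K n) * norm v) * (norm (a n) * exp (R * K n))"
    by (intro mult_right_mono exp_ge_self) auto
  also have "\<dots> = norm (a n) * exp ((R + 1) * K n) * norm v"
    by (simp add: algebra_simps exp_add)
  finally show ?thesis .
qed

lemma exp_series_derivative_summable:
  fixes l :: "nat \<Rightarrow> 'a::real_normed_vector \<Rightarrow> complex"
  assumes le: "\<And>n x. norm (l n x) \<le> K n * norm x" and K: "\<And>n. K n \<ge> 0"
    and sum: "\<And>R. summable (\<lambda>n. norm (a n) * exp (R * K n))"
  shows "summable (\<lambda>n. a n * l n v * exp (l n x))"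
proof (rule summable_comparison_test'[where N = 0])
  show "norm (a n * l n v * exp (l n x)) \<le> norm (a n) * exp ((norm x + 1) * K n) * norm v" for n
    by (rule exp_series_derivative_bound[OF le K]) simp
  show "summable (\<lambda>n. norm (a n) * exp ((norm x + 1) * K n) * norm v)"
    by (intro summable_mult2 sum)
qed

text \<open>Termwise differentiation on a ball around the origin that contains \<open>x\<close>:
  there \<open>b\<close> majorises the derivatives uniformly, relative to the length of the
  direction, and its tails give the uniform convergence.\<close>

lemma exp_series_has_derivative:
  fixes l :: "nat \<Rightarrow> 'a::real_normed_vector \<Rightarrow> complex"
  assumes lin: "\<And>n. bounded_linear (l n)"
    and le: "\<And>n x. norm (l n x) \<le> K n * norm x" and K: "\<And>n. K n \<ge> 0"
    and sum: "\<And>R. summable (\<lambda>n. norm (a n) * exp (R * K n))"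
  shows "((\<lambda>x. \<Sum>n. a n * exp (l n x)) has_derivative (\<lambda>v. \<Sum>n. a n * l n v * exp (l n x))) (at x)"
proof -
  define R where "R = norm x + 1"
  have R: "R \<ge> 0" by (simp add: R_def)
  define b where "b n = norm (a n) * exp ((R + 1) * K n)" for n
  have bsum: "summable b" unfolding b_def by (rule sum)
  have main: "norm (a n * l n v * exp (l n y)) \<le> b n * norm v" if "y \<in> ball 0 R" for n v y
    unfolding b_def by (rule exp_series_derivative_bound[OF le K]) (use that in simp)
  note smb = exp_series_derivative_summable[where a = a, OF le K sum]
  have "\<exists>g. \<forall>y\<in>ball 0 R. (\<lambda>n. a n * exp (l n y)) sums g y \<and>
      (g has_derivative (\<lambda>v. \<Sum>n. a n * l n v * exp (l n y))) (at y within ball 0 R)"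
  proof (rule has_derivative_series[where f' = "\<lambda>n y v. a n * l n v * exp (l n y)"
        and x = 0 and l = "\<Sum>n. a n * exp (l n 0)"])
    show "((\<lambda>y. a n * exp (l n y)) has_derivative (\<lambda>v. a n * l n v * exp (l n y))) (at y within ball 0 R)" for n y
      using has_derivative_mult_right[OF has_derivative_cexp[OF bounded_linear_imp_has_derivative[OF lin[of n]]], of "a n"]
      by (simp add: mult.assoc)
    show "\<forall>\<^sub>F n in sequentially. \<forall>y\<in>ball 0 R. \<forall>h.
          norm ((\<Sum>i<n. a i * l i h * exp (l i y)) - (\<Sum>i. a i * l i h * exp (l i y))) \<le> e * norm h"
      if "e > 0" for e
    proof -
      have "(\<lambda>n. \<Sum>i. b (i + n)) \<longlonglongrightarrow> 0"
        using suminf_exist_split2[OF bsum] by (simp add: add.commute)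
      then have "\<forall>\<^sub>F n in sequentially. (\<Sum>i. b (i + n)) < e"
        using that by (rule order_tendstoD)
      then show ?thesis
      proof (eventually_elim, intro ballI allI)
        fix n y h assume n: "(\<Sum>i. b (i + n)) < e" and y: "y \<in> ball (0::'a) R"
        note s = smb[of h y]
        have "(\<Sum>i<n. a i * l i h * exp (l i y)) - (\<Sum>i. a i * l i h * exp (l i y))
            = - (\<Sum>i. a (i+n) * l (i+n) h * exp (l (i+n) y))"
          using suminf_minus_initial_segment[OF s, of n] by simp
        also have "norm \<dots> \<le> (\<Sum>i. b (i+n) * norm h)"
          unfolding norm_minus_cancel
          by (intro norm_suminf_le main y summable_mult2) (use bsum in \<open>simp add: summable_iff_shift\<close>)
        also have "\<dots> = (\<Sum>i. b (i+n)) * norm h"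
          by (intro suminf_mult2[symmetric]) (use bsum in \<open>simp add: summable_iff_shift\<close>)
        also have "\<dots> \<le> e * norm h" using n by (intro mult_right_mono) auto
        finally show "norm ((\<Sum>i<n. a i * l i h * exp (l i y)) - (\<Sum>i. a i * l i h * exp (l i y))) \<le> e * norm h" .
      qed
    qed
    show "(\<lambda>n. a n * exp (l n 0)) sums (\<Sum>n. a n * exp (l n 0))"
    proof (rule summable_sums, rule summable_comparison_test'[where N = 0])
      show "norm (a n * exp (l n 0)) \<le> norm (a n) * exp (0 * K n)" for n
        by (rule exp_series_summable_bound[OF le K]) auto
    qed (rule sum)
  qed (use R in \<open>auto simp: R_def add_nonneg_pos\<close>)
  then obtain g where g: "\<And>y. y \<in> ball 0 R \<Longrightarrow> (\<lambda>n. a n * exp (l n y)) sums g y"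
      "\<And>y. y \<in> ball 0 R \<Longrightarrow> (g has_derivative (\<lambda>v. \<Sum>n. a n * l n v * exp (l n y))) (at y within ball 0 R)"
    by blast
  have x: "x \<in> ball 0 R" by (simp add: R_def)
  have "((\<lambda>x. \<Sum>n. a n * exp (l n x)) has_derivative (\<lambda>v. \<Sum>n. a n * l n v * exp (l n x))) (at x within ball 0 R)"
    by (rule has_derivative_transform[OF x _ g(2)[OF x]]) (simp add: sums_unique[OF g(1)])
  then show ?thesis by (simp only: at_within_open[OF x open_ball])
qed

text \<open>Differentiating in direction \<open>v\<close> gives a series of the same kind with
  coefficients \<open>a n * l n v\<close>, which again satisfy the summability hypothesis for all
  \<open>R\<close>. Hence the induction over the order runs over all coefficient sequences.\<close>

lemma exp_series_smooth:
  fixes l :: "nat \<Rightarrow> 'a::real_normed_vector \<Rightarrow> complex"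
  assumes lin: "\<And>n. bounded_linear (l n)"
    and le: "\<And>n x. norm (l n x) \<le> K n * norm x" and K: "\<And>n. K n \<ge> 0"
    and "\<And>R. summable (\<lambda>n. norm (a n) * exp (R * K n))"
  shows "smooth (\<lambda>x. \<Sum>n. a n * exp (l n x))"
proof -
  have "k_smooth r (\<lambda>x. \<Sum>n. a n * exp (l n x))"
    if "\<And>R. summable (\<lambda>n. norm (a n) * exp (R * K n))" for r a
    using that
  proof (induction r arbitrary: a)
    case 0
    show ?case
      using has_derivative_continuous[OF exp_series_has_derivative[OF lin le K 0]]
      by (auto intro!: continuous_at_imp_continuous_on)
  next
    case (Suc r)
    show ?case
    proof (rule k_smooth_SucI[OF exp_series_has_derivative[OF lin le K Suc.prems]], rule Suc.IH)
      fix v R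
      show "summable (\<lambda>n. norm (a n * l n v) * exp (R * K n))"
      proof (rule summable_comparison_test'[where N = 0])
        show "summable (\<lambda>n. norm v * (norm (a n) * exp ((R + 1) * K n)))"
          by (intro summable_mult Suc.prems)
        fix n
        have "norm (l n v) \<le> exp (K n) * norm v"
          by (intro order_trans[OF le] mult_right_mono exp_ge_self) auto
        then have "norm (a n) * norm (l n v) * exp (R * K n) \<le> norm (a n) * (exp (K n) * norm v) * exp (R * K n)"
          by (intro mult_right_mono mult_left_mono) auto
        then show "norm (norm (a n * l n v) * exp (R * K n)) \<le> norm v * (norm (a n) * exp ((R + 1) * K n))"
          by (simp add: norm_mult algebra_simps exp_add)
      qed
    qed
  qed
  with assms(4) show ?thesis by (simp add: smooth_def)
qed

section \<open>The bundle as a system of factors of automorphy\<close>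

definition cnjv :: "complex ^ 'm \<Rightarrow> complex ^ 'm" where
  "cnjv u = (\<chi> j. cnj (u $ j))"

text \<open>Complex bilinear, with conjugates inserted through \<open>cnjv\<close>: the Hermitian
  form of a symmetric \<open>A\<close> is \<open>bilin A u (cnjv v)\<close>, while
  \<open>bilin A z z\<close> is holomorphic in \<open>z\<close> and serves as prefactor of the theta
  series.\<close>

definition bilin :: "('m \<Rightarrow> 'm \<Rightarrow> int) \<Rightarrow> complex ^ 'm \<Rightarrow> complex ^ 'm::finite \<Rightarrow> complex" where
  "bilin A u v = (\<Sum>j\<in>UNIV. \<Sum>t\<in>UNIV. of_int (A j t) * (u $ j * v $ t))"

lemma cnjv_nth [simp]: "cnjv u $ j = cnj (u $ j)"
  by (simp add: cnjv_def)

lemma cnjv_simps [simp]: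
  "cnjv (u + v) = cnjv u + cnjv v" "cnjv (u - v) = cnjv u - cnjv v" "cnjv (- u) = - cnjv u"
  "cnjv (c *s u) = cnj c *s cnjv u" "cnjv 0 = 0" "cnjv (cnjv u) = u"
  by (auto simp: vec_eq_iff)

lemma bilin_simps:
  "bilin A (u + u') v = bilin A u v + bilin A u' v"
  "bilin A u (v + v') = bilin A u v + bilin A u v'"
  "bilin A (u - u') v = bilin A u v - bilin A u' v"
  "bilin A u (v - v') = bilin A u v - bilin A u v'"
  "bilin A (- u) v = - bilin A u v"
  "bilin A u (- v) = - bilin A u v"
  "bilin A (c *s u) v = c * bilin A u v"
  "bilin A u (c *s v) = c * bilin A u v"
  "bilin A 0 v = 0" "bilin A u 0 = 0"
  by (simp_all add: bilin_def algebra_simps sum.distrib sum_subtractf sum_negf sum_distrib_left)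

lemma bilin_commute: "(\<And>j t. A j t = A t j) \<Longrightarrow> bilin A u v = bilin A v u"
  unfolding bilin_def by (subst sum.swap) (simp add: mult.commute)

lemma cnj_bilin: "cnj (bilin A u v) = bilin A (cnjv u) (cnjv v)"
  by (simp add: bilin_def)

lemma heis_lattice_0 [simp]: "0 \<in> heis_lattice"
  unfolding heis_lattice_def by (auto intro!: exI[of _ "\<lambda>_. 0"])

lemma heis_lattice_uminus: assumes "\<alpha> \<in> heis_lattice" shows "- \<alpha> \<in> heis_lattice"
proof -
  obtain a b :: "'a \<Rightarrow> int" where
    "\<And>j. \<alpha> $ j = of_real (sqrt (2 * pi)) * of_int (a j) + \<i> * of_real (sqrt (2 * pi)) * of_int (b j)"
    using assms unfolding heis_lattice_def by blast
  then show ?thesis unfolding heis_lattice_def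
    by - (intro CollectI, rule exI[of _ "\<lambda>j. - a j"], rule exI[of _ "\<lambda>j. - b j"], simp add: algebra_simps)
qed

lemma heis_lattice_add:
  assumes "\<alpha> \<in> heis_lattice" "\<beta> \<in> heis_lattice" shows "\<alpha> + \<beta> \<in> heis_lattice"
proof -
  obtain a b c d :: "'a \<Rightarrow> int" where
    "\<And>j. \<alpha> $ j = of_real (sqrt (2 * pi)) * of_int (a j) + \<i> * of_real (sqrt (2 * pi)) * of_int (b j)"
    "\<And>j. \<beta> $ j = of_real (sqrt (2 * pi)) * of_int (c j) + \<i> * of_real (sqrt (2 * pi)) * of_int (d j)"
    using assms unfolding heis_lattice_def by blast
  then show ?thesis unfolding heis_lattice_def
    by - (intro CollectI, rule exI[of _ "\<lambda>j. a j + c j"], rule exI[of _ "\<lambda>j. b j + d j"], simp add: algebra_simps)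
qed

text \<open>The mesh \<open>sqrt (2 * pi)\<close> of the lattice squares to 2 pi. This integrality
  is what makes the congruences modulo pi and the factors for integer matrices compatible with
  composition.\<close>

lemma heis_lattice_Im_mult_cnj:
  assumes "\<alpha> \<in> heis_lattice" "\<beta> \<in> heis_lattice"
  obtains n :: "'m \<Rightarrow> 'm::finite \<Rightarrow> int" where "\<And>j t. Im (\<alpha> $ j * cnj (\<beta> $ t)) = 2 * pi * of_int (n j t)"
proof -
  obtain a b c d :: "'m \<Rightarrow> int" where
    "\<And>j. \<alpha> $ j = of_real (sqrt (2 * pi)) * of_int (a j) + \<i> * of_real (sqrt (2 * pi)) * of_int (b j)"
    "\<And>j. \<beta> $ j = of_real (sqrt (2 * pi)) * of_int (c j) + \<i> * of_real (sqrt (2 * pi)) * of_int (d j)"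
    using assms unfolding heis_lattice_def by blast
  then have "Im (\<alpha> $ j * cnj (\<beta> $ t)) = (sqrt (2 * pi))\<^sup>2 * (b j * c t - a j * d t)" for j t
    by (simp add: power2_eq_square algebra_simps del: real_sqrt_mult real_sqrt_pow2 real_sqrt_mult_self)
  then have "Im (\<alpha> $ j * cnj (\<beta> $ t)) = 2 * pi * of_int (b j * c t - a j * d t)" for j t
    by simp
  then show ?thesis by (rule that[of "\<lambda>j t. b j * c t - a j * d t"])
qed

text \<open>The twist of the Heisenberg group law in real form, by i (a - cnj a) = - 2 Im a. It is
  additive in both arguments and alternating.\<close>

definition heis_phase :: "('m::finite \<Rightarrow> int) \<Rightarrow> complex ^ 'm \<Rightarrow> complex ^ 'm \<Rightarrow> real" where
  "heis_phase lam u v = - 2 * (\<Sum>j\<in>UNIV. of_int (lam j) * Im (u $ j * cnj (v $ j)))"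

lemma heis_phase_simps:
  "heis_phase lam (u + u') v = heis_phase lam u v + heis_phase lam u' v"
  "heis_phase lam u (v + v') = heis_phase lam u v + heis_phase lam u v'"
  "heis_phase lam u (- v) = - heis_phase lam u v"
  "heis_phase lam u 0 = 0" "heis_phase lam u u = 0"
  by (simp_all add: heis_phase_def algebra_simps sum.distrib sum_negf sum_subtractf)

lemma heis_phase_lattice:
  assumes "\<alpha> \<in> heis_lattice" "\<beta> \<in> heis_lattice"
  obtains n :: int where "heis_phase lam \<alpha> \<beta> = pi * of_int n"
proof -
  obtain n where n: "\<And>j t. Im (\<alpha> $ j * cnj (\<beta> $ t)) = 2 * pi * of_int (n j t)"
    using heis_lattice_Im_mult_cnj[OF assms] by blast
  have "heis_phase lam \<alpha> \<beta> = pi * of_int (- 4 * (\<Sum>j\<in>UNIV. lam j * n j j))"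
    unfolding heis_phase_def n by (simp add: sum_distrib_left mult_ac)
  with that show ?thesis by blast
qed

lemma of_real_heis_phase:
  "of_real (heis_phase lam u v)
     = \<i> * (\<Sum>j\<in>UNIV. of_int (lam j) * (u $ j * cnj (v $ j) - cnj (u $ j) * v $ j))"
proof -
  have "of_real (- 2 * (of_int l * Im (a * cnj b))) = \<i> * (of_int l * (a * cnj b - cnj a * b))" for l a b
    by (simp add: complex_eq_iff algebra_simps)
  then show ?thesis
    unfolding heis_phase_def sum_distrib_left of_real_sum by simp
qed

lemma heis_rel_iff:
  "(x, x') \<in> heis_rel lam \<longleftrightarrow> fst x' - fst x \<in> heis_lattice \<and>
     (\<exists>m::int. snd x' - snd x = heis_phase lam (fst x) (fst x' - fst x) + pi * of_int m)"
proof -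
  obtain z \<theta> z' \<theta>' where x: "x = (z, \<theta>)" "x' = (z', \<theta>')" by fastforce
  have "\<i> * (\<Sum>j\<in>UNIV. of_int (lam j) * (z $ j * cnj ((z' - z) $ j) - cnj (z $ j) * (z' - z) $ j))
      = of_real (heis_phase lam z (z' - z))"
    by (simp only: of_real_heis_phase)
  moreover have "of_real a - of_real b = complex_of_real pi * of_int m \<longleftrightarrow> a = b + pi * of_int m" for a b m
    by (auto simp: complex_eq_iff)
  ultimately show ?thesis
    unfolding x heis_rel_def by (simp only: mem_Collect_eq prod.case fst_conv snd_conv)
qed

text \<open>Symmetry rests on \<open>heis_phase lam u u = 0\<close>. In transitivity the cross term
  is the phase of two lattice vectors, an integer multiple of pi, which the congruence
  absorbs.\<close>

lemma equiv_heis_rel: "equiv UNIV (heis_rel lam)"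
proof (rule equivI)
  show "refl (heis_rel lam)"
    by (auto simp: refl_on_def heis_rel_iff heis_phase_simps intro!: exI[of _ 0])
  show "sym (heis_rel lam)"
  proof (rule symI)
    fix x x' assume "(x, x') \<in> heis_rel lam"
    then obtain m :: int where m: "fst x' - fst x \<in> heis_lattice"
      "snd x' - snd x = heis_phase lam (fst x) (fst x' - fst x) + pi * of_int m"
      by (auto simp: heis_rel_iff)
    have "heis_phase lam (fst x') (fst x - fst x') = - heis_phase lam (fst x + (fst x' - fst x)) (fst x' - fst x)"
      by (simp add: heis_phase_simps(3)[symmetric])
    also have "\<dots> = - heis_phase lam (fst x) (fst x' - fst x)"
      by (simp only: heis_phase_simps)
    finally show "(x', x) \<in> heis_rel lam"
      using m heis_lattice_uminus[OF m(1)]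
      by (auto simp: heis_rel_iff intro!: exI[of _ "- m"])
  qed
  show "trans (heis_rel lam)"
  proof (rule transI)
    fix x y y' assume "(x, y) \<in> heis_rel lam" "(y, y') \<in> heis_rel lam"
    then obtain m m' :: int where m: "fst y - fst x \<in> heis_lattice" "fst y' - fst y \<in> heis_lattice"
      "snd y - snd x = heis_phase lam (fst x) (fst y - fst x) + pi * of_int m"
      "snd y' - snd y = heis_phase lam (fst y) (fst y' - fst y) + pi * of_int m'"
      by (auto simp: heis_rel_iff)
    obtain n :: int where n: "heis_phase lam (fst y - fst x) (fst y' - fst y) = pi * of_int n"
      using heis_phase_lattice[OF m(1,2)] by blast
    have "snd y' - snd x = heis_phase lam (fst x) (fst y - fst x) + heis_phase lam (fst y) (fst y' - fst y)
      + pi * of_int (m + m')"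
      using m by (simp add: algebra_simps)
    also have "heis_phase lam (fst y) (fst y' - fst y)
       = heis_phase lam (fst x + (fst y - fst x)) (fst y' - fst y)" by simp
    also have "heis_phase lam (fst x) (fst y - fst x) + \<dots>
       = heis_phase lam (fst x) ((fst y - fst x) + (fst y' - fst y)) + pi * of_int n"
      by (simp only: heis_phase_simps n)
    finally have "snd y' - snd x = heis_phase lam (fst x) (fst y' - fst x) + pi * of_int (n + m + m')"
      by (simp add: algebra_simps)
    moreover have "fst y' - fst x \<in> heis_lattice"
      using heis_lattice_add[OF m(1,2)] by simp
    ultimately show "(x, y') \<in> heis_rel lam" unfolding heis_rel_iff by blast
  qed
qed simp

section \<open>Factors of automorphy and equivariant functions\<close>

definition heis_w :: "('m::finite \<Rightarrow> int) \<Rightarrow> (complex ^ 'm) \<times> real \<Rightarrow> complex" where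
  "heis_w lam x = of_real (snd x) + \<i> * (\<Sum>j\<in>UNIV. of_int (lam j) * (fst x $ j * cnj (fst x $ j)))"

text \<open>For symmetric \<open>A\<close> the exponential of this is the Appell-Humbert factor of
  the Hermitian form bilin A u (cnjv v) / pi. The imaginary part of that form takes even values on
  the lattice, so the trivial semicharacter is allowed.\<close>

definition theta_exponent :: "('m \<Rightarrow> 'm \<Rightarrow> int) \<Rightarrow> complex ^ 'm \<Rightarrow> complex ^ 'm::finite \<Rightarrow> complex" where
  "theta_exponent A z \<alpha> = bilin A z (cnjv \<alpha>) + bilin A \<alpha> (cnjv \<alpha>) / 2"

definition sasaki_factor ::
    "('m::finite \<Rightarrow> int) \<Rightarrow> ('m \<Rightarrow> 'm \<Rightarrow> int) \<Rightarrow> (complex ^ 'm) \<times> real \<Rightarrow> (complex ^ 'm) \<times> real \<Rightarrow> complex" where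
  "sasaki_factor lam mu x x' =
     exp (heis_w lam x - heis_w lam x' + theta_exponent mu (fst x) (fst x' - fst x))"

lemma sasaki_factor_refl: "sasaki_factor lam mu x x = 1"
  by (simp add: sasaki_factor_def theta_exponent_def bilin_simps)

lemma sasaki_rel_iff:
  "((z, \<theta>, \<eta>), (z', \<theta>', \<eta>')) \<in> sasaki_rel lam mu \<longleftrightarrow>
     ((z, \<theta>), (z', \<theta>')) \<in> heis_rel lam \<and> \<eta>' = \<eta> * sasaki_factor lam mu (z, \<theta>) (z', \<theta>')"
proof -
  have "(\<Sum>j\<in>UNIV. \<Sum>t\<in>UNIV. of_int (mu j t) *
         (z $ j * cnj ((z' - z) $ t) + 1 / 2 * (z' - z) $ j * cnj ((z' - z) $ t)))
      = theta_exponent mu z (z' - z)"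
    unfolding theta_exponent_def bilin_def sum_divide_distrib sum.distrib[symmetric]
    by (intro sum.cong refl) (simp add: field_simps)
  moreover have "of_real \<theta> + \<i> * (\<Sum>j\<in>UNIV. of_int (lam j) * of_real ((cmod (z $ j))\<^sup>2))
      = heis_w lam (z, \<theta>)" for z \<theta>
    unfolding heis_w_def by (simp add: complex_norm_square[symmetric])
  moreover have "\<eta>' * exp a = \<eta> * exp b * exp c \<longleftrightarrow> \<eta>' = \<eta> * exp (b - a + c)" for a b c :: complex
    by (auto simp: exp_add exp_diff field_simps)
  ultimately show ?thesis
    by (simp add: sasaki_rel_def sasaki_factor_def)
qed

lemma sasaki_power_rel_iff:
  "((z, \<theta>, \<eta>), (z', \<theta>', \<eta>')) \<in> sasaki_power_rel lam mu k \<longleftrightarrow>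
     ((z, \<theta>), (z', \<theta>')) \<in> heis_rel lam \<and> \<eta>' = \<eta> * sasaki_factor lam mu (z, \<theta>) (z', \<theta>') ^ k"
  by (auto simp: sasaki_power_rel_def sasaki_rel_iff)

lemma exp_plus_of_int_2pi_i: "exp (z + 2 * of_int n * of_real pi * \<i>) = exp (z::complex)"
  unfolding exp_eq by (rule exI[of _ n]) simp

text \<open>The exponents differ by half the antisymmetrised Hermitian form, that is by i Im (bilin
  A \<alpha> (cnjv \<beta>)), an integer multiple of 2 pi i on the lattice.\<close>

lemma exp_theta_exponent_add:
  assumes sym: "\<And>j t. A j t = A t j" and "\<alpha> \<in> heis_lattice" "\<beta> \<in> heis_lattice"
  shows "exp (theta_exponent A z \<alpha>) * exp (theta_exponent A (z + \<alpha>) \<beta>) = exp (theta_exponent A z (\<alpha> + \<beta>))"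
proof -
  obtain n where n: "\<And>j t. Im (\<alpha> $ j * cnj (\<beta> $ t)) = 2 * pi * of_int (n j t)"
    using heis_lattice_Im_mult_cnj[OF assms(2,3)] by blast
  have "bilin A \<alpha> (cnjv \<beta>) - bilin A \<beta> (cnjv \<alpha>) = bilin A \<alpha> (cnjv \<beta>) - cnj (bilin A \<alpha> (cnjv \<beta>))"
    by (simp add: cnj_bilin bilin_commute[of A \<beta>, OF sym])
  also have "\<dots> = 2 * \<i> * of_real (Im (bilin A \<alpha> (cnjv \<beta>)))"
    by (simp add: complex_eq_iff)
  also have "Im (bilin A \<alpha> (cnjv \<beta>)) = 2 * pi * of_int (\<Sum>j\<in>UNIV. \<Sum>t\<in>UNIV. A j t * n j t)"
  proof -
    have "Im (of_int l * c) = of_int l * Im c" for l c by simp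
    then show ?thesis
      unfolding bilin_def cnjv_nth Im_sum by (simp only: n) (simp add: sum_distrib_left mult_ac)
  qed
  finally have "theta_exponent A z \<alpha> + theta_exponent A (z + \<alpha>) \<beta>
      = theta_exponent A z (\<alpha> + \<beta>) + 2 * of_int (\<Sum>j\<in>UNIV. \<Sum>t\<in>UNIV. A j t * n j t) * of_real pi * \<i>"
    unfolding theta_exponent_def by (simp add: bilin_simps add_divide_distrib) (simp add: field_simps)
  then show ?thesis
    by (simp only: exp_add[symmetric] exp_plus_of_int_2pi_i)
qed

lemma sasaki_factor_trans:
  assumes sym: "\<And>j t. mu j t = mu t j" and "(x, y) \<in> heis_rel lam" "(y, y') \<in> heis_rel lam"
  shows "sasaki_factor lam mu x y * sasaki_factor lam mu y y' = sasaki_factor lam mu x y'"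
proof -
  have "exp (theta_exponent mu (fst x) (fst y - fst x)) * exp (theta_exponent mu (fst y) (fst y' - fst y))
      = exp (theta_exponent mu (fst x) (fst y' - fst x))"
    using exp_theta_exponent_add[of mu "fst y - fst x" "fst y' - fst y" "fst x", OF sym] assms(2,3)
    by (simp add: heis_rel_iff)
  then show ?thesis
    by (simp add: sasaki_factor_def exp_add exp_diff field_simps)
qed

lemma equiv_sasaki_power_rel:
  assumes sym: "\<And>j t. mu j t = mu t j"
  shows "equiv UNIV (sasaki_power_rel lam mu k)"
proof (rule equivI)
  note eq = equiv_heis_rel[of lam, unfolded equiv_def]
  show "refl (sasaki_power_rel lam mu k)"
    using eq by (auto simp: refl_on_def sasaki_power_rel_iff sasaki_factor_refl)
  show "sym (sasaki_power_rel lam mu k)"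
  proof (rule symI, clarify)
    fix z \<theta> \<eta> z' \<theta>' \<eta>' assume "((z, \<theta>, \<eta>), (z', \<theta>', \<eta>')) \<in> sasaki_power_rel lam mu k"
    then have 1: "((z, \<theta>), (z', \<theta>')) \<in> heis_rel lam"
      and 2: "\<eta>' = \<eta> * sasaki_factor lam mu (z, \<theta>) (z', \<theta>') ^ k"
      by (auto simp: sasaki_power_rel_iff)
    have 3: "((z', \<theta>'), (z, \<theta>)) \<in> heis_rel lam" using eq 1 by (meson symD)
    show "((z', \<theta>', \<eta>'), (z, \<theta>, \<eta>)) \<in> sasaki_power_rel lam mu k"
      using sasaki_factor_trans[of mu, OF sym 1 3] 3
      by (simp add: sasaki_power_rel_iff 2 power_mult_distrib[symmetric] sasaki_factor_refl mult.assoc)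
  qed
  show "trans (sasaki_power_rel lam mu k)"
  proof (rule transI, clarify)
    fix z \<theta> \<eta> z' \<theta>' \<eta>' z'' \<theta>'' \<eta>''
    assume "((z, \<theta>, \<eta>), (z', \<theta>', \<eta>')) \<in> sasaki_power_rel lam mu k"
      "((z', \<theta>', \<eta>'), (z'', \<theta>'', \<eta>'')) \<in> sasaki_power_rel lam mu k"
    then have 1: "((z, \<theta>), (z', \<theta>')) \<in> heis_rel lam" "((z', \<theta>'), (z'', \<theta>'')) \<in> heis_rel lam"
      and 2: "\<eta>' = \<eta> * sasaki_factor lam mu (z, \<theta>) (z', \<theta>') ^ k"
        "\<eta>'' = \<eta>' * sasaki_factor lam mu (z', \<theta>') (z'', \<theta>'') ^ k"
      by (auto simp: sasaki_power_rel_iff)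
    have 3: "((z, \<theta>), (z'', \<theta>'')) \<in> heis_rel lam" using eq 1 by (meson transD)
    show "((z, \<theta>, \<eta>), (z'', \<theta>'', \<eta>'')) \<in> sasaki_power_rel lam mu k"
      using sasaki_factor_trans[of mu, OF sym 1] 3
      by (simp add: sasaki_power_rel_iff 2 power_mult_distrib[symmetric] mult.assoc)
  qed
qed simp

text \<open>From here on sections are equivariant functions on the covering space. For the converse,
  \<open>s p\<close> is formed from an arbitrary representative of \<open>p\<close>, and
  equivariance makes the class independent of the choice.\<close>

lemma represents_section_iff:
  assumes sym: "\<And>j t. mu j t = mu t j"
  shows "(\<exists>s. is_section lam mu k s \<and> represents lam mu k f s) \<longleftrightarrow>
    (\<forall>x x'. (x, x') \<in> heis_rel lam \<longrightarrow> f x' = f x * sasaki_factor lam mu x x' ^ k)"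
proof (intro iffI allI impI)
  note eq = equiv_sasaki_power_rel[of mu lam k, OF sym]
  fix x x' assume "\<exists>s. is_section lam mu k s \<and> represents lam mu k f s" and xx': "(x, x') \<in> heis_rel lam"
  then obtain s where s: "represents lam mu k f s" by blast
  obtain z \<theta> z' \<theta>' where x: "x = (z, \<theta>)" "x' = (z', \<theta>')" by fastforce
  have "sasaki_power_rel lam mu k `` {(z, \<theta>, f x)} = sasaki_power_rel lam mu k `` {(z', \<theta>', f x')}"
    using s equiv_class_eq[OF equiv_heis_rel xx'] unfolding represents_def x by metis
  then have "((z, \<theta>, f x), (z', \<theta>', f x')) \<in> sasaki_power_rel lam mu k"
    using eq by (simp add: eq_equiv_class_iff)
  then show "f x' = f x * sasaki_factor lam mu x x' ^ k"
    by (simp add: sasaki_power_rel_iff x)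
next
  note eq = equiv_sasaki_power_rel[of mu lam k, OF sym]
  assume f: "\<forall>x x'. (x, x') \<in> heis_rel lam \<longrightarrow> f x' = f x * sasaki_factor lam mu x x' ^ k"
  define s where "s p = (let x = (SOME x. x \<in> p) in sasaki_power_rel lam mu k `` {(fst x, snd x, f x)})" for p
  have rep: "(x, SOME y. y \<in> heis_rel lam `` {x}) \<in> heis_rel lam" for x
  proof -
    have "x \<in> heis_rel lam `` {x}" using equiv_class_self[OF equiv_heis_rel] by blast
    then have "(SOME y. y \<in> heis_rel lam `` {x}) \<in> heis_rel lam `` {x}" by (rule someI)
    then show ?thesis by simp
  qed
  have s_eq: "s (heis_rel lam `` {x}) = sasaki_power_rel lam mu k `` {(fst x, snd x, f x)}" for x
  proof -
    define y where "y = (SOME y. y \<in> heis_rel lam `` {x})"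
    have "((fst x, snd x, f x), (fst y, snd y, f y)) \<in> sasaki_power_rel lam mu k"
      using f[rule_format, OF rep[of x]] rep[of x] by (simp add: sasaki_power_rel_iff y_def[symmetric] del: Image_singleton_iff)
    then show ?thesis
      unfolding s_def Let_def y_def[symmetric] by (rule equiv_class_eq[OF eq, symmetric])
  qed
  have "is_section lam mu k s"
    unfolding is_section_def
  proof
    fix p assume "p \<in> heis_manifold lam"
    then obtain x where p: "p = heis_rel lam `` {x}" by (auto simp: heis_manifold_def elim: quotientE)
    show "s p \<in> sasaki_power lam mu k \<and> (\<forall>(z, \<theta>, \<eta>)\<in>s p. (z, \<theta>) \<in> p)"
      unfolding p s_eq by (auto simp: sasaki_power_def sasaki_power_rel_iff intro: quotientI)
  qed
  then show "\<exists>s. is_section lam mu k s \<and> represents lam mu k f s"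
    using s_eq by (auto simp: represents_def)
qed

lemma CR_sections_iff:
  assumes "\<And>j t. mu j t = mu t j"
  shows "f \<in> CR_sections lam mu k \<longleftrightarrow> smooth f \<and> is_CR lam f \<and>
    (\<forall>x x'. (x, x') \<in> heis_rel lam \<longrightarrow> f x' = f x * sasaki_factor lam mu x x' ^ k)"
  unfolding CR_sections_def mem_Collect_eq represents_section_iff[of mu, OF assms] by blast

section \<open>The factor of automorphy of a Fourier mode\<close>

definition mode_matrix ::
    "('m \<Rightarrow> int) \<Rightarrow> ('m \<Rightarrow> 'm \<Rightarrow> int) \<Rightarrow> nat \<Rightarrow> int \<Rightarrow> 'm \<Rightarrow> 'm \<Rightarrow> int" where
  "mode_matrix lam mu k m j t = int k * mu j t + (if j = t then 4 * m * lam j else 0)"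

lemma mode_matrix_commute:
  "(\<And>j t. mu j t = mu t j) \<Longrightarrow> mode_matrix lam mu k m j t = mode_matrix lam mu k m t j"
  by (simp add: mode_matrix_def)

lemma bilin_mode_matrix:
  "bilin (mode_matrix lam mu k m) u v
     = of_nat k * bilin mu u v + 4 * of_int m * (\<Sum>j\<in>UNIV. of_int (lam j) * (u $ j * v $ j))"
proof -
  have "(\<Sum>t\<in>UNIV. (if j = t then of_int (4 * m * lam j) else 0) * (u $ j * v $ t))
      = 4 * of_int m * (of_int (lam j) * (u $ j * v $ j))" for j
    by (subst sum.mono_neutral_right[of UNIV "{j}"]) auto
  moreover have "of_int (mode_matrix lam mu k m j t) * c
      = of_nat k * (of_int (mu j t) * c) + (if j = t then of_int (4 * m * lam j) else 0) * c" for j t and c :: complex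
    by (simp add: mode_matrix_def algebra_simps)
  ultimately show ?thesis
    unfolding bilin_def by (simp only: sum.distrib sum_distrib_left[symmetric])
qed

definition mode_coeff :: "nat \<Rightarrow> int \<Rightarrow> complex" where
  "mode_coeff k m = of_nat k - 2 * \<i> * of_int m"

text \<open>The \<open>k\<close> in \<open>mode_coeff\<close> cancels the bundle's exp (- k (w' -
  w)). The freedom \<open>m0\<close> in \<theta> survives only as - 2 pi i m m0, which the
  exponential does not see.\<close>

lemma sasaki_factor_mode:
  assumes "(x, x') \<in> heis_rel lam"
  shows "sasaki_factor lam mu x x' ^ k * exp (mode_coeff k m * (heis_w lam x' - heis_w lam x))
    = exp (theta_exponent (mode_matrix lam mu k m) (fst x) (fst x' - fst x))"
proof -
  define \<alpha> where "\<alpha> = fst x' - fst x"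
  obtain m0 :: int where m0: "snd x' - snd x = heis_phase lam (fst x) \<alpha> + pi * of_int m0"
    using assms by (auto simp: heis_rel_iff \<alpha>_def)
  define S where "S u v = (\<Sum>j\<in>UNIV. of_int (lam j) * (u $ j * v $ j))" for u v :: "complex ^ 'a"
  have S: "S (u + u') v = S u v + S u' v" "S u (v + v') = S u v + S u v'" "S u v = S v u" for u u' v v'
    by (auto simp: S_def algebra_simps sum.distrib)
  have w: "heis_w lam y = of_real (snd y) + \<i> * S (fst y) (cnjv (fst y))" for y
    by (simp add: heis_w_def S_def)
  have ph: "of_real (heis_phase lam u v) = \<i> * (S u (cnjv v) - S (cnjv u) v)" for u v
    by (simp add: of_real_heis_phase S_def sum_subtractf right_diff_distrib)
  have x': "fst x' = fst x + \<alpha>" by (simp add: \<alpha>_def)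
  have "heis_w lam x' - heis_w lam x
      = of_real (snd x' - snd x) + \<i> * (S (fst x') (cnjv (fst x')) - S (fst x) (cnjv (fst x)))"
    by (simp add: w algebra_simps)
  also have "\<dots> = of_real (heis_phase lam (fst x) \<alpha>) + of_real (pi * of_int m0)
      + \<i> * (S (fst x) (cnjv \<alpha>) + S \<alpha> (cnjv (fst x)) + S \<alpha> (cnjv \<alpha>))"
    unfolding m0 x' by (simp add: S algebra_simps)
  also have "\<dots> = \<i> * (2 * S (fst x) (cnjv \<alpha>) + S \<alpha> (cnjv \<alpha>)) + of_real (pi * of_int m0)"
    unfolding ph by (simp add: S(3)[of "cnjv (fst x)"] algebra_simps)
  finally have wd: "heis_w lam x' - heis_w lam x
      = \<i> * (2 * S (fst x) (cnjv \<alpha>) + S \<alpha> (cnjv \<alpha>)) + of_real (pi * of_int m0)" .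
  have "of_nat k * (heis_w lam x - heis_w lam x' + theta_exponent mu (fst x) \<alpha>)
      + mode_coeff k m * (heis_w lam x' - heis_w lam x)
      = of_nat k * theta_exponent mu (fst x) \<alpha> - 2 * \<i> * of_int m * (heis_w lam x' - heis_w lam x)"
    by (simp add: mode_coeff_def algebra_simps)
  also have "\<dots> = theta_exponent (mode_matrix lam mu k m) (fst x) \<alpha> + 2 * of_int (- (m * m0)) * of_real pi * \<i>"
    unfolding wd theta_exponent_def bilin_mode_matrix S_def[symmetric]
    by (simp add: field_simps)
  finally show ?thesis
    unfolding sasaki_factor_def \<alpha>_def[symmetric] exp_of_nat_mult[symmetric] exp_add[symmetric]
    by (simp only: exp_plus_of_int_2pi_i)
qed

section \<open>Fourier uniqueness and theta functions\<close>

lemma integral_periodic_shift: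
  fixes f :: "real \<Rightarrow> 'a::euclidean_space"
  assumes cont: "continuous_on UNIV f" and per: "\<And>x. f (x + p) = f x" and p: "p > 0"
  shows "integral {0..p} (\<lambda>x. f (x + s)) = integral {0..p} f"
proof -
  have per_n: "f (x + p * of_nat n) = f x" for x n
  proof (induction n)
    case (Suc n)
    have "x + p * of_nat (Suc n) = (x + p * of_nat n) + p" by (simp add: algebra_simps)
    then show ?case by (simp only: per Suc.IH)
  qed simp
  have per_i: "f (x + p * of_int m) = f x" for x m
  proof (cases "m \<ge> 0")
    case True
    then show ?thesis using per_n[of x "nat m"] by simp
  next
    case False
    then show ?thesis using per_n[of "x + p * of_int m" "nat (- m)"] by simp
  qed
  define r where "r = s - p * of_int \<lfloor>s / p\<rfloor>"
  have r: "0 \<le> r" "r \<le> p"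
    using p floor_divide_lower[of p s] floor_divide_upper[of p s] by (auto simp: r_def algebra_simps)
  have int: "f integrable_on {a..b}" for a b
    by (intro integrable_continuous_real continuous_on_subset[OF cont]) auto
  have shift: "integral {a..b} (\<lambda>x. f (x + c)) = integral {a + c..b + c} f" for a b c
    using integral_shift[of a c b f] continuous_on_subset[OF cont] by (simp add: o_def)
  have "f (x + s) = f (x + r)" for x
    using per_i[of "x + r" "\<lfloor>s / p\<rfloor>"] by (simp add: r_def algebra_simps)
  then have "integral {0..p} (\<lambda>x. f (x + s)) = integral {r..p + r} f"
    using shift[of 0 p r] by simp
  also have "\<dots> = integral {r..p} f + integral {p..p + r} f"
    using Henstock_Kurzweil_Integration.integral_combine[OF _ _ int, of r p "p + r"] r by simp
  also have "integral {p..p + r} f = integral {0..r} f"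
    using shift[of 0 r p] by (simp add: per add.commute)
  also have "integral {r..p} f + integral {0..r} f = integral {0..p} f"
    using Henstock_Kurzweil_Integration.integral_combine[OF _ _ int, of 0 r p] r by (simp add: add.commute)
  finally show ?thesis .
qed

lemma integral_periodic_reflect:
  fixes f :: "real \<Rightarrow> 'a::euclidean_space"
  assumes cont: "continuous_on UNIV f" and per: "\<And>x. f (x + p) = f x" and p: "p > 0"
  shows "integral {0..p} (\<lambda>x. f (- x)) = integral {0..p} f"
proof -
  have "integral {0..p} (\<lambda>x. f (- x)) = integral {- p..0} f"
    using Henstock_Kurzweil_Integration.integral_reflect_real[of 0 "- p" f] by simp
  also have "\<dots> = integral {0..p} (\<lambda>x. f (x + - p))"
    using integral_shift[of 0 "- p" p f] continuous_on_subset[OF cont] by (simp add: o_def)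
  also have "\<dots> = integral {0..p} f" by (rule integral_periodic_shift[OF cont per p])
  finally show ?thesis .
qed

text \<open>On one period the even part of the function is a continuous function of \<open>cos (2 x)\<close>, so that
  Weierstrass approximation applies to it.\<close>

lemma fourier_uniqueness_real:
  fixes g :: "real \<Rightarrow> real"
  assumes cont: "continuous_on UNIV g" and per: "\<And>x. g (x + pi) = g x"
    and coeff: "\<And>m::int. integral {0..pi} (\<lambda>x. of_real (g x) * exp (2 * \<i> * of_int m * of_real x)) = 0"
  shows "g s = 0"
proof -
  define e where "e m x = exp (2 * \<i> * of_int m * of_real x)" for m :: int and x :: real
  have e_add: "e m (x + y) = e m x * e m y" for m x y
    by (simp add: e_def exp_add[symmetric] algebra_simps)
  have e_pi: "e m pi = 1" for m
    unfolding e_def using exp_plus_of_int_2pi_i[of 0 m] by (simp add: mult_ac)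
  have cont_e: "continuous_on S (e m)" for m S
    unfolding e_def by (intro continuous_intros)
  have cont_g: "continuous_on S (\<lambda>x. g (h x))" if "continuous_on S h" for S :: "real set" and h
    using continuous_on_compose2[OF cont that] by simp
  have e_cos: "of_real (cos (2 * x)) * e m x = (e (m + 1) x + e (m - 1) x) / 2" for m x
  proof -
    have c: "of_real (cos (2 * x)) = (e 1 x + e (- 1) x) / 2"
      by (simp add: cos_of_real[symmetric] cos_exp_eq e_def mult_ac)
    have "e (m + l) x = e l x * e m x" for l
      by (simp add: e_def exp_add[symmetric] algebra_simps)
    from this[of 1] this[of "- 1"] have d: "e (m + 1) x = e 1 x * e m x" "e (m - 1) x = e (- 1) x * e m x"
      by simp_all
    show ?thesis unfolding c d by (simp add: field_simps)
  qed
  \<comment> \<open>Multiplication by cos (2 x) averages the frequencies m + 1 and m - 1, so powers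
    of the cosine keep all coefficients zero.\<close>
  have coeff_cos: "integral {0..pi} (\<lambda>x. of_real (g (x + s) * cos (2 * x) ^ n) * e m x) = 0" for n m
  proof (induction n arbitrary: m)
    case 0
    have "integral {0..pi} (\<lambda>x. of_real (g (x + s)) * e m (x + s)) = 0"
      using integral_periodic_shift[of "\<lambda>x. of_real (g x) * e m x" pi s] coeff[of m]
      by (simp add: per e_add e_pi e_def[symmetric] continuous_intros cont_g cont_e)
    then have "integral {0..pi} (\<lambda>x. e m s * (of_real (g (x + s)) * e m x)) = 0"
      by (simp add: e_add mult_ac)
    then show ?case by (simp add: e_def)
  next
    case (Suc n)
    have "integral {0..pi} (\<lambda>x. of_real (g (x + s) * cos (2 * x) ^ Suc n) * e m x)
      = integral {0..pi} (\<lambda>x. (of_real (g (x + s) * cos (2 * x) ^ n) * e (m + 1) x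
          + of_real (g (x + s) * cos (2 * x) ^ n) * e (m - 1) x) / 2)"
    proof (rule integral_cong)
      fix x
      have "of_real (g (x + s) * cos (2 * x) ^ Suc n) * e m x
         = of_real (g (x + s) * cos (2 * x) ^ n) * (of_real (cos (2 * x)) * e m x)"
        by simp
      then show "of_real (g (x + s) * cos (2 * x) ^ Suc n) * e m x =
         (of_real (g (x + s) * cos (2 * x) ^ n) * e (m + 1) x
          + of_real (g (x + s) * cos (2 * x) ^ n) * e (m - 1) x) / 2"
        unfolding e_cos by (simp add: algebra_simps)
    qed
    also have "\<dots> = 0"
      unfolding integral_divide
      by (subst integral_add)
        (auto intro!: integrable_continuous_real continuous_intros cont_g cont_e
          simp: Suc simp del: of_real_mult of_real_power)
    finally show ?case .
  qed
  have real_cos: "integral {0..pi} (\<lambda>x. g (x + s) * cos (2 * x) ^ n) = 0" for n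
  proof -
    have "(of_real (integral {0..pi} (\<lambda>x. g (x + s) * cos (2 * x) ^ n)) :: complex)
      = integral {0..pi} (\<lambda>x. of_real (g (x + s) * cos (2 * x) ^ n))"
      using integral_linear[of "\<lambda>x. g (x + s) * cos (2 * x) ^ n" "{0..pi}" complex_of_real,
          OF _ bounded_linear_of_real]
      by (simp add: o_def integrable_continuous_real continuous_intros cont_g)
    also have "\<dots> = 0" using coeff_cos[of n 0] by (simp add: e_def)
    finally show ?thesis by simp
  qed
  have real_cos': "integral {0..pi} (\<lambda>x. g (s - x) * cos (2 * x) ^ n) = 0" for n
  proof -
    have "g (x + pi + s) * cos (2 * (x + pi)) ^ n = g (x + s) * cos (2 * x) ^ n" for x
      using per[of "x + s"] cos_periodic[of "2 * x"] by (simp add: algebra_simps)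
    then have "integral {0..pi} (\<lambda>x. g (- x + s) * cos (2 * (- x)) ^ n)
        = integral {0..pi} (\<lambda>x. g (x + s) * cos (2 * x) ^ n)"
      by (intro integral_periodic_reflect[of "\<lambda>x. g (x + s) * cos (2 * x) ^ n" pi])
        (auto intro!: continuous_intros cont_g)
    then show ?thesis by (simp add: real_cos)
  qed
  \<comment> \<open>Recentred at \<open>s\<close>, so that the wanted value appears as E 0 = 2 g
    s.\<close>
  define E where "E x = g (x + s) + g (s - x)" for x
  have cont_E: "continuous_on S (\<lambda>x. E (h x))" if "continuous_on S h" for S :: "real set" and h
    unfolding E_def by (intro continuous_intros cont_g that)
  have E_cos: "integral {0..pi} (\<lambda>x. E x * cos (2 * x) ^ n) = 0" for n
    unfolding E_def distrib_right
    by (subst integral_add) (simp_all add: real_cos real_cos' integrable_continuous_real continuous_intros cont_g)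
  have E_poly: "integral {0..pi} (\<lambda>x. E x * q (cos (2 * x))) = 0" if "real_polynomial_function q" for q
  proof -
    obtain a n where q: "q = (\<lambda>x. \<Sum>i\<le>n. a i * x ^ i)"
      using \<open>real_polynomial_function q\<close> unfolding real_polynomial_function_iff_sum by blast
    have "integral {0..pi} (\<lambda>x. E x * q (cos (2 * x)))
      = integral {0..pi} (\<lambda>x. \<Sum>i\<le>n. a i * (E x * cos (2 * x) ^ i))"
      unfolding q by (simp add: sum_distrib_left mult_ac)
    also have "\<dots> = (\<Sum>i\<le>n. integral {0..pi} (\<lambda>x. a i * (E x * cos (2 * x) ^ i)))"
      by (intro integral_sum integrable_continuous_real continuous_intros cont_E) auto
    finally show ?thesis by (simp add: E_cos)
  qed
  \<comment> \<open>On [0, pi] the value cos (2 x) determines x only up to the reflection x -> pi -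
    x. Evenness and periodicity make \<open>E\<close> invariant under it, so \<open>E\<close>
    factors through the cosine.\<close>
  have E_arccos: "E x = E (arccos (cos (2 * x)) / 2)" if "x \<in> {0..pi}" for x
  proof (cases "x \<le> pi / 2")
    case True
    then show ?thesis using that by (simp add: arccos_cos)
  next
    case False
    have "cos (2 * x) = cos (2 * (pi - x))"
      using cos_periodic[of "- (2 * x)"] by (simp add: algebra_simps)
    then have "arccos (cos (2 * x)) = arccos (cos (2 * (pi - x)))" by (simp only:)
    also have "\<dots> = 2 * (pi - x)" using that False by (intro arccos_cos) auto
    finally have "arccos (cos (2 * x)) / 2 = pi - x" by simp
    moreover have "E (pi - x) = E x"
      using per[of "s - x"] per[of "x - pi + s"] by (simp add: E_def algebra_simps)
    ultimately show ?thesis by (simp only:)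
  qed
  define I where "I = integral {0..pi} (\<lambda>x. \<bar>E x\<bar>)"
  have I: "I \<ge> 0" unfolding I_def
    by (intro integral_nonneg integrable_continuous_real continuous_intros cont_E) auto
  \<comment> \<open>Subtracting a polynomial in the cosine from one factor \<open>E\<close> does not
    change the integral, so the integral of the square is at most the approximation error times
    \<open>I\<close>.\<close>
  have "integral {0..pi} (\<lambda>x. E x * E x) \<le> d * I" if d: "d > 0" for d
  proof -
    have "continuous_on {- 1..1} (\<lambda>y. E (arccos y / 2))"
      by (intro cont_E continuous_intros) auto
    then obtain q where q: "real_polynomial_function q" "\<And>y. y \<in> {- 1..1} \<Longrightarrow> \<bar>E (arccos y / 2) - q y\<bar> < d"
      using Stone_Weierstrass_real_polynomial_function[of "{- 1..1}" "\<lambda>y. E (arccos y / 2)" d] d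
      by auto
    have cont_q: "continuous_on S q" for S
      using q(1) by (auto simp: real_polynomial_function_eq intro: continuous_on_polymonial_function)
    have cq: "continuous_on {0..pi} (\<lambda>x. q (cos (2 * x)))"
      by (rule continuous_on_compose2[OF cont_q[of UNIV]]) (auto intro: continuous_intros)
    have "integral {0..pi} (\<lambda>x. E x * E x)
       = integral {0..pi} (\<lambda>x. E x * (E x - q (cos (2 * x)))) + integral {0..pi} (\<lambda>x. E x * q (cos (2 * x)))"
    proof -
      have "(\<lambda>x. E x * (E x - q (cos (2 * x)))) integrable_on {0..pi}"
        "(\<lambda>x. E x * q (cos (2 * x))) integrable_on {0..pi}"
        by (intro integrable_continuous_real continuous_intros cont_E cq)+
      then show ?thesis
        using integral_add[of "\<lambda>x. E x * (E x - q (cos (2 * x)))" "{0..pi}" "\<lambda>x. E x * q (cos (2 * x))"]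
        by (simp add: right_diff_distrib)
    qed
    also have "\<dots> = integral {0..pi} (\<lambda>x. E x * (E x - q (cos (2 * x))))"
      by (simp add: E_poly[OF q(1)])
    also have "\<dots> \<le> integral {0..pi} (\<lambda>x. d * \<bar>E x\<bar>)"
    proof (intro integral_le integrable_continuous_real continuous_intros cont_E cq)
      fix x assume x: "x \<in> {0..pi}"
      have "\<bar>E x - q (cos (2 * x))\<bar> \<le> d"
        using q(2)[of "cos (2 * x)"] E_arccos[OF x] by simp
      then have "\<bar>E x\<bar> * \<bar>E x - q (cos (2 * x))\<bar> \<le> \<bar>E x\<bar> * d"
        by (intro mult_left_mono) auto
      then show "E x * (E x - q (cos (2 * x))) \<le> d * \<bar>E x\<bar>"
        by (metis abs_ge_self abs_mult mult.commute order_trans)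
    qed
    also have "\<dots> = d * I" by (simp add: I_def)
    finally show ?thesis .
  qed
  note le = this
  have "integral {0..pi} (\<lambda>x. E x * E x) \<le> 0"
  proof (rule field_le_epsilon)
    fix d :: real assume d: "d > 0"
    have "integral {0..pi} (\<lambda>x. E x * E x) \<le> d / (I + 1) * I"
      using d I by (intro le) (auto intro: divide_pos_pos)
    also have "\<dots> \<le> d" using d I by (simp add: field_simps)
    finally show "integral {0..pi} (\<lambda>x. E x * E x) \<le> 0 + d" by simp
  qed
  moreover have "integral {0..pi} (\<lambda>x. E x * E x) \<ge> 0"
    by (intro integral_nonneg integrable_continuous_real continuous_intros cont_E) auto
  ultimately have "integral {0..pi} (\<lambda>x. E x * E x) = 0" by simp
  then have "E 0 * E 0 = 0"
    by (subst (asm) integral_eq_0_iff) (auto intro!: continuous_intros cont_E)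
  then show ?thesis by (simp add: E_def)
qed

text \<open>Conjugation turns the coefficient of index m into that of index - m, so the coefficients
  of the real and imaginary parts vanish as well and the real case applies to each.\<close>

lemma fourier_uniqueness:
  fixes g :: "real \<Rightarrow> complex"
  assumes cont: "continuous_on UNIV g" and per: "\<And>x. g (x + pi) = g x"
    and coeff: "\<And>m::int. integral {0..pi} (\<lambda>x. g x * exp (2 * \<i> * of_int m * of_real x)) = 0"
  shows "g s = 0"
proof -
  define e where "e m x = exp (2 * \<i> * of_int m * of_real x)" for m :: int and x :: real
  have cont_e: "continuous_on S (e m)" for m S
    unfolding e_def by (intro continuous_intros)
  have int: "(\<lambda>x. g x * e m x) integrable_on {0..pi}" "(\<lambda>x. cnj (g x) * e m x) integrable_on {0..pi}" for m
    by (intro integrable_continuous_real continuous_intros cont_e continuous_on_subset[OF cont], auto)+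
  have c1: "integral {0..pi} (\<lambda>x. g x * e m x) = 0" for m
    using coeff[of m] by (simp add: e_def)
  have c2: "integral {0..pi} (\<lambda>x. cnj (g x) * e m x) = 0" for m
  proof -
    have "cnj (e m x) = e (- m) x" for x by (simp add: e_def exp_cnj)
    then have "(\<lambda>x. cnj (g x) * e m x) = (\<lambda>x. cnj (g x * e (- m) x))"
      by (metis complex_cnj_cnj complex_cnj_mult)
    then show ?thesis by (simp only: integral_cnj[symmetric] c1 complex_cnj_zero)
  qed
  have "Re (g s) = 0"
  proof (rule fourier_uniqueness_real[where g = "\<lambda>x. Re (g x)"])
    fix m :: int
    have "(\<lambda>x. of_real (Re (g x)) * e m x) = (\<lambda>x. (g x * e m x + cnj (g x) * e m x) / 2)"
      by (auto simp: complex_add_cnj[symmetric] fun_eq_iff algebra_simps complex_eq_iff)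
    then show "integral {0..pi} (\<lambda>x. of_real (Re (g x)) * exp (2 * \<i> * of_int m * of_real x)) = 0"
      unfolding e_def[symmetric] by (simp add: integral_divide integral_add int c1 c2)
  qed (auto intro!: continuous_intros cont simp: per)
  moreover have "Im (g s) = 0"
  proof (rule fourier_uniqueness_real[where g = "\<lambda>x. Im (g x)"])
    fix m :: int
    have "(\<lambda>x. of_real (Im (g x)) * e m x) = (\<lambda>x. (g x * e m x - cnj (g x) * e m x) / (2 * \<i>))"
      by (rule ext) (simp add: left_diff_distrib[symmetric] complex_diff_cnj mult_ac)
    then show "integral {0..pi} (\<lambda>x. of_real (Im (g x)) * exp (2 * \<i> * of_int m * of_real x)) = 0"
      unfolding e_def[symmetric] by (simp add: integral_divide integral_diff int c1 c2)
  qed (auto intro!: continuous_intros cont simp: per)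
  ultimately show ?thesis by (simp add: complex_eq_iff)
qed

section \<open>Theta functions: growth, vanishing and determining sets\<close>

lemma norm_vector_smult: "norm (t *s u) = cmod t * norm (u :: complex ^ 'm)"
  by (simp add: norm_vec_def L2_set_def norm_mult power_mult_distrib
      sum_distrib_left[symmetric] real_sqrt_mult)

text \<open>Holomorphy is asked along complex lines, since the arguments below restrict to a line
  and apply one-variable theorems. Continuity gives the maximum over the compact
  \<open>heis_box\<close>.\<close>

definition theta_function :: "('m \<Rightarrow> 'm \<Rightarrow> int) \<Rightarrow> (complex ^ 'm::finite \<Rightarrow> complex) \<Rightarrow> bool" where
  "theta_function A h \<longleftrightarrow> continuous_on UNIV h \<and>
     (\<forall>w u. (\<lambda>t. h (w + t *s u)) holomorphic_on UNIV) \<and>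
     (\<forall>z. \<forall>\<alpha>\<in>heis_lattice. h (z + \<alpha>) = h z * exp (theta_exponent A z \<alpha>))"

text \<open>Half the Hermitian form at \<open>z\<close>. For symmetric \<open>A\<close> and a theta
  function \<open>h\<close>, the product of cmod (h z) and exp (- theta_weight A z) is invariant
  under lattice translations.\<close>

definition theta_weight :: "('m \<Rightarrow> 'm \<Rightarrow> int) \<Rightarrow> complex ^ 'm::finite \<Rightarrow> real" where
  "theta_weight A z = Re (bilin A z (cnjv z)) / 2"

lemma theta_weight_add:
  assumes "\<And>j t. A j t = A t j"
  shows "theta_weight A (z + \<alpha>) = theta_weight A z + Re (theta_exponent A z \<alpha>)"
proof -
  have "bilin A \<alpha> (cnjv z) = cnj (bilin A z (cnjv \<alpha>))"
    by (simp add: cnj_bilin bilin_commute[of A \<alpha>, OF assms])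
  then show ?thesis
    by (simp add: theta_weight_def theta_exponent_def bilin_simps add_divide_distrib)
qed

lemma continuous_on_bilin [continuous_intros]:
  "continuous_on S f \<Longrightarrow> continuous_on S g \<Longrightarrow> continuous_on S (\<lambda>x. bilin A (f x) (g x))"
  unfolding bilin_def by (intro continuous_intros)

lemma continuous_on_cnjv [continuous_intros]:
  "continuous_on S f \<Longrightarrow> continuous_on S (\<lambda>x. cnjv (f x))"
  unfolding cnjv_def by (intro continuous_intros)

definition heis_box :: "(complex ^ 'm) set" where
  "heis_box = {z. \<forall>j. Re (z $ j) \<in> {0..sqrt (2 * pi)} \<and> Im (z $ j) \<in> {0..sqrt (2 * pi)}}"

lemma compact_heis_box: "compact (heis_box :: (complex ^ 'm::finite) set)"
proof -
  have "norm z \<le> (\<Sum>j\<in>(UNIV :: 'm set). 2 * sqrt (2 * pi))" if "z \<in> heis_box" for z :: "complex ^ 'm"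
  proof -
    have "norm (z $ j) \<le> 2 * sqrt (2 * pi)" for j
    proof -
      have "\<bar>Re (z $ j)\<bar> \<le> sqrt (2 * pi)" "\<bar>Im (z $ j)\<bar> \<le> sqrt (2 * pi)"
        using that by (auto simp: heis_box_def)
      then show ?thesis using cmod_le[of "z $ j"] by linarith
    qed
    then have "(\<Sum>j\<in>UNIV. norm (z $ j)) \<le> (\<Sum>j\<in>(UNIV :: 'm set). 2 * sqrt (2 * pi))"
      by (intro sum_mono)
    moreover have "norm z \<le> (\<Sum>j\<in>UNIV. norm (z $ j))"
      unfolding norm_vec_def by (rule L2_set_le_sum) simp
    ultimately show ?thesis by linarith
  qed
  then have "bounded (heis_box :: (complex ^ 'm) set)" unfolding bounded_iff by blast
  moreover have "closed (heis_box :: (complex ^ 'm) set)"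
    unfolding heis_box_def atLeastAtMost_iff
    by (intro closed_Collect_all closed_Collect_conj closed_Collect_le continuous_intros)
  ultimately show ?thesis by (simp add: compact_eq_bounded_closed)
qed

lemma heis_box_translate: obtains \<alpha> :: "complex ^ 'm::finite" where "\<alpha> \<in> heis_lattice" "z - \<alpha> \<in> heis_box"
proof -
  define s where "s = sqrt (2 * pi)"
  have s: "s > 0" by (simp add: s_def)
  define a b where "a j = \<lfloor>Re (z $ j) / s\<rfloor>" and "b j = \<lfloor>Im (z $ j) / s\<rfloor>" for j
  define \<alpha> :: "complex ^ 'm" where "\<alpha> = (\<chi> j. of_real s * of_int (a j) + \<i> * of_real s * of_int (b j))"
  have fl: "0 \<le> x - s * of_int \<lfloor>x / s\<rfloor>" "x - s * of_int \<lfloor>x / s\<rfloor> \<le> s" for x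
    using s floor_divide_lower[of s x] floor_divide_upper[of s x] by (auto simp: algebra_simps)
  show ?thesis
  proof
    show "\<alpha> \<in> heis_lattice" unfolding heis_lattice_def \<alpha>_def s_def
mem_Collect_eq
      by (rule exI[of _ a], rule exI[of _ b]) simp
    show "z - \<alpha> \<in> heis_box"
      using fl by (auto simp: heis_box_def s_def[symmetric] \<alpha>_def a_def b_def)
  qed
qed

text \<open>By lattice invariance the maximum of the weighted modulus over the box is a global one.
  The maximising point \<open>p\<close> is exported because the determining-set argument compares
  with the value there.\<close>

lemma theta_function_bounded:
  assumes sym: "\<And>j t. A j t = A t j" and h: "theta_function A h"
  obtains p where "p \<in> heis_box"
    "\<And>z. cmod (h z) \<le> cmod (h p) * exp (- theta_weight A p) * exp (theta_weight A z)"
proof -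
  define W where "W z = cmod (h z) * exp (- theta_weight A z)" for z
  have cont: "continuous_on heis_box W"
    unfolding W_def theta_weight_def using h
    by (intro continuous_intros) (auto simp: theta_function_def intro: continuous_on_subset)
  have "heis_box \<noteq> ({} :: (complex ^ 'a) set)"
    using heis_box_translate by blast
  then obtain p where p: "p \<in> heis_box" "\<And>z. z \<in> heis_box \<Longrightarrow> W z \<le> W p"
    using continuous_attains_sup[OF compact_heis_box _ cont] by blast
  have "W z \<le> W p" for z
  proof -
    obtain \<alpha> where \<alpha>: "\<alpha> \<in> heis_lattice" "z - \<alpha> \<in> heis_box" using heis_box_translate by blast
    have "h z = h (z - \<alpha>) * exp (theta_exponent A (z - \<alpha>) \<alpha>)"
      using h \<alpha>(1) unfolding theta_function_def by (metis diff_add_cancel)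
    moreover have "theta_weight A z = theta_weight A (z - \<alpha>) + Re (theta_exponent A (z - \<alpha>) \<alpha>)"
      using theta_weight_add[of A "z - \<alpha>" \<alpha>, OF sym] by simp
    ultimately have "W z = W (z - \<alpha>)"
      by (simp add: W_def norm_mult exp_diff exp_add exp_minus field_simps)
    then show ?thesis using p(2) \<alpha>(2) by simp
  qed
  moreover have "cmod (h z) = W z * exp (theta_weight A z)" for z
    by (simp add: W_def mult.assoc exp_add[symmetric])
  ultimately have "cmod (h z) \<le> W p * exp (theta_weight A z)" for z
    by (simp add: mult_right_mono)
  with p(1) show ?thesis by (auto simp: W_def intro: that)
qed

text \<open>On the complex line through \<open>z\<close> in direction \<open>axis j 1\<close> the
  weight falls off quadratically, so the restriction of \<open>h\<close> tends to 0 at infinity and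
  Liouville's theorem makes it vanish.\<close>

lemma theta_function_eq_0_if_diagonal_neg:
  assumes sym: "\<And>j t. A j t = A t j" and h: "theta_function A h" and neg: "A j j < 0"
  shows "h z = 0"
proof -
  obtain B where B: "\<And>z. cmod (h z) \<le> B * exp (theta_weight A z)"
    using theta_function_bounded[of A h, OF sym h] by metis
  have B0: "B \<ge> 0" using order_trans[OF norm_ge_zero B[of 0]] by (simp add: zero_le_mult_iff)
  define e :: "complex ^ 'a" where "e = axis j 1"
  define C where "C = cmod (bilin A z (cnjv e))"
  have Ae: "bilin A e (cnjv e) = of_int (A j j)"
  proof -
    have "of_int (A i t) * (e $ i * cnj (e $ t)) = (if t = j then if i = j then of_int (A j j) else 0 else 0)" for i t
      by (auto simp: e_def axis_def)
    then show ?thesis by (simp add: bilin_def)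
  qed
  \<comment> \<open>The entry \<open>A j j\<close> is a negative integer, hence at most - 1; this
    gives the coefficient 1/2 of the quadratic term.\<close>
  have weight: "theta_weight A (z + t *s e) \<le> theta_weight A z + C * cmod t - (cmod t)\<^sup>2 / 2" for t
  proof -
    have "bilin A (t *s e) (cnjv (t *s e)) = (t * cnj t) * of_int (A j j)"
      by (simp add: bilin_simps Ae)
    also have "t * cnj t = of_real ((cmod t)\<^sup>2)" by (rule complex_norm_square[symmetric])
    finally have "bilin A (t *s e) (cnjv (t *s e)) = of_real ((cmod t)\<^sup>2 * of_int (A j j))" by simp
    moreover have "(cmod t)\<^sup>2 * of_int (A j j) \<le> - ((cmod t)\<^sup>2)"
      using neg mult_left_mono[of "of_int (A j j)" "- 1" "(cmod t)\<^sup>2"] by simp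
    moreover have "Re (bilin A z (cnjv (t *s e))) \<le> C * cmod t"
      using complex_Re_le_cmod[of "cnj t * bilin A z (cnjv e)"]
      by (simp add: bilin_simps C_def norm_mult mult.commute)
    ultimately show ?thesis
      unfolding theta_weight_add[of A, OF sym] theta_exponent_def by simp
  qed
  define \<phi> where "\<phi> t = h (z + t *s e)" for t
  have "(\<phi> \<longlongrightarrow> 0) at_infinity"
  proof (rule Lim_null_comparison)
    have "\<forall>\<^sub>F t in at_infinity. cmod t \<ge> 2 * C + 2"
      by (auto simp: eventually_at_infinity)
    then show "\<forall>\<^sub>F t in at_infinity. norm (\<phi> t) \<le> B * exp (theta_weight A z) * exp (- cmod t)"
    proof eventually_elim
      case (elim t)
      \<comment> \<open>From the radius 2 C + 2 on, the quadratic term is at least (C + 1) |t|,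
        which leaves the decay - |t|.\<close>
      have "(2 * C + 2) * cmod t \<le> cmod t * cmod t" using elim by (intro mult_right_mono) auto
      then have "theta_weight A (z + t *s e) \<le> theta_weight A z - cmod t"
        using weight[of t] by (simp add: power2_eq_square algebra_simps)
      then have "exp (theta_weight A (z + t *s e)) \<le> exp (theta_weight A z) * exp (- cmod t)"
        by (simp add: exp_add[symmetric])
      then show ?case
        unfolding \<phi>_def using B B0 by (metis (no_types) order_trans mult_left_mono mult.assoc)
    qed
    have "filterlim (\<lambda>t::complex. - cmod t) at_bot at_infinity"
      by (simp add: filterlim_uminus_at_bot filterlim_norm_at_top)
    then have "((\<lambda>t::complex. exp (- cmod t)) \<longlongrightarrow> 0) at_infinity"
      by (rule filterlim_compose[OF exp_at_bot])
    then show "((\<lambda>t. B * exp (theta_weight A z) * exp (- cmod t)) \<longlongrightarrow> 0) at_infinity"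
      by (rule tendsto_mult_right_zero)
  qed
  moreover have "\<phi> holomorphic_on UNIV"
    using h by (simp add: theta_function_def \<phi>_def[abs_def])
  ultimately have "\<phi> 0 = 0" using Liouville_weak_0 by blast
  then show ?thesis by (simp add: \<phi>_def)
qed

lemma Schwarz_lemma_scaled:
  assumes "\<phi> holomorphic_on UNIV" "\<phi> 0 = 0" "R > 1" "\<And>t. cmod t < R \<Longrightarrow> cmod (\<phi> t) \<le> M"
  shows "cmod (\<phi> 1) \<le> M / R"
proof -
  have M: "M \<ge> 0" using assms(4)[of 0] assms(2,3) by simp
  have "R * cmod (\<phi> 1) \<le> M + \<epsilon>" if \<epsilon>: "\<epsilon> > 0" for \<epsilon>
  proof -
    \<comment> \<open>Rescaled to the unit disc. The Schwarz lemma needs a strict bound by 1 and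
      \<open>M\<close> may be 0, hence the division by \<open>M + \<epsilon>\<close>.\<close>
    define f where "f z = \<phi> (of_real R * z) / of_real (M + \<epsilon>)" for z
    have "\<phi> holomorphic_on (\<lambda>z. of_real R * z) ` ball 0 1"
      using assms(1) holomorphic_on_subset by blast
    then have "(\<lambda>z. \<phi> (of_real R * z)) holomorphic_on ball 0 1"
      using holomorphic_on_compose[of "\<lambda>z. of_real R * z" "ball 0 1" \<phi>]
      by (simp add: o_def holomorphic_intros)
    then have "f holomorphic_on ball 0 1"
      unfolding f_def using M \<epsilon> by (intro holomorphic_intros) (simp_all flip: of_real_add)
    moreover have "cmod (f z) < 1" if "cmod z < 1" for z
    proof -
      have "cmod (\<phi> (of_real R * z)) \<le> M"
        using that assms(3) by (intro assms(4)) (simp add: norm_mult)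
      then show ?thesis using M \<epsilon> by (simp add: f_def norm_divide flip: of_real_add)
    qed
    moreover have "f 0 = 0" by (simp add: f_def assms(2))
    moreover have "cmod (1 / of_real R) < 1" using assms(3) by (simp add: norm_divide)
    ultimately have "cmod (f (1 / of_real R)) \<le> cmod (1 / of_real R)"
      using Schwarz_Lemma(1)[of f "1 / of_real R"] by blast
    then show ?thesis
      using assms(3) M \<epsilon> by (simp add: f_def norm_divide field_simps flip: of_real_add)
  qed
  then have "R * cmod (\<phi> 1) \<le> M" by (rule field_le_epsilon)
  then show ?thesis using assms(3) by (simp add: field_simps)
qed

text \<open>By the Schwarz lemma a theta function that vanishes on an \<open>\<epsilon>\<close>-net of the fundamental domain
  is there smaller than half of its maximum.\<close>

lemma theta_function_determining_set:
  assumes sym: "\<And>j t. A j t = A t j"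
  obtains N :: "(complex ^ 'm::finite) set" where "finite N"
    "\<And>h. theta_function A h \<Longrightarrow> (\<And>z. z \<in> N \<Longrightarrow> h z = 0) \<Longrightarrow> h = (\<lambda>_. 0)"
proof -
  define K :: "(complex ^ 'm) set" where "K = heis_box"
  have cont: "continuous_on S (theta_weight A)" for S
    unfolding theta_weight_def by (intro continuous_intros) auto
  \<comment> \<open>The unit neighbourhood of the box: it contains w + t (p - w) for a net point
    \<open>w\<close> within distance \<epsilon> of \<open>p\<close> as long as |t| < 1 /
    \<epsilon>.\<close>
  define K' where "K' = {x + y |x y. x \<in> K \<and> y \<in> cball 0 1}"
  have K: "compact K" and K': "compact K'"
    unfolding K_def K'_def by (intro compact_sums compact_heis_box compact_cball)+
  obtain C where C: "\<And>z. z \<in> K' \<Longrightarrow> \<bar>theta_weight A z\<bar> \<le> C"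
    using compact_imp_bounded[OF compact_continuous_image[OF cont K']]
    unfolding bounded_iff by auto
  have KK': "K \<subseteq> K'" unfolding K'_def by force
  \<comment> \<open>Passing between two weights on \<open>K'\<close> costs at most exp (2 C), and
    the Schwarz lemma gains the factor \<epsilon>; the product is 1/2.\<close>
  define \<epsilon> where "\<epsilon> = exp (- 2 * C) / 2"
  have C0: "C \<ge> 0" using C KK' heis_box_translate unfolding K_def by (metis abs_ge_zero order_trans subsetD)
  have \<epsilon>: "\<epsilon> < 1" "0 < \<epsilon>"
  proof -
    have "exp (- 2 * C) \<le> 1" using C0 by simp
    then show "\<epsilon> < 1" unfolding \<epsilon>_def by linarith
    show "0 < \<epsilon>" by (simp add: \<epsilon>_def)
  qed
  obtain N where N: "N \<subseteq> K" "finite N" "K \<subseteq> (\<Union>x\<in>N. ball x \<epsilon>)"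
    using compactE_image[OF K, of K "\<lambda>x. ball x \<epsilon>"] \<epsilon>(2) by (metis centre_in_ball open_ball subsetI UN_I)
  show ?thesis
  proof
    fix h assume h: "theta_function A h" and N0: "\<And>z. z \<in> N \<Longrightarrow> h z = 0"
    obtain p where p: "p \<in> K"
      "\<And>z. cmod (h z) \<le> cmod (h p) * exp (- theta_weight A p) * exp (theta_weight A z)"
      using theta_function_bounded[of A h, OF sym h] unfolding K_def by metis
    obtain w where w: "w \<in> N" "dist w p < \<epsilon>" using N(3) p(1) by auto
    define \<phi> where "\<phi> t = h (w + t *s (p - w))" for t
    have "cmod (\<phi> 1) \<le> (cmod (h p) * exp C * exp C) / (1 / \<epsilon>)"
    proof (rule Schwarz_lemma_scaled)
      show "\<phi> holomorphic_on UNIV"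
        using h unfolding theta_function_def \<phi>_def[abs_def] by blast
      show "\<phi> 0 = 0" using N0 w by (simp add: \<phi>_def)
      show "1 < 1 / \<epsilon>" using \<epsilon> by simp
      fix t assume t: "cmod t < 1 / \<epsilon>"
      have "norm (t *s (p - w)) = cmod t * norm (p - w)"
        by (rule norm_vector_smult)
      also have "\<dots> \<le> (1 / \<epsilon>) * \<epsilon>"
        using t w(2) \<epsilon> by (intro mult_mono) (auto simp: dist_norm norm_minus_commute)
      finally have "norm (t *s (p - w)) \<le> 1" using \<epsilon> by simp
      then have "w + t *s (p - w) \<in> K'" unfolding K'_def using w N(1) by auto
      then have "theta_weight A (w + t *s (p - w)) \<le> C" "- theta_weight A p \<le> C"
        using C[of "w + t *s (p - w)"] C[of p] p(1) KK' by (auto simp: abs_le_iff)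
      then have "cmod (h p) * exp (- theta_weight A p) * exp (theta_weight A (w + t *s (p - w)))
          \<le> cmod (h p) * exp C * exp C"
        by (intro mult_mono) auto
      then show "cmod (\<phi> t) \<le> cmod (h p) * exp C * exp C"
        unfolding \<phi>_def by (rule order_trans[OF p(2)])
    qed
    also have "\<dots> = cmod (h p) / 2"
      by (simp add: \<epsilon>_def exp_add[symmetric])
    finally have "h p = 0" by (simp add: \<phi>_def)
    then show "h = (\<lambda>_. 0)" using p(2) by (auto simp: fun_eq_iff)
  qed (rule N(2))
qed

section \<open>Fourier modes of CR sections and finite dimensionality\<close>

text \<open>The tangential operator evaluated on a candidate derivative \<open>D\<close>, so that
  the CR equation can be checked on whatever derivative the differentiation rules deliver.\<close>

definition CR_form ::
    "('m::finite \<Rightarrow> int) \<Rightarrow> complex ^ 'm \<Rightarrow> ((complex ^ 'm) \<times> real \<Rightarrow> complex) \<Rightarrow> 'm \<Rightarrow> complex" where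
  "CR_form lam z D j =
     (D (axis j 1, 0) + \<i> * D (axis j \<i>, 0)) / 2 - \<i> * of_int (lam j) * z $ j * D (0, 1)"

lemma is_CR_iff: "is_CR lam f \<longleftrightarrow> (\<forall>x j. CR_form lam (fst x) (frechet_derivative f (at x)) j = 0)"
  by (auto simp: is_CR_def CR_form_def d_zbar_def d_theta_def)

lemma is_CRI:
  assumes "\<And>x. (f has_derivative f' x) (at x)" "\<And>x j. CR_form lam (fst x) (f' x) j = 0"
  shows "is_CR lam f"
  using assms frechet_derivative_at[OF assms(1)] unfolding is_CR_iff by metis

lemma is_CR_mult:
  assumes "smooth f" "smooth g" "is_CR lam f" "is_CR lam g"
  shows "is_CR lam (\<lambda>x. f x * g x)"
proof (rule is_CRI[OF has_derivative_mult[OF smooth_has_derivative[OF assms(1)] smooth_has_derivative[OF assms(2)]]])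
  fix x j
  let ?f' = "frechet_derivative f (at x)" and ?g' = "frechet_derivative g (at x)"
  have "CR_form lam (fst x) (\<lambda>h. f x * ?g' h + ?f' h * g x) j
      = f x * CR_form lam (fst x) ?g' j + CR_form lam (fst x) ?f' j * g x"
    by (simp add: CR_form_def field_simps)
  then show "CR_form lam (fst x) (\<lambda>h. f x * ?g' h + ?f' h * g x) j = 0"
    using assms(3,4)[unfolded is_CR_iff, rule_format, of x j] by simp
qed

lemma is_CR_exp:
  assumes "smooth f" "is_CR lam f"
  shows "is_CR lam (\<lambda>x. exp (f x))"
proof (rule is_CRI[OF has_derivative_cexp[OF smooth_has_derivative[OF assms(1)]]])
  fix x j
  let ?f' = "frechet_derivative f (at x)"
  have "CR_form lam (fst x) (\<lambda>h. ?f' h * exp (f x)) j = CR_form lam (fst x) ?f' j * exp (f x)"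
    by (simp add: CR_form_def field_simps)
  then show "CR_form lam (fst x) (\<lambda>h. ?f' h * exp (f x)) j = 0"
    using assms(2)[unfolded is_CR_iff, rule_format, of x j] by simp
qed

lemma bounded_linear_fst_nth: "bounded_linear (\<lambda>x::(complex ^ 'm::finite) \<times> real. fst x $ j)"
  by (rule bounded_linear_compose[OF bounded_linear_vec_nth bounded_linear_fst])

lemma bounded_linear_cnj_fst_nth: "bounded_linear (\<lambda>x::(complex ^ 'm::finite) \<times> real. cnj (fst x $ j))"
  by (rule bounded_linear_compose[OF bounded_linear_cnj bounded_linear_fst_nth])

lemma bounded_linear_of_real_snd: "bounded_linear (\<lambda>x::(complex ^ 'm::finite) \<times> real. complex_of_real (snd x))"
  by (rule bounded_linear_compose[OF bounded_linear_of_real bounded_linear_snd])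

lemma smooth_cmult: "smooth f \<Longrightarrow> smooth (\<lambda>x. c * f x)" for f :: "'a::real_normed_vector \<Rightarrow> complex"
  by (rule smooth_mult[OF smooth_const])

lemma smooth_heis_w: "smooth (heis_w lam)"
  unfolding heis_w_def[abs_def]
  by (intro smooth_add smooth_cmult smooth_sum smooth_mult smooth_bounded_linear
      bounded_linear_fst_nth bounded_linear_cnj_fst_nth bounded_linear_of_real_snd)

lemma sum_only_one: "(\<And>t. t \<noteq> j \<Longrightarrow> F t = 0) \<Longrightarrow> (\<Sum>t\<in>UNIV. F t) = F (j::'m::finite)"
  by (subst sum.mono_neutral_right[of UNIV "{j}"]) auto

lemma is_CR_heis_w: "is_CR lam (\<lambda>x. c * heis_w lam x)"
proof (rule is_CRI)
  fix x :: "(complex ^ 'a) \<times> real" and j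
  note d = bounded_linear_imp_has_derivative
  show "((\<lambda>x. c * heis_w lam x) has_derivative (\<lambda>v. c * (of_real (snd v) + \<i> * (\<Sum>j\<in>UNIV. of_int (lam j) *
      (fst x $ j * cnj (fst v $ j) + fst v $ j * cnj (fst x $ j)))))) (at x)"
    unfolding heis_w_def
    by (intro has_derivative_mult_right has_derivative_add has_derivative_sum has_derivative_mult
        d[OF bounded_linear_fst_nth] d[OF bounded_linear_cnj_fst_nth] d[OF bounded_linear_of_real_snd])
  have "(\<Sum>t\<in>UNIV. of_int (lam t) * (fst x $ t * cnj (axis j a $ t) + axis j a $ t * cnj (fst x $ t)))
      = of_int (lam j) * (fst x $ j * cnj a + a * cnj (fst x $ j))" for a
    by (subst sum_only_one[of j]) (auto simp: axis_def)
  then show "CR_form lam (fst x) (\<lambda>v. c * (of_real (snd v) + \<i> * (\<Sum>j\<in>UNIV. of_int (lam j) *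
      (fst x $ j * cnj (fst v $ j) + fst v $ j * cnj (fst x $ j))))) j = 0"
    by (simp add: CR_form_def field_simps)
qed

text \<open>In a complex direction \<open>u\<close> the antiholomorphic derivative combines the
  coordinate ones with weights cnj (u_j), and the CR equations turn each of them into a
  \<theta>-derivative. So holomorphy along a line fails only by a multiple of
  \<open>D (0, 1)\<close>, which integration over a period will remove.\<close>

lemma CR_line_derivative:
  assumes D: "bounded_linear D" and CR: "\<And>j. CR_form lam z D j = 0"
  shows "D (u, 0) + \<i> * D (\<i> *s u, 0) = (\<Sum>j\<in>UNIV. 2 * \<i> * of_int (lam j) * z $ j * cnj (u $ j)) * D (0, 1)"
proof -
  interpret D: bounded_linear D by (rule D)
  have expand: "D (v, 0) = (\<Sum>j\<in>UNIV. of_real (Re (v $ j)) * D (axis j 1, 0) + of_real (Im (v $ j)) * D (axis j \<i>, 0))" for v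
  proof -
    have "v = (\<Sum>j\<in>UNIV. Re (v $ j) *\<^sub>R axis j 1 + Im (v $ j) *\<^sub>R axis j \<i>)"
    proof (rule vec_eq_iff[THEN iffD2], rule allI)
      fix i
      have "(\<Sum>j\<in>UNIV. Re (v $ j) *\<^sub>R axis j 1 $ i + Im (v $ j) *\<^sub>R axis j \<i> $ i) = v $ i"
        by (subst sum_only_one[of i]) (auto simp: axis_def complex_eq_iff)
      then show "v $ i = (\<Sum>j\<in>UNIV. Re (v $ j) *\<^sub>R axis j 1 + Im (v $ j) *\<^sub>R axis j \<i>) $ i"
        by simp
    qed
    then have "(v, 0) = (\<Sum>j\<in>UNIV. Re (v $ j) *\<^sub>R (axis j 1, 0::real) + Im (v $ j) *\<^sub>R (axis j \<i>, 0))"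
      by (auto simp: prod_eq_iff fst_sum snd_sum)
    then have "D (v, 0) = D (\<Sum>j\<in>UNIV. Re (v $ j) *\<^sub>R (axis j 1, 0::real) + Im (v $ j) *\<^sub>R (axis j \<i>, 0))"
      by simp
    then show ?thesis
      by (simp only: D.sum D.add D.scaleR) (simp add: scaleR_conv_of_real)
  qed
  have CR': "D (axis j 1, 0) + \<i> * D (axis j \<i>, 0) = 2 * \<i> * of_int (lam j) * z $ j * D (0, 1)" for j
    using CR[of j] by (simp add: CR_form_def field_simps)
  have "D (u, 0) + \<i> * D (\<i> *s u, 0)
      = (\<Sum>j\<in>UNIV. cnj (u $ j) * (D (axis j 1, 0) + \<i> * D (axis j \<i>, 0)))"
  proof -
    have c: "cnj (u $ j) = of_real (Re (u $ j)) - \<i> * of_real (Im (u $ j))" for j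
      by (simp add: complex_eq_iff)
    show ?thesis
      unfolding expand[of u] expand[of "\<i> *s u"] sum_distrib_left sum.distrib[symmetric] c
      by (intro sum.cong refl) (simp add: algebra_simps)
  qed
  also have "\<dots> = (\<Sum>j\<in>UNIV. 2 * \<i> * of_int (lam j) * z $ j * cnj (u $ j)) * D (0, 1)"
    unfolding CR' sum_distrib_right by (intro sum.cong refl) (simp add: mult_ac)
  finally show ?thesis .
qed

lemma bounded_linear_smult_left: "bounded_linear (\<lambda>v::complex. v *s u)" for u :: "complex ^ 'm::finite"
  unfolding linear_conv_bounded_linear[symmetric]
  by (intro linearI) (auto simp: vec_eq_iff algebra_simps)

lemma holomorphic_on_line_integral:
  assumes P: "smooth P" "is_CR lam P" and per: "\<And>z. P (z, pi) = P (z, 0)"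
  shows "(\<lambda>t. integral {0..pi} (\<lambda>\<theta>. P (w + t *s u, \<theta>))) holomorphic_on UNIV"
proof -
  define D where "D y = frechet_derivative P (at y)" for y
  have PD: "(P has_derivative D y) (at y)" for y
    unfolding D_def by (rule smooth_has_derivative[OF P(1)])
  have contD: "continuous_on S (\<lambda>y. D y v)" for v S
    unfolding D_def by (rule smooth_continuous_on_derivative[OF P(1)])
  have cont_line: "continuous_on S (\<lambda>p. (w + fst p *s u, snd p))" for S :: "(complex \<times> real) set"
    by (intro continuous_intros
        continuous_on_compose2[OF linear_continuous_on[OF bounded_linear_smult_left, of UNIV u]]) auto
  \<comment> \<open>Packaged as a bounded operator because the Leibniz rule asks for joint
    continuity in operator norm; \<open>continuous_on_blinfun_componentwise\<close> reduces this to
    single vectors.\<close>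
  define F where "F x \<theta> = Blinfun (\<lambda>v::complex. D (w + x *s u, \<theta>) (v *s u, 0))" for x \<theta>
  have der: "((\<lambda>x. P (w + x *s u, \<theta>)) has_derivative (\<lambda>v. D (w + x *s u, \<theta>) (v *s u, 0))) (at x)" for x \<theta>
  proof -
    have "((\<lambda>x. (w + x *s u, \<theta>)) has_derivative (\<lambda>v. (0 + v *s u, 0))) (at x)"
      by (intro has_derivative_Pair has_derivative_add has_derivative_const
          bounded_linear_imp_has_derivative bounded_linear_smult_left)
    from has_derivative_compose[OF this PD] show ?thesis by simp
  qed
  have F_apply: "blinfun_apply (F x \<theta>) = (\<lambda>v. D (w + x *s u, \<theta>) (v *s u, 0))" for x \<theta>
    unfolding F_def by (rule bounded_linear_Blinfun_apply[OF has_derivative_bounded_linear[OF der]])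
  have contF: "continuous_on S (\<lambda>p. F (fst p) (snd p))" for S
    by (rule continuous_on_blinfun_componentwise)
      (simp add: F_apply continuous_on_compose2[OF contD[of UNIV] cont_line])
  have intF: "F x integrable_on cbox 0 pi" for x
  proof (rule integrable_continuous)
    have "continuous_on (cbox 0 pi) (\<lambda>\<theta>. F (fst (x, \<theta>)) (snd (x, \<theta>)))"
      by (rule continuous_on_compose2[OF contF[of UNIV]])
        (intro continuous_on_Pair continuous_on_const continuous_on_id, simp)
    then show "continuous_on (cbox 0 pi) (F x)" by simp
  qed
  define L where "L x = integral (cbox 0 pi) (F x)" for x
  have L: "((\<lambda>x. integral (cbox 0 pi) (\<lambda>\<theta>. P (w + x *s u, \<theta>))) has_derivative L x) (at x)" for x
    unfolding L_def
  proof (rule leibniz_rule[where U = UNIV])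
    show "((\<lambda>x. P (w + x *s u, \<theta>)) has_derivative blinfun_apply (F x \<theta>)) (at x)" for x \<theta>
      unfolding F_apply by (rule der)
    show "(\<lambda>\<theta>. P (w + x *s u, \<theta>)) integrable_on cbox 0 pi" for x
      by (intro integrable_continuous continuous_on_compose2[OF smooth_continuous_on[OF P(1), of UNIV]]
          continuous_intros) auto
    show "continuous_on (UNIV \<times> cbox 0 pi) (\<lambda>(x, t). F x t)"
      using contF by (simp add: case_prod_unfold)
  qed auto
  have L_apply: "L x v = integral (cbox 0 pi) (\<lambda>\<theta>. D (w + x *s u, \<theta>) (v *s u, 0))" for x v
    unfolding L_def using blinfun_apply_integral[OF intF, of x v] by (simp add: F_apply)
  \<comment> \<open>The defect is a \<theta>-derivative times a factor independent of \<theta>, and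
    it integrates to the boundary term P (z, pi) - P (z, 0) = 0.\<close>
  have L_CR: "L x 1 + \<i> * L x \<i> = 0" for x
  proof -
    define z where "z = w + x *s u"
    define C where "C = (\<Sum>j\<in>UNIV. 2 * \<i> * of_int (lam j) * z $ j * cnj (u $ j))"
    have int: "(\<lambda>\<theta>. D (z, \<theta>) v) integrable_on {0..pi}" for v
      by (intro integrable_continuous_real continuous_on_compose2[OF contD[of UNIV]] continuous_intros) auto
    have "L x 1 + \<i> * L x \<i> = integral {0..pi} (\<lambda>\<theta>. D (z, \<theta>) (u, 0) + \<i> * D (z, \<theta>) (\<i> *s u, 0))"
      unfolding L_apply z_def[symmetric]
      by (simp add: integral_add int integrable_on_mult_right)
    also have "\<dots> = integral {0..pi} (\<lambda>\<theta>. C * D (z, \<theta>) (0, 1))"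
    proof (rule integral_cong)
      fix \<theta>
      have "CR_form lam z (D (z, \<theta>)) j = 0" for j
        using P(2)[unfolded is_CR_iff, rule_format, of "(z, \<theta>)" j] by (simp add: D_def)
      then show "D (z, \<theta>) (u, 0) + \<i> * D (z, \<theta>) (\<i> *s u, 0) = C * D (z, \<theta>) (0, 1)"
        unfolding C_def by (intro CR_line_derivative has_derivative_bounded_linear[OF PD])
    qed
    also have "\<dots> = C * integral {0..pi} (\<lambda>\<theta>. D (z, \<theta>) (0, 1))" by simp
    also have "((\<lambda>\<theta>. D (z, \<theta>) (0, 1)) has_integral P (z, pi) - P (z, 0)) {0..pi}"
    proof (rule fundamental_theorem_of_calculus)
      fix \<theta> :: real
      have "((\<lambda>\<theta>. (z, \<theta>)) has_derivative (\<lambda>s. (0, s))) (at \<theta> within {0..pi})"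
        by (intro has_derivative_Pair has_derivative_const has_derivative_ident)
      from has_derivative_compose[OF this PD]
      have "((\<lambda>\<theta>. P (z, \<theta>)) has_derivative (\<lambda>s. D (z, \<theta>) (0, s))) (at \<theta> within {0..pi})" .
      moreover have "(\<lambda>s. D (z, \<theta>) (0, s)) = (\<lambda>s. s *\<^sub>R D (z, \<theta>) (0, 1))"
      proof
        show "D (z, \<theta>) (0, s) = s *\<^sub>R D (z, \<theta>) (0, 1)" for s
        using linear_scale[OF bounded_linear.linear[OF has_derivative_bounded_linear[OF PD]], of "(z, \<theta>)" s "(0, 1)"]
          by simp
      qed
      ultimately show "((\<lambda>\<theta>. P (z, \<theta>)) has_vector_derivative D (z, \<theta>) (0, 1)) (at \<theta> within {0..pi})"
        by (simp only: has_vector_derivative_def)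
    qed simp
    then have "integral {0..pi} (\<lambda>\<theta>. D (z, \<theta>) (0, 1)) = 0"
      using per by (simp add: integral_unique)
    finally show ?thesis by simp
  qed
  have "blinfun_apply (L x) = (\<lambda>v. L x 1 * v)" for x
  proof
    fix v
    have v: "v = Re v *\<^sub>R 1 + Im v *\<^sub>R \<i>" by (simp add: complex_eq_iff)
    have "L x v = Re v *\<^sub>R L x 1 + Im v *\<^sub>R L x \<i>"
      by (subst v) (simp only: blinfun.add_right blinfun.scaleR_right)
    also have "L x \<i> = \<i> * L x 1"
      using L_CR[of x] by (simp add: complex_eq_iff)
    also have "Re v *\<^sub>R L x 1 + Im v *\<^sub>R (\<i> * L x 1) = L x 1 * v"
      by (simp add: complex_eq_iff algebra_simps)
    finally show "L x v = L x 1 * v" .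
  qed
  then have "((\<lambda>x. integral {0..pi} (\<lambda>\<theta>. P (w + x *s u, \<theta>))) has_field_derivative L x 1) (at x)" for x
    using L[of x] by (simp only: has_field_derivative_def box_real)
  then show ?thesis
    by (auto simp: holomorphic_on_def field_differentiable_def)
qed


section \<open>Modes of a section\<close>

definition mode_integrand ::
    "('m::finite \<Rightarrow> int) \<Rightarrow> nat \<Rightarrow> int \<Rightarrow> ((complex ^ 'm) \<times> real \<Rightarrow> complex) \<Rightarrow> (complex ^ 'm) \<times> real \<Rightarrow> complex" where
  "mode_integrand lam k m f x = f x * exp (mode_coeff k m * heis_w lam x)"

definition mode ::
    "('m::finite \<Rightarrow> int) \<Rightarrow> nat \<Rightarrow> int \<Rightarrow> ((complex ^ 'm) \<times> real \<Rightarrow> complex) \<Rightarrow> complex ^ 'm \<Rightarrow> complex" where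
  "mode lam k m f z = integral {0..pi} (\<lambda>\<theta>. mode_integrand lam k m f (z, \<theta>))"

lemma mode_integrand_translate:
  assumes "(x, x') \<in> heis_rel lam" "f x' = f x * sasaki_factor lam mu x x' ^ k"
  shows "mode_integrand lam k m f x' = mode_integrand lam k m f x *
    exp (theta_exponent (mode_matrix lam mu k m) (fst x) (fst x' - fst x))"
  unfolding sasaki_factor_mode[OF assms(1), symmetric] mode_integrand_def assms(2)
  by (simp add: right_diff_distrib exp_diff)

lemma heis_rel_shift: "((z, \<theta>), (z, \<theta> + pi)) \<in> heis_rel lam"
  by (auto simp: heis_rel_iff heis_phase_simps intro!: exI[of _ 1])

lemma heis_rel_translate:
  "\<alpha> \<in> heis_lattice \<Longrightarrow> ((z, \<theta>), (z + \<alpha>, \<theta> + heis_phase lam z \<alpha>)) \<in> heis_rel lam"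
  by (auto simp: heis_rel_iff intro!: exI[of _ 0])

context
  fixes lam :: "'m::finite \<Rightarrow> int" and mu :: "'m \<Rightarrow> 'm \<Rightarrow> int" and k :: nat
    and f :: "(complex ^ 'm) \<times> real \<Rightarrow> complex"
  assumes f: "f \<in> CR_sections lam mu k" and sym: "\<And>j t. mu j t = mu t j"
begin

lemma mode_integrand_section_translate:
  "(x, x') \<in> heis_rel lam \<Longrightarrow> mode_integrand lam k m f x' = mode_integrand lam k m f x *
    exp (theta_exponent (mode_matrix lam mu k m) (fst x) (fst x' - fst x))"
  using f unfolding CR_sections_iff[of mu, OF sym] by (blast intro: mode_integrand_translate)

lemma mode_integrand_periodic:
  "mode_integrand lam k m f (z, \<theta> + pi) = mode_integrand lam k m f (z, \<theta>)"
  using mode_integrand_section_translate[OF heis_rel_shift, of m z \<theta>]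
  by (simp add: theta_exponent_def bilin_simps)

lemma smooth_mode_integrand: "smooth (mode_integrand lam k m f)"
  and is_CR_mode_integrand: "is_CR lam (mode_integrand lam k m f)"
  using f unfolding mode_integrand_def[abs_def] CR_sections_iff[of mu, OF sym]
  by (auto intro!: smooth_mult smooth_exp smooth_cmult smooth_heis_w is_CR_mult is_CR_exp is_CR_heis_w)

lemma continuous_on_mode_integrand:
  "continuous_on S g \<Longrightarrow> continuous_on S h \<Longrightarrow> continuous_on S (\<lambda>x. mode_integrand lam k m f (g x, h x))"
  by (rule continuous_on_compose2[OF smooth_continuous_on[OF smooth_mode_integrand, of UNIV]])
    (auto intro: continuous_intros)

text \<open>A lattice step in \<open>z\<close> also moves \<theta> by the phase, but the integral of
  a periodic function over a full period ignores this shift; the theta factor is independent of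
  \<theta> and leaves the integral.\<close>

lemma theta_function_mode: "theta_function (mode_matrix lam mu k m) (mode lam k m f)"
  unfolding theta_function_def
proof (intro conjI allI ballI)
  let ?P = "mode_integrand lam k m f"
  show "continuous_on UNIV (mode lam k m f)"
    unfolding mode_def[abs_def] box_real(2)[symmetric]
    by (rule integral_continuous_on_param)
      (auto simp: case_prod_unfold intro!: smooth_continuous_on smooth_mode_integrand)
  show "(\<lambda>t. mode lam k m f (w + t *s u)) holomorphic_on UNIV" for w u
    unfolding mode_def[abs_def]
    using mode_integrand_periodic[where \<theta> = 0]
    by (intro holomorphic_on_line_integral[OF smooth_mode_integrand is_CR_mode_integrand]) simp
  fix z \<alpha> :: "complex ^ 'm" assume \<alpha>: "\<alpha> \<in> heis_lattice"
  have "mode lam k m f (z + \<alpha>) = integral {0..pi} (\<lambda>\<theta>. ?P (z + \<alpha>, \<theta> + heis_phase lam z \<alpha>))"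
    unfolding mode_def
    by (rule integral_periodic_shift[symmetric])
      (auto intro!: continuous_on_mode_integrand continuous_intros mode_integrand_periodic)
  also have "\<dots> = integral {0..pi} (\<lambda>\<theta>. ?P (z, \<theta>) * exp (theta_exponent (mode_matrix lam mu k m) z \<alpha>))"
    using mode_integrand_section_translate[OF heis_rel_translate[OF \<alpha>], of m z] by simp
  finally show "mode lam k m f (z + \<alpha>) = mode lam k m f z * exp (theta_exponent (mode_matrix lam mu k m) z \<alpha>)"
    by (simp add: mode_def)
qed

text \<open>For fixed \<open>z\<close> the modes are, up to non-zero constants, the Fourier
  coefficients of the pi-periodic function \<open>?g\<close>.\<close>

lemma section_eq_0_if_modes_eq_0:
  assumes "\<And>m. mode lam k m f = (\<lambda>_. 0)"
  shows "f = (\<lambda>_. 0)"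
proof
  fix x :: "(complex ^ 'm) \<times> real"
  obtain z \<theta> where x: "x = (z, \<theta>)" by fastforce
  let ?g = "\<lambda>\<theta>. mode_integrand lam k 0 f (z, \<theta>)"
  have "?g \<theta> = 0"
  proof (rule fourier_uniqueness)
    show "continuous_on UNIV ?g" by (intro continuous_on_mode_integrand continuous_intros)
    show "?g (\<theta> + pi) = ?g \<theta>" for \<theta> by (rule mode_integrand_periodic)
    fix m :: int
    \<comment> \<open>The part of exp (2 i m w) that does not depend on \<theta>. The remaining
      character of index \<open>m\<close> belongs to the mode \<open>- m\<close>.\<close>
    define c where "c = exp (2 * \<i> * of_int m * (heis_w lam (z, 0)))"
    have "?g \<theta> * exp (2 * \<i> * of_int m * of_real \<theta>) = mode_integrand lam k (- m) f (z, \<theta>) / c" for \<theta>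
    proof -
      have "heis_w lam (z, \<theta>) = of_real \<theta> + heis_w lam (z, 0)" by (simp add: heis_w_def)
      then have "mode_coeff k 0 * heis_w lam (z, \<theta>) + 2 * \<i> * of_int m * of_real \<theta>
          = mode_coeff k (- m) * heis_w lam (z, \<theta>) - 2 * \<i> * of_int m * (heis_w lam (z, 0))"
        by (simp add: mode_coeff_def algebra_simps)
      then show ?thesis
        unfolding mode_integrand_def c_def
        by (simp only: mult.assoc[of "f (z, \<theta>)"] exp_add[symmetric] times_divide_eq_right[symmetric] exp_diff[symmetric])
    qed
    then have "integral {0..pi} (\<lambda>\<theta>. ?g \<theta> * exp (2 * \<i> * of_int m * of_real \<theta>)) = mode lam k (- m) f z / c"
      by (simp add: mode_def)
    then show "integral {0..pi} (\<lambda>\<theta>. ?g \<theta> * exp (2 * \<i> * of_int m * of_real \<theta>)) = 0"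
      by (simp add: assms)
  qed
  then show "f x = 0" by (simp add: x mode_integrand_def)
qed

text \<open>For negative \<open>m\<close> the diagonal entry at \<open>i\<close> is negative, for
  positive \<open>m\<close> the one at \<open>j\<close>: the bound on |m| makes 4 m \<lambda>
  outweigh k \<mu>.\<close>

lemma mode_eq_0_if_large:
  assumes "lam i > 0" "lam j < 0" and m: "\<bar>m\<bar> > int k * (\<bar>mu i i\<bar> + \<bar>mu j j\<bar>)"
  shows "mode lam k m f = (\<lambda>_. 0)"
proof -
  have le: "int k * mu t t \<le> int k * (\<bar>mu i i\<bar> + \<bar>mu j j\<bar>)" if "t = i \<or> t = j" for t
    using that by (intro mult_left_mono) auto
  have diag: "mode_matrix lam mu k m t t = int k * mu t t + 4 * m * lam t" for t
    by (simp add: mode_matrix_def)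
  have "\<exists>t. mode_matrix lam mu k m t t < 0"
  proof (cases "m < 0")
    case True
    then have "4 * m * lam i \<le> 4 * m * 1" using assms(1) by (intro mult_left_mono_neg) auto
    then have "mode_matrix lam mu k m i i < 0" using m le[OF disjI1[OF refl]] True unfolding diag by linarith
    then show ?thesis by blast
  next
    case False
    then have "4 * m * lam j \<le> 4 * m * - 1" using assms(2) by (intro mult_left_mono) auto
    then have "mode_matrix lam mu k m j j < 0" using m le[OF disjI2[OF refl]] False unfolding diag by linarith
    then show ?thesis by blast
  qed
  then obtain t where "mode_matrix lam mu k m t t < 0" by blast
  then show ?thesis
    using theta_function_eq_0_if_diagonal_neg[of "mode_matrix lam mu k m" "mode lam k m f" t,
        OF mode_matrix_commute[of mu, OF sym] theta_function_mode]
    by auto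
qed

end

section \<open>Finite dimensionality\<close>

lemma integrable_mode_integrand:
  assumes "f \<in> CR_sections lam mu k" and sym: "\<And>j t. mu j t = mu t j"
  shows "(\<lambda>\<theta>. mode_integrand lam k m f (z, \<theta>)) integrable_on {0..pi}"
  by (intro integrable_continuous_real continuous_on_mode_integrand[OF assms] continuous_intros)

text \<open>Induction over the functionals: the kernel of one of them is all of \<open>V\<close> or
  is complemented by a single vector \<open>v\<close>. Linearity is asked only on \<open>V\<close>,
  because a mode is an integral and its additivity comes from integrability.\<close>

lemma finite_spanning_set_of_functionals:
  assumes "finite I" "cfun.subspace V"
    and "\<And>i f g. i \<in> I \<Longrightarrow> f \<in> V \<Longrightarrow> g \<in> V \<Longrightarrow> \<phi> i (f + g) = (\<phi> i f + \<phi> i g :: complex)"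
    and "\<And>i c f. i \<in> I \<Longrightarrow> f \<in> V \<Longrightarrow> \<phi> i (scale_fun c f) = c * \<phi> i f"
    and "\<And>f. f \<in> V \<Longrightarrow> (\<And>i. i \<in> I \<Longrightarrow> \<phi> i f = 0) \<Longrightarrow> f = 0"
  shows "\<exists>B. finite B \<and> V \<subseteq> cfun.span B"
  using assms
proof (induction I arbitrary: V rule: finite_induct)
  case empty
  have "x \<in> cfun.span {}" if "x \<in> V" for x
  proof -
    have "x = 0" using empty.prems(4)[OF that] by blast
    then show ?thesis by (simp only: cfun.span_zero)
  qed
  then show ?case by blast
next
  case (insert i I)
  note sub = insert.prems(1)
  define W where "W = {f \<in> V. \<phi> i f = 0}"
  have "\<phi> i (0 + 0) = \<phi> i 0 + \<phi> i 0"
    by (intro insert.prems(2) cfun.subspace_0[OF sub]) simp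
  then have \<phi>0: "\<phi> i 0 = 0" unfolding add_0_left by simp
  have "cfun.subspace W"
  proof (rule cfun.subspaceI)
    show "0 \<in> W" using cfun.subspace_0[OF sub] \<phi>0 unfolding W_def by blast
    show "x + y \<in> W" if "x \<in> W" "y \<in> W" for x y
    proof -
      have "\<phi> i (x + y) = \<phi> i x + \<phi> i y"
        using that by (intro insert.prems(2)) (auto simp: W_def)
      then show ?thesis using that cfun.subspace_add[OF sub, of x y] by (simp add: W_def)
    qed
    show "scale_fun c x \<in> W" if "x \<in> W" for c x
    proof -
      have "\<phi> i (scale_fun c x) = c * \<phi> i x"
        using that by (intro insert.prems(3)) (auto simp: W_def)
      then show ?thesis using that cfun.subspace_scale[OF sub, of x c] by (simp add: W_def)
    qed
  qed
  then have "\<exists>B. finite B \<and> W \<subseteq> cfun.span B"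
  proof (rule insert.IH)
    show "\<phi> i' (f + g) = \<phi> i' f + \<phi> i' g" if "i' \<in> I" "f \<in> W" "g \<in> W" for i' f g
      using that by (intro insert.prems(2)) (auto simp: W_def)
    show "\<phi> i' (scale_fun c f) = c * \<phi> i' f" if "i' \<in> I" "f \<in> W" for i' c f
      using that by (intro insert.prems(3)) (auto simp: W_def)
    show "f = 0" if "f \<in> W" "\<And>i'. i' \<in> I \<Longrightarrow> \<phi> i' f = 0" for f
      by (rule insert.prems(4)) (use that in \<open>auto simp: W_def\<close>)
  qed
  then obtain B where B: "finite B" "W \<subseteq> cfun.span B" by blast
  show ?case
  proof (cases "W = V")
    case False
    then obtain v where v: "v \<in> V" "\<phi> i v \<noteq> 0" by (auto simp: W_def)
    have "f \<in> cfun.span (insert v B)" if f: "f \<in> V" for f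
    proof -
      define c where "c = \<phi> i f / \<phi> i v"
      define g where "g = f + scale_fun (- c) v"
      have cv: "scale_fun (- c) v \<in> V" using sub v(1) by (rule cfun.subspace_scale)
      have "g \<in> V" unfolding g_def by (rule cfun.subspace_add[OF sub f cv])
      moreover have "\<phi> i g = 0"
      proof -
        have "\<phi> i g = \<phi> i f + \<phi> i (scale_fun (- c) v)"
          unfolding g_def by (rule insert.prems(2)[OF _ f cv]) simp
        also have "\<phi> i (scale_fun (- c) v) = - c * \<phi> i v"
          by (rule insert.prems(3)[OF _ v(1)]) simp
        finally show ?thesis using v(2) by (simp add: c_def)
      qed
      ultimately have "g \<in> cfun.span B" using B(2) by (auto simp: W_def)
      then have "g \<in> cfun.span (insert v B)" using cfun.span_mono[of B "insert v B"] by blast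
      moreover have "scale_fun c v \<in> cfun.span (insert v B)"
        by (intro cfun.span_scale cfun.span_base) simp
      ultimately have "g + scale_fun c v \<in> cfun.span (insert v B)" by (rule cfun.span_add)
      moreover have "g + scale_fun c v = f" by (simp add: g_def scale_fun_def fun_eq_iff)
      ultimately show ?thesis by simp
    qed
    then show ?thesis using B(1) by (intro exI[of _ "insert v B"]) auto
  qed (use B in blast)
qed

lemma subspace_CR_sections:
  assumes sym: "\<And>j t. mu j t = mu t j"
  shows "cfun.subspace (CR_sections lam mu k)"
proof -
  note iff = CR_sections_iff[of mu, OF sym]
  have add: "is_CR lam (\<lambda>x. f x + g x)" if "smooth f" "smooth g" "is_CR lam f" "is_CR lam g" for f g
  proof (rule is_CRI[OF has_derivative_add[OF smooth_has_derivative[OF that(1)] smooth_has_derivative[OF that(2)]]])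
    fix x j
    have "CR_form lam (fst x) (\<lambda>h. frechet_derivative f (at x) h + frechet_derivative g (at x) h) j
      = CR_form lam (fst x) (frechet_derivative f (at x)) j + CR_form lam (fst x) (frechet_derivative g (at x)) j"
      by (simp add: CR_form_def field_simps)
    then show "CR_form lam (fst x) (\<lambda>h. frechet_derivative f (at x) h + frechet_derivative g (at x) h) j = 0"
      using that(3,4)[unfolded is_CR_iff, rule_format, of x j] by simp
  qed
  have const: "is_CR lam (\<lambda>x. c)" for c
    by (rule is_CRI[OF has_derivative_const]) (simp add: CR_form_def)
  show ?thesis
    unfolding cfun.subspace_def plus_fun_def zero_fun_def scale_fun_def
    by (auto simp: iff intro!: add const is_CR_mult smooth_add smooth_const smooth_mult simp: algebra_simps)
qed

lemma CR_sections_finite_spanning_set: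
  assumes sym: "\<And>j t. mu j t = mu t j" and "lam i > 0" "lam j < 0"
  shows "\<exists>B. finite B \<and> CR_sections lam mu k \<subseteq> cfun.span B"
proof -
  define R where "R = int k * (\<bar>mu i i\<bar> + \<bar>mu j j\<bar>)"
  have "\<exists>N. finite N \<and> (\<forall>h. theta_function (mode_matrix lam mu k m) h \<longrightarrow> (\<forall>z\<in>N. h z = 0) \<longrightarrow> h = (\<lambda>_. 0))" for m
    using theta_function_determining_set[of "mode_matrix lam mu k m", OF mode_matrix_commute[of mu, OF sym]]
    by metis
  then obtain N where N: "\<And>m. finite (N m)"
    "\<And>m h. theta_function (mode_matrix lam mu k m) h \<Longrightarrow> (\<And>z. z \<in> N m \<Longrightarrow> h z = 0) \<Longrightarrow> h = (\<lambda>_. 0)"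
    by metis
  show ?thesis
  proof (rule finite_spanning_set_of_functionals[where \<phi> = "\<lambda>(m, z) f. mode lam k m f z"])
    show "finite (Sigma {- R..R} N)" using N(1) by blast
    show "cfun.subspace (CR_sections lam mu k)" by (rule subspace_CR_sections[OF sym])
    fix p :: "int \<times> (complex ^ 'a)"
    obtain m z where p: "p = (m, z)" by fastforce
    show "(case p of (m, z) \<Rightarrow> \<lambda>f. mode lam k m f z) (f + g)
        = (case p of (m, z) \<Rightarrow> \<lambda>f. mode lam k m f z) f + (case p of (m, z) \<Rightarrow> \<lambda>f. mode lam k m f z) g"
      if "f \<in> CR_sections lam mu k" "g \<in> CR_sections lam mu k" for f g
      using integral_add[OF integrable_mode_integrand[OF that(1) sym] integrable_mode_integrand[OF that(2) sym], of m z m z]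
      by (simp add: p mode_def mode_integrand_def distrib_right)
    show "(case p of (m, z) \<Rightarrow> \<lambda>f. mode lam k m f z) (scale_fun c f)
        = c * (case p of (m, z) \<Rightarrow> \<lambda>f. mode lam k m f z) f" for c f
      by (simp add: p mode_def mode_integrand_def scale_fun_def mult.assoc)
  next
    fix f assume f: "f \<in> CR_sections lam mu k"
      and 0: "\<And>p. p \<in> Sigma {- R..R} N \<Longrightarrow> (case p of (m, z) \<Rightarrow> \<lambda>f. mode lam k m f z) f = 0"
    have "mode lam k m f = (\<lambda>_. 0)" for m
    proof (cases "\<bar>m\<bar> > R")
      case True
      then show ?thesis
        using mode_eq_0_if_large[OF f sym assms(2,3)] by (simp add: R_def)
    next
      case False
      then have m: "m \<in> {- R..R}" by auto
      show ?thesis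
      proof (rule N(2)[OF theta_function_mode[OF f sym]])
        show "mode lam k m f z = 0" if "z \<in> N m" for z
          using 0[of "(m, z)"] m that by simp
      qed
    qed
    then show "f = 0"
      using section_eq_0_if_modes_eq_0[OF f sym] by (simp add: zero_fun_def)
  qed
qed

text \<open>The finite spanning set makes the basis behind \<open>dim\<close> finite, and the
  exchange argument then bounds the size of every independent set.\<close>

lemma dim_CR_sections_ge:
  assumes sym: "\<And>j t. mu j t = mu t j" and "lam i > 0" "lam j < 0"
    and S: "S \<subseteq> CR_sections lam mu k" "cfun.independent S"
  shows "card S \<le> cfun.dim (CR_sections lam mu k)"
proof -
  obtain T where T: "finite T" "CR_sections lam mu k \<subseteq> cfun.span T"
    using CR_sections_finite_spanning_set[of mu lam i j k, OF sym assms(2,3)] by blast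
  obtain B where B: "B \<subseteq> CR_sections lam mu k" "cfun.independent B"
    "CR_sections lam mu k \<subseteq> cfun.span B" "card B = cfun.dim (CR_sections lam mu k)"
    by (rule cfun.basis_exists)
  have "finite B" using cfun.independent_span_bound[OF T(1) B(2)] B(1) T(2) by blast
  then show ?thesis
    using cfun.independent_span_bound[of B S] S B(3,4) by auto
qed

section \<open>Theta series\<close>

text \<open>Each absolute value comes from at most two integers, so twice a geometric series bounds
  the sum uniformly in \<open>S\<close>.\<close>

lemma sum_abs_exp_neg_le:
  fixes S :: "int set"
  assumes "finite S"
  shows "(\<Sum>n\<in>S. exp (- \<bar>of_int n\<bar>)) \<le> 2 / (1 - exp (- 1 :: real))"
proof -
  let ?q = "exp (- 1 :: real)"
  define N where "N = (\<Sum>n\<in>S. nat \<bar>n\<bar>)"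
  have "S \<subseteq> int ` {..N} \<union> (\<lambda>n. - int n) ` {..N}"
  proof
    fix n assume n: "n \<in> S"
    then have "nat \<bar>n\<bar> \<le> N" unfolding N_def using assms by (intro member_le_sum) auto
    then show "n \<in> int ` {..N} \<union> (\<lambda>n. - int n) ` {..N}"
      by (cases "n \<ge> 0") (auto intro: image_eqI[of _ _ "nat \<bar>n\<bar>"])
  qed
  then have "(\<Sum>n\<in>S. exp (- \<bar>of_int n\<bar>) :: real)
      \<le> (\<Sum>n\<in>int ` {..N} \<union> (\<lambda>n. - int n) ` {..N}. exp (- \<bar>of_int n\<bar>))"
    by (intro sum_mono2) auto
  also have "\<dots> \<le> (\<Sum>n\<in>int ` {..N}. exp (- \<bar>of_int n\<bar>)) + (\<Sum>n\<in>(\<lambda>n. - int n) ` {..N}. exp (- \<bar>of_int n\<bar>))"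
    by (subst sum.union_inter[symmetric]) (auto intro: sum_nonneg)
  also have "\<dots> = 2 * (\<Sum>n\<le>N. ?q ^ n)"
    by (subst (1 2) sum.reindex) (auto simp: inj_on_def exp_of_nat_mult[symmetric])
  also have "(\<Sum>n\<le>N. ?q ^ n) \<le> (\<Sum>n. ?q ^ n)"
    by (intro sum_le_suminf summable_geometric) auto
  also have "(\<Sum>n. ?q ^ n) = 1 / (1 - ?q)"
    by (intro suminf_geometric) auto
  finally show ?thesis by simp
qed

text \<open>Completing the square for D + 1 instead of D keeps a spare linear decay - x, which makes
  the sum over the integers converge.\<close>

lemma quadratic_exp_bound:
  fixes x D \<gamma> :: real assumes "\<gamma> > 0"
  shows "D * x - \<gamma> * x\<^sup>2 \<le> (D + 1)\<^sup>2 / (4 * \<gamma>) - x"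
proof -
  have "0 \<le> (2 * \<gamma> * x - (D + 1))\<^sup>2 / (4 * \<gamma>)" using assms by simp
  also have "\<dots> = \<gamma> * x\<^sup>2 - (D + 1) * x + (D + 1)\<^sup>2 / (4 * \<gamma>)"
    using assms by (simp add: power2_eq_square field_simps)
  finally show ?thesis by (simp add: algebra_simps)
qed

text \<open>Enlarging \<open>S\<close> to the product of its coordinate projections factorises the
  sum, and each factor is bounded independently of the projection. One constant thus serves for all
  partial sums.\<close>

lemma gaussian_sum_bound:
  fixes \<gamma> D :: real assumes \<gamma>: "\<gamma> > 0"
  obtains C where "\<And>S :: ('m::finite \<Rightarrow> int) set. finite S \<Longrightarrow>
    (\<Sum>b\<in>S. exp (D * (\<Sum>j\<in>UNIV. \<bar>of_int (b j)\<bar>) - \<gamma> * (\<Sum>j\<in>UNIV. (of_int (b j))\<^sup>2))) \<le> C"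
proof
  fix S :: "('m \<Rightarrow> int) set" assume S: "finite S"
  define G where "G n = exp ((D + 1)\<^sup>2 / (4 * \<gamma>)) * exp (- \<bar>of_int n\<bar>)" for n :: int
  define T where "T j = (\<lambda>b. b j) ` S" for j :: 'm
  have "exp (D * (\<Sum>j\<in>UNIV. \<bar>of_int (b j)\<bar>) - \<gamma> * (\<Sum>j\<in>UNIV. (of_int (b j))\<^sup>2)) \<le> (\<Prod>j\<in>UNIV. G (b j))" for b :: "'m \<Rightarrow> int"
  proof -
    have "D * (\<Sum>j\<in>UNIV. \<bar>of_int (b j)\<bar>) - \<gamma> * (\<Sum>j\<in>UNIV. (of_int (b j))\<^sup>2)
        = (\<Sum>j\<in>UNIV. D * \<bar>of_int (b j)\<bar> - \<gamma> * \<bar>of_int (b j)\<bar>\<^sup>2)"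
      by (simp add: sum_subtractf sum_distrib_left)
    also have "\<dots> \<le> (\<Sum>j\<in>UNIV. (D + 1)\<^sup>2 / (4 * \<gamma>) - \<bar>of_int (b j)\<bar>)"
      by (intro sum_mono quadratic_exp_bound \<gamma>)
    finally have "exp (D * (\<Sum>j\<in>UNIV. \<bar>of_int (b j)\<bar>) - \<gamma> * (\<Sum>j\<in>UNIV. (of_int (b j))\<^sup>2))
        \<le> exp (\<Sum>j\<in>UNIV. (D + 1)\<^sup>2 / (4 * \<gamma>) - \<bar>of_int (b j)\<bar>)" by simp
    also have "\<dots> = (\<Prod>j\<in>UNIV. G (b j))" by (subst exp_sum) (auto simp: G_def exp_add[symmetric])
    finally show ?thesis .
  qed
  then have "(\<Sum>b\<in>S. exp (D * (\<Sum>j\<in>UNIV. \<bar>of_int (b j)\<bar>) - \<gamma> * (\<Sum>j\<in>UNIV. (of_int (b j))\<^sup>2)))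
      \<le> (\<Sum>b\<in>S. \<Prod>j\<in>UNIV. G (b j))" by (intro sum_mono)
  also have "\<dots> \<le> (\<Sum>b\<in>PiE UNIV T. \<Prod>j\<in>UNIV. G (b j))"
    using S by (intro sum_mono2 finite_PiE) (auto simp: T_def G_def intro!: prod_nonneg)
  also have "\<dots> = (\<Prod>j\<in>UNIV. \<Sum>n\<in>T j. G n)"
    using S by (intro prod_sum_PiE[symmetric]) (auto simp: T_def)
  also have "\<dots> \<le> (\<Prod>j\<in>(UNIV :: 'm set). exp ((D + 1)\<^sup>2 / (4 * \<gamma>)) * (2 / (1 - exp (- 1))))"
    unfolding G_def sum_distrib_left[symmetric] using S
    by (intro prod_mono conjI mult_left_mono sum_abs_exp_neg_le mult_nonneg_nonneg sum_nonneg) (auto simp: T_def)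
  finally show "(\<Sum>b\<in>S. exp (D * (\<Sum>j\<in>UNIV. \<bar>of_int (b j)\<bar>) - \<gamma> * (\<Sum>j\<in>UNIV. (of_int (b j))\<^sup>2)))
      \<le> (\<Prod>j\<in>(UNIV :: 'm set). exp ((D + 1)\<^sup>2 / (4 * \<gamma>)) * (2 / (1 - exp (- 1))))" .
qed

section \<open>Theta series: terms, convergence and quasi-periodicity\<close>

definition quad_form :: "('m \<Rightarrow> 'm \<Rightarrow> int) \<Rightarrow> ('m::finite \<Rightarrow> real) \<Rightarrow> real" where
  "quad_form A v = (\<Sum>j\<in>UNIV. \<Sum>t\<in>UNIV. of_int (A j t) * v j * v t)"

definition ivec :: "('m \<Rightarrow> int) \<Rightarrow> complex ^ 'm" where
  "ivec b = (\<chi> j. of_int (b j))"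

definition cdot :: "complex ^ 'm \<Rightarrow> complex ^ 'm::finite \<Rightarrow> complex" where
  "cdot u v = (\<Sum>j\<in>UNIV. u $ j * v $ j)"

lemma cdot_simps:
  "cdot (u + u') v = cdot u v + cdot u' v"
  "cdot u (v + v') = cdot u v + cdot u v'"
  "cdot (c *s u) v = c * cdot u v"
  "cdot u (c *s v) = c * cdot u v"
  by (simp_all add: cdot_def algebra_simps sum.distrib sum_distrib_left)

lemma ivec_simps [simp]: "ivec b $ j = of_int (b j)" "ivec (b + b') = ivec b + ivec b'" "cnjv (ivec b) = ivec b"
  by (simp_all add: ivec_def vec_eq_iff)

lemma bilin_ivec_ivec: "bilin A (ivec b) (ivec b) = of_real (quad_form A (\<lambda>j. of_int (b j)))"
  by (simp add: bilin_def quad_form_def mult.assoc)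

text \<open>An enumeration turns the family of terms into a sequence, to which termwise
  differentiation applies; the shift of the summation index is done with \<open>infsum\<close>
  instead.\<close>

definition enum_int_fun :: "nat \<Rightarrow> ('m::finite \<Rightarrow> int)" where
  "enum_int_fun = from_nat_into UNIV"

lemma bij_enum_int_fun: "bij (enum_int_fun :: nat \<Rightarrow> ('m::finite \<Rightarrow> int))"
proof -
  have "inj (\<lambda>(n::int) (j::'m). n)" by (auto simp: inj_def fun_eq_iff)
  then have "infinite (range (\<lambda>(n::int) (j::'m). n))"
    using finite_imageD infinite_UNIV_int by blast
  then have "infinite (UNIV :: ('m \<Rightarrow> int) set)" using finite_subset subset_UNIV by blast
  then show ?thesis
    unfolding enum_int_fun_def using bij_betw_from_nat_into[of "UNIV :: ('m \<Rightarrow> int) set"] by simp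
qed

lemma suminf_enum_int_fun:
  fixes g :: "('m::finite \<Rightarrow> int) \<Rightarrow> complex"
  assumes "summable (\<lambda>n. norm (g (enum_int_fun n)))"
  shows "(\<Sum>n. g (enum_int_fun n)) = infsum g UNIV"
proof -
  have "((\<lambda>n. g (enum_int_fun n)) has_sum (\<Sum>n. g (enum_int_fun n))) UNIV"
    by (rule norm_summable_imp_has_sum[OF assms summable_sums[OF summable_norm_cancel[OF assms]]])
  then have "(g has_sum (\<Sum>n. g (enum_int_fun n))) UNIV"
    using has_sum_reindex_bij_betw[OF bij_enum_int_fun, of g] by blast
  then show ?thesis by (simp add: infsumI)
qed

definition heis_period :: real where "heis_period = sqrt (2 * pi)"

lemma heis_period_sq: "of_real heis_period * of_real heis_period = (2 * of_real pi :: complex)"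
  unfolding of_real_mult[symmetric] by (simp add: heis_period_def)

lemma heis_period_sq': "of_real heis_period * (of_real heis_period * c) = (2 * of_real pi * c :: complex)"
  by (simp add: mult.assoc[symmetric] heis_period_sq)

lemma heis_lattice_decomp:
  assumes "\<alpha> \<in> heis_lattice"
  obtains a b where "\<alpha> = of_real heis_period *s ivec a + (\<i> * of_real heis_period) *s ivec b"
proof -
  obtain a b :: "'a \<Rightarrow> int" where
    "\<And>j. \<alpha> $ j = of_real (sqrt (2 * pi)) * of_int (a j) + \<i> * of_real (sqrt (2 * pi)) * of_int (b j)"
    using assms unfolding heis_lattice_def by blast
  then have "\<alpha> = of_real heis_period *s ivec a + (\<i> * of_real heis_period) *s ivec b"
    by (simp add: vec_eq_iff heis_period_def)
  then show ?thesis by (rule that)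
qed

text \<open>Quasi-periodicity in the imaginary directions determines the Fourier coefficients of a theta function
  (with respect to the real lattice directions, after splitting off \<open>exp (bilin A z z / 2)\<close>)
  on each class of frequencies \<open>p + 2 A b\<close> up to a common factor.\<close>

definition theta_lin :: "('m \<Rightarrow> 'm \<Rightarrow> int) \<Rightarrow> ('m \<Rightarrow> int) \<Rightarrow> ('m::finite \<Rightarrow> int) \<Rightarrow> complex ^ 'm \<Rightarrow> complex" where
  "theta_lin A p b z = \<i> * of_real heis_period * (cdot (ivec p) z + 2 * bilin A (ivec b) z)"

text \<open>At the frequency q = p + 2 A b this is the Gaussian exp (- (pi / 2) q A^(-1) q),
  normalised to 1 at b = 0. Written in terms of \<open>b\<close> it needs no inverse matrix.\<close>

definition theta_coeff :: "('m \<Rightarrow> 'm \<Rightarrow> int) \<Rightarrow> ('m \<Rightarrow> int) \<Rightarrow> ('m::finite \<Rightarrow> int) \<Rightarrow> complex" where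
  "theta_coeff A p b = exp (- 2 * of_real pi * (cdot (ivec p) (ivec b) + bilin A (ivec b) (ivec b)))"

definition theta_series :: "('m \<Rightarrow> 'm \<Rightarrow> int) \<Rightarrow> ('m \<Rightarrow> int) \<Rightarrow> complex ^ 'm::finite \<Rightarrow> complex" where
  "theta_series A p z = (\<Sum>n. theta_coeff A p (enum_int_fun n) * exp (theta_lin A p (enum_int_fun n) z))"

definition theta_basis :: "('m \<Rightarrow> 'm \<Rightarrow> int) \<Rightarrow> ('m \<Rightarrow> int) \<Rightarrow> complex ^ 'm::finite \<Rightarrow> complex" where
  "theta_basis A p z = exp (bilin A z z / 2) * theta_series A p z"

definition theta_lin_bound :: "('m \<Rightarrow> 'm \<Rightarrow> int) \<Rightarrow> ('m \<Rightarrow> int) \<Rightarrow> ('m::finite \<Rightarrow> int) \<Rightarrow> real" where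
  "theta_lin_bound A p b = heis_period * ((\<Sum>j\<in>UNIV. \<bar>of_int (p j)\<bar>) +
     2 * (\<Sum>j\<in>UNIV. \<Sum>t\<in>UNIV. \<bar>of_int (A j t)\<bar>) * (\<Sum>j\<in>UNIV. \<bar>of_int (b j)\<bar>))"

lemma heis_period_pos: "heis_period > 0" by (simp add: heis_period_def)

lemma theta_lin_bound_nonneg: "theta_lin_bound A p b \<ge> 0"
  unfolding theta_lin_bound_def using heis_period_pos
  by (intro mult_nonneg_nonneg add_nonneg_nonneg sum_nonneg) auto

lemma norm_theta_lin_le: "norm (theta_lin A p b z) \<le> theta_lin_bound A p b * norm z"
proof -
  have "norm (cdot (ivec p) z) \<le> (\<Sum>j\<in>UNIV. \<bar>of_int (p j)\<bar> * norm z)"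
    unfolding cdot_def
    by (intro sum_norm_le) (auto simp: norm_mult norm_of_int intro!: mult_left_mono Finite_Cartesian_Product.norm_nth_le)
  moreover have "norm (bilin A (ivec b) z) \<le>
      (\<Sum>j\<in>UNIV. \<Sum>t\<in>UNIV. \<bar>of_int (A j t)\<bar> * ((\<Sum>j\<in>UNIV. \<bar>of_int (b j)\<bar>) * norm z))"
    unfolding bilin_def
  proof (intro sum_norm_le order_trans[OF norm_sum] sum_mono)
    fix j t
    have "\<bar>of_int (b j)\<bar> \<le> (\<Sum>j\<in>UNIV. \<bar>of_int (b j) :: real\<bar>)"
      by (rule member_le_sum) auto
    then show "norm (of_int (A j t) * (ivec b $ j * z $ t))
        \<le> \<bar>of_int (A j t)\<bar> * ((\<Sum>j\<in>UNIV. \<bar>of_int (b j)\<bar>) * norm z)"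
      by (auto simp: norm_mult norm_of_int intro!: mult_left_mono mult_mono Finite_Cartesian_Product.norm_nth_le sum_nonneg)
  qed
  ultimately have "norm (cdot (ivec p) z + 2 * bilin A (ivec b) z) \<le> (\<Sum>j\<in>UNIV. \<bar>of_int (p j)\<bar> * norm z) +
     2 * (\<Sum>j\<in>UNIV. \<Sum>t\<in>UNIV. \<bar>of_int (A j t)\<bar> * ((\<Sum>j\<in>UNIV. \<bar>of_int (b j)\<bar>) * norm z))"
    by (intro order_trans[OF norm_triangle_ineq] add_mono) (auto simp: norm_mult)
  also have "\<dots> = ((\<Sum>j\<in>UNIV. \<bar>of_int (p j)\<bar>) +
     2 * (\<Sum>j\<in>UNIV. \<Sum>t\<in>UNIV. \<bar>of_int (A j t)\<bar>) * (\<Sum>j\<in>UNIV. \<bar>of_int (b j)\<bar>)) * norm z"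
    by (simp add: sum_distrib_right[symmetric] distrib_right mult.assoc)
  finally have "heis_period * norm (cdot (ivec p) z + 2 * bilin A (ivec b) z) \<le> theta_lin_bound A p b * norm z"
    unfolding theta_lin_bound_def mult.assoc[of heis_period] using heis_period_pos by (intro mult_left_mono) auto
  then show ?thesis using heis_period_pos by (simp add: theta_lin_def norm_mult)
qed

lemma theta_lin_smult: "theta_lin A p b (c *s z) = c * theta_lin A p b z"
  by (simp add: theta_lin_def cdot_simps bilin_simps algebra_simps)

lemma bounded_linear_theta_lin: "bounded_linear (theta_lin A p b)"
proof (rule bounded_linear_intro[where K = "theta_lin_bound A p b"])
  show "theta_lin A p b (x + y) = theta_lin A p b x + theta_lin A p b y" for x y
    by (simp add: theta_lin_def cdot_simps bilin_simps algebra_simps)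
  have "r *\<^sub>R x = complex_of_real r *s x" for r and x :: "complex ^ 'a"
    by (simp add: vec_eq_iff complex_eq_iff)
  then show "theta_lin A p b (r *\<^sub>R x) = r *\<^sub>R theta_lin A p b x" for r x
    by (metis theta_lin_smult scaleR_conv_of_real)
  show "norm (theta_lin A p b x) \<le> norm x * theta_lin_bound A p b" for x
    using norm_theta_lin_le[of A p b x] by (simp add: mult.commute)
qed

lemma norm_theta_coeff:
  "norm (theta_coeff A p b)
     = exp (- 2 * pi * ((\<Sum>j\<in>UNIV. of_int (p j) * of_int (b j)) + quad_form A (\<lambda>j. of_int (b j))))"
  unfolding theta_coeff_def bilin_ivec_ivec norm_exp_eq_Re by (simp add: cdot_def)

text \<open>The constant is kept explicit: it governs the convergence of the theta series and,
  through \<open>int_box_incongruent\<close>, the number of frequency classes that can be told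
  apart.\<close>

definition posdef_by :: "('m::finite \<Rightarrow> 'm \<Rightarrow> int) \<Rightarrow> real \<Rightarrow> bool" where
  "posdef_by A \<delta> \<longleftrightarrow> \<delta> > 0 \<and> (\<forall>v. quad_form A v \<ge> \<delta> * (\<Sum>j\<in>UNIV. (v j)\<^sup>2))"

text \<open>The exponents grow linearly in b while the coefficients decay like a Gaussian, so every
  \<open>R\<close> is allowed.\<close>

lemma theta_summable:
  assumes "posdef_by A \<delta>"
  shows "summable (\<lambda>n. norm (theta_coeff A p (enum_int_fun n)) * exp (R * theta_lin_bound A p (enum_int_fun n)))"
proof -
  define b1 where "b1 b = (\<Sum>j\<in>UNIV. \<bar>of_int (b j) :: real\<bar>)" for b :: "'a \<Rightarrow> int"
  define P where "P = b1 p"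
  define a where "a = 2 * (\<Sum>j\<in>UNIV. \<Sum>t\<in>UNIV. \<bar>of_int (A j t) :: real\<bar>)"
  \<comment> \<open>All terms linear in b: one from the frequency \<open>p\<close> in the
    coefficient, one from the bound on the exponent.\<close>
  define D where "D = 2 * pi * P + R * heis_period * a"
  define \<gamma> where "\<gamma> = 2 * pi * \<delta>"
  have \<gamma>: "\<gamma> > 0" using assms by (simp add: \<gamma>_def posdef_by_def)
  define G where "G b = exp (D * b1 b - \<gamma> * (\<Sum>j\<in>UNIV. (of_int (b j))\<^sup>2))" for b :: "'a \<Rightarrow> int"
  obtain C where C: "\<And>S. finite S \<Longrightarrow> (\<Sum>b\<in>S. G b) \<le> C"
    using gaussian_sum_bound[OF \<gamma>, where D = D and 'm = 'a] unfolding G_def b1_def by blast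
  have "summable (\<lambda>n. G (enum_int_fun n))"
  proof (rule summableI_nonneg_bounded)
    show "0 \<le> G (enum_int_fun n)" for n by (simp add: G_def)
    have "(\<Sum>i<n. G (enum_int_fun i)) = (\<Sum>b\<in>enum_int_fun ` {..<n}. G b)" for n
      using bij_is_inj[OF bij_enum_int_fun] by (subst sum.reindex) (auto intro: inj_on_subset)
    then show "(\<Sum>i<n. G (enum_int_fun i)) \<le> C" for n using C by simp
  qed
  then have s: "summable (\<lambda>n. exp (R * heis_period * P) * G (enum_int_fun n))"
    by (rule summable_mult)
  show ?thesis
  proof (rule summable_comparison_test'[OF s, where N = 0])
    fix n
    define b :: "'a \<Rightarrow> int" where "b = enum_int_fun n"
    have "\<bar>of_int (b j)\<bar> \<le> b1 b" for j unfolding b1_def by (rule member_le_sum) auto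
    then have "- (of_int (p j) * of_int (b j)) \<le> \<bar>of_int (p j)\<bar> * b1 b" for j
      using abs_ge_minus_self[of "of_int (p j) * of_int (b j) :: real"]
        mult_left_mono[of "\<bar>of_int (b j)\<bar>" "b1 b" "\<bar>of_int (p j) :: real\<bar>"]
      by (simp add: abs_mult)
    then have "- (\<Sum>j\<in>UNIV. of_int (p j) * of_int (b j)) \<le> P * b1 b"
      unfolding P_def b1_def[of p] sum_distrib_right sum_negf[symmetric] by (intro sum_mono)
    moreover have "\<delta> * (\<Sum>j\<in>UNIV. (of_int (b j))\<^sup>2) \<le> quad_form A (\<lambda>j. of_int (b j))"
      using assms by (auto simp: posdef_by_def)
    ultimately have "- ((\<Sum>j\<in>UNIV. of_int (p j) * of_int (b j)) + quad_form A (\<lambda>j. of_int (b j)))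
        \<le> P * b1 b - \<delta> * (\<Sum>j\<in>UNIV. (of_int (b j))\<^sup>2)" by linarith
    from mult_left_mono[OF this, of "2 * pi"]
    have "- 2 * pi * ((\<Sum>j\<in>UNIV. of_int (p j) * of_int (b j)) + quad_form A (\<lambda>j. of_int (b j)))
        \<le> 2 * pi * (P * b1 b - \<delta> * (\<Sum>j\<in>UNIV. (of_int (b j))\<^sup>2))"
      by (simp only: mult_minus_right mult_minus_left) simp
    then have "norm (theta_coeff A p b) \<le> exp (2 * pi * (P * b1 b - \<delta> * (\<Sum>j\<in>UNIV. (of_int (b j))\<^sup>2)))"
      unfolding norm_theta_coeff by (rule iffD2[OF exp_le_cancel_iff])
    then have "norm (theta_coeff A p b) * exp (R * theta_lin_bound A p b)
        \<le> exp (2 * pi * (P * b1 b - \<delta> * (\<Sum>j\<in>UNIV. (of_int (b j))\<^sup>2))) * exp (R * theta_lin_bound A p b)"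
      by (rule mult_right_mono) simp
    also have "\<dots> = exp (R * heis_period * P) * G b"
      unfolding exp_add[symmetric] G_def D_def \<gamma>_def theta_lin_bound_def P_def b1_def[of p] b1_def[of b, symmetric] a_def
      by (simp add: algebra_simps)
    finally show "norm (norm (theta_coeff A p (enum_int_fun n)) * exp (R * theta_lin_bound A p (enum_int_fun n)))
        \<le> exp (R * heis_period * P) * G (enum_int_fun n)"
      by (simp add: b_def)
  qed
qed

lemma theta_series_summable:
  assumes "posdef_by A \<delta>"
  shows "summable (\<lambda>n. norm (theta_coeff A p (enum_int_fun n) * exp (theta_lin A p (enum_int_fun n) z)))"
proof (rule summable_comparison_test'[OF theta_summable[OF assms, of p "norm z"], where N = 0])
  fix n
  show "norm (norm (theta_coeff A p (enum_int_fun n) * exp (theta_lin A p (enum_int_fun n) z)))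
      \<le> norm (theta_coeff A p (enum_int_fun n)) * exp (norm z * theta_lin_bound A p (enum_int_fun n))"
    using exp_series_summable_bound[of "\<lambda>n. theta_lin A p (enum_int_fun n)" "\<lambda>n. theta_lin_bound A p (enum_int_fun n)"
        z "norm z" "\<lambda>n. theta_coeff A p (enum_int_fun n)" n]
    by (simp add: norm_theta_lin_le theta_lin_bound_nonneg)
qed

lemma theta_series_infsum:
  assumes "posdef_by A \<delta>"
  shows "theta_series A p z = infsum (\<lambda>b. theta_coeff A p b * exp (theta_lin A p b z)) UNIV"
  unfolding theta_series_def by (rule suminf_enum_int_fun[OF theta_series_summable[OF assms]])

text \<open>A real lattice step leaves every exponential of the series unchanged and is accounted
  for by the prefactor exp (bilin A z z / 2). An imaginary step moves the summation index by
  \<open>b0\<close>.\<close>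

lemma theta_basis_translate:
  assumes sym: "\<And>j t. A j t = A t j" and pos: "posdef_by A \<delta>" and \<alpha>: "\<alpha> \<in> heis_lattice"
  shows "theta_basis A p (z + \<alpha>) = theta_basis A p z * exp (theta_exponent A z \<alpha>)"
proof -
  obtain a b0 where \<alpha>: "\<alpha> = of_real heis_period *s ivec a + (\<i> * of_real heis_period) *s ivec b0"
    using heis_lattice_decomp[OF \<alpha>] .
  define E where "E b z = exp (bilin A z z / 2) * (theta_coeff A p b * exp (theta_lin A p b z))" for b z
  have basis: "theta_basis A p z = infsum (\<lambda>b. E b z) UNIV" for z
    by (simp add: theta_basis_def theta_series_infsum[OF pos] E_def infsum_cmult_right')
  have E: "E b z = exp (bilin A z z / 2 - 2 * of_real pi * (cdot (ivec p) (ivec b) + bilin A (ivec b) (ivec b))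
      + theta_lin A p b z)" for b z
    unfolding E_def theta_coeff_def exp_add[symmetric] by (rule arg_cong[of _ _ exp]) simp
  have shift: "E b (z + \<alpha>) = E (b + b0) z * exp (theta_exponent A z \<alpha>)" for b
  proof -
    \<comment> \<open>Collects the integer multiples of 2 pi i: the phases of the real step in the
      series, and the cross term of the two steps in the prefactor.\<close>
    define N where "N = (\<Sum>j\<in>UNIV. p j * a j) + 2 * (\<Sum>j\<in>UNIV. \<Sum>t\<in>UNIV. A j t * b j * a t)
      + (\<Sum>j\<in>UNIV. \<Sum>t\<in>UNIV. A j t * a j * b0 t)"
    have N: "of_int N = cdot (ivec p) (ivec a) + 2 * bilin A (ivec b) (ivec a) + bilin A (ivec a) (ivec b0)"
      by (simp add: N_def cdot_def bilin_def mult.assoc)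
    have c: "bilin A (ivec b0) z = bilin A z (ivec b0)" "bilin A (ivec b0) (ivec a) = bilin A (ivec a) (ivec b0)"
      "bilin A (ivec b0) (ivec b) = bilin A (ivec b) (ivec b0)" "bilin A (ivec a) z = bilin A z (ivec a)"
      using bilin_commute[of A, OF sym] by auto
    have "bilin A (z + \<alpha>) (z + \<alpha>) / 2 - 2 * of_real pi * (cdot (ivec p) (ivec b) + bilin A (ivec b) (ivec b))
          + theta_lin A p b (z + \<alpha>)
        = bilin A z z / 2 - 2 * of_real pi * (cdot (ivec p) (ivec (b + b0)) + bilin A (ivec (b + b0)) (ivec (b + b0)))
          + theta_lin A p (b + b0) z + theta_exponent A z \<alpha> + 2 * of_int N * of_real pi * \<i>"
      unfolding N theta_lin_def theta_exponent_def \<alpha>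
      by (simp add: bilin_simps cdot_simps c) (simp add: field_simps heis_period_sq heis_period_sq')
    then show ?thesis
      unfolding E exp_add[symmetric] by (simp only: exp_plus_of_int_2pi_i)
  qed
  have "bij (\<lambda>b. b + b0)" by (rule bij_betwI[where g = "\<lambda>b. b - b0"]) auto
  then have "infsum (\<lambda>b. E (b + b0) z) UNIV = infsum (\<lambda>b. E b z) UNIV"
    by (rule infsum_reindex_bij_betw)
  then show ?thesis
    unfolding basis shift by (simp add: infsum_cmult_left')
qed

text \<open>At the origin every term is a positive real number, so nothing can cancel.\<close>

lemma theta_series_0_nonzero:
  assumes "posdef_by A \<delta>"
  shows "theta_series A p 0 \<noteq> 0"
proof -
  have eq: "theta_coeff A p b * exp (theta_lin A p b 0) = of_real (norm (theta_coeff A p b))" for b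
    unfolding norm_theta_coeff
    by (simp add: theta_coeff_def theta_lin_def cdot_def bilin_ivec_ivec bilin_simps exp_of_real[symmetric])
  have s: "summable (\<lambda>n. norm (theta_coeff A p (enum_int_fun n)))"
    using theta_series_summable[OF assms, of p 0] unfolding eq by simp
  have "theta_series A p 0 = of_real (\<Sum>n. norm (theta_coeff A p (enum_int_fun n)))"
    unfolding theta_series_def eq by (rule suminf_of_real[OF s, symmetric])
  moreover have "(\<Sum>n. norm (theta_coeff A p (enum_int_fun n))) > 0"
    by (intro suminf_pos s) (simp add: theta_coeff_def)
  ultimately show ?thesis by simp
qed

section \<open>Independent CR sections\<close>

lemma CR_form_complex_linear_eq_0:
  assumes "\<And>j. D (axis j \<i>, 0) = \<i> * D (axis j 1, 0)" "D (0, 1) = 0"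
  shows "CR_form lam z D j = 0"
  using assms by (simp add: CR_form_def)

lemma axis_i: "axis j \<i> = \<i> *s axis j (1::complex)"
  by (simp add: vec_eq_iff axis_def)

lemma smooth_bilin: "smooth (\<lambda>x::(complex ^ 'm::finite) \<times> real. bilin A (fst x) (fst x))"
  unfolding bilin_def
  by (intro smooth_sum smooth_cmult smooth_mult smooth_bounded_linear bounded_linear_fst_nth)

lemma is_CR_bilin: "is_CR lam (\<lambda>x. c * bilin A (fst x) (fst x))"
proof (rule is_CRI)
  fix x :: "(complex ^ 'a) \<times> real" and j
  note d = bounded_linear_imp_has_derivative[OF bounded_linear_fst_nth]
  have "((\<lambda>x. c * bilin A (fst x) (fst x)) has_derivative (\<lambda>v. c * (\<Sum>j\<in>UNIV. \<Sum>t\<in>UNIV. of_int (A j t) *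
      (fst x $ j * fst v $ t + fst v $ j * fst x $ t)))) (at x)"
    unfolding bilin_def by (intro has_derivative_mult_right has_derivative_sum has_derivative_mult d)
  then show "((\<lambda>x. c * bilin A (fst x) (fst x)) has_derivative
      (\<lambda>v. c * (bilin A (fst x) (fst v) + bilin A (fst v) (fst x)))) (at x)"
    by (simp add: bilin_def distrib_left sum.distrib)
  show "CR_form lam (fst x) (\<lambda>v. c * (bilin A (fst x) (fst v) + bilin A (fst v) (fst x))) j = 0"
    by (rule CR_form_complex_linear_eq_0) (simp_all add: axis_i bilin_simps algebra_simps)
qed

context
  fixes A :: "'m::finite \<Rightarrow> 'm \<Rightarrow> int" and \<delta> :: real
  assumes pos: "posdef_by A \<delta>"
begin

lemma norm_theta_lin_fst_le: "norm (theta_lin A p b (fst x)) \<le> theta_lin_bound A p b * norm (x :: (complex ^ 'm) \<times> real)"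
  proof -
  have "norm (fst x) \<le> norm x" using norm_fst_le[of "fst x" "snd x"] by simp
  then show ?thesis
    by (rule order_trans[OF norm_theta_lin_le mult_left_mono[OF _ theta_lin_bound_nonneg]])
qed

lemma bounded_linear_theta_lin_fst: "bounded_linear (\<lambda>x::(complex ^ 'm) \<times> real. theta_lin A p b (fst x))"
  by (rule bounded_linear_compose[OF bounded_linear_theta_lin bounded_linear_fst])

lemma smooth_theta_series: "smooth (\<lambda>x::(complex ^ 'm) \<times> real. theta_series A p (fst x))"
  unfolding theta_series_def
  by (rule exp_series_smooth[where K = "\<lambda>n. theta_lin_bound A p (enum_int_fun n)"])
    (rule bounded_linear_theta_lin_fst norm_theta_lin_fst_le theta_lin_bound_nonneg theta_summable[OF pos])+

lemma is_CR_theta_series: "is_CR lam (\<lambda>x::(complex ^ 'm) \<times> real. theta_series A p (fst x))"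
proof -
  note facts = norm_theta_lin_fst_le theta_lin_bound_nonneg theta_summable[OF pos]
  show ?thesis
    unfolding theta_series_def
  proof (rule is_CRI)
    fix x :: "(complex ^ 'm) \<times> real" and j
    show "((\<lambda>x. \<Sum>n. theta_coeff A p (enum_int_fun n) * exp (theta_lin A p (enum_int_fun n) (fst x))) has_derivative
        (\<lambda>v. \<Sum>n. theta_coeff A p (enum_int_fun n) * theta_lin A p (enum_int_fun n) (fst v) *
          exp (theta_lin A p (enum_int_fun n) (fst x)))) (at x)"
      by (rule exp_series_has_derivative[where K = "\<lambda>n. theta_lin_bound A p (enum_int_fun n)"])
        (rule bounded_linear_theta_lin_fst facts)+
    let ?D = "\<lambda>v::(complex ^ 'm) \<times> real. \<Sum>n. theta_coeff A p (enum_int_fun n) *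
      theta_lin A p (enum_int_fun n) (fst v) * exp (theta_lin A p (enum_int_fun n) (fst x))"
    have "summable (\<lambda>n. theta_coeff A p (enum_int_fun n) * theta_lin A p (enum_int_fun n) (fst v) *
          exp (theta_lin A p (enum_int_fun n) (fst x)))" for v :: "(complex ^ 'm) \<times> real"
      using exp_series_derivative_summable[where l = "\<lambda>n x. theta_lin A p (enum_int_fun n) (fst x)" and
          K = "\<lambda>n. theta_lin_bound A p (enum_int_fun n)" and v = v and x = x, OF facts] by simp
    note s = suminf_mult[OF this, where c = \<i>]
    show "CR_form lam (fst x) ?D j = 0"
    proof (rule CR_form_complex_linear_eq_0)
      show "?D (axis j \<i>, 0) = \<i> * ?D (axis j 1, 0)" for j
        unfolding s[symmetric] by (simp add: axis_i theta_lin_smult mult_ac)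
      show "?D (0, 1) = 0" by (simp add: theta_lin_def cdot_def bilin_simps)
    qed
  qed
qed

text \<open>Translation by \<open>(heis_period / 2) s\<close> multiplies every series by a constant if \<open>A s\<close> is a vector of the
  standard basis, and these constants separate the classes of \<open>p\<close> modulo \<open>2 A\<close>.\<close>

lemma theta_series_eigenfunction:
  assumes s: "\<And>t. (\<Sum>i\<in>UNIV. of_int (A t i) * s $ i) = (if t = j then 1 else 0 :: real)"
  shows "theta_series A p (z + of_real (heis_period / 2) *s (\<chi> i. of_real (s $ i)))
    = exp (\<i> * of_real pi * of_real (\<Sum>i\<in>UNIV. of_int (p i) * s $ i)) * theta_series A p z"
proof -
  define u :: "complex ^ 'm" where "u = (\<chi> i. of_real (s $ i))"
  define c where "c = \<i> * of_real pi * of_real (\<Sum>i\<in>UNIV. of_int (p i) * s $ i)"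
  have p: "cdot (ivec p) u = of_real (\<Sum>i\<in>UNIV. of_int (p i) * s $ i)"
    by (simp add: cdot_def u_def)
  have b: "bilin A (ivec b) u = of_int (b j)" for b
  proof -
    have "bilin A (ivec b) u = of_real (\<Sum>t\<in>UNIV. of_int (b t) * (\<Sum>i\<in>UNIV. of_int (A t i) * s $ i))"
      by (simp add: bilin_def u_def sum_distrib_left mult_ac)
    also have "(\<Sum>t\<in>UNIV. of_int (b t) * (\<Sum>i\<in>UNIV. of_int (A t i) * s $ i)) = of_int (b j)"
      unfolding s by (subst sum_only_one[of j]) auto
    also have "of_real (of_int (b j)) = (of_int (b j) :: complex)" by simp
    finally show ?thesis .
  qed
  have eq: "theta_lin A p b (of_real (heis_period / 2) *s u)
      = \<i> * (of_real heis_period * of_real heis_period) * (cdot (ivec p) u + 2 * bilin A (ivec b) u) / 2" for b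
    by (simp add: theta_lin_def cdot_simps bilin_simps field_simps)
  \<comment> \<open>Half a period makes the part depending on \<open>b\<close> a multiple of 2 pi i,
    so all terms of the series get the same factor exp c.\<close>
  have "theta_lin A p b (of_real (heis_period / 2) *s u) = c + 2 * of_int (b j) * of_real pi * \<i>" for b
    unfolding eq heis_period_sq b p c_def by (simp add: algebra_simps)
  then have shift: "exp (theta_lin A p b (z + of_real (heis_period / 2) *s u)) = exp c * exp (theta_lin A p b z)" for b
    using exp_plus_of_int_2pi_i[of "theta_lin A p b z + c" "b j"]
    by (simp add: linear_add[OF bounded_linear.linear[OF bounded_linear_theta_lin]] exp_add mult_ac)
  have "theta_series A p (z + of_real (heis_period / 2) *s u) = exp c * theta_series A p z"
    unfolding theta_series_def shift
    by (subst suminf_mult[symmetric])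
      (auto intro: summable_norm_cancel[OF theta_series_summable[OF pos]] simp: mult_ac)
  then show ?thesis by (simp only: u_def c_def)
qed

text \<open>The \<open>s j\<close> are the columns of the inverse of \<open>A\<close>, which exists
  since positivity excludes a kernel. The first identity feeds
  \<open>theta_series_eigenfunction\<close>; the second recovers a frequency from its eigenvalue
  exponents.\<close>

lemma posdef_inverse_columns:
  obtains s :: "'m \<Rightarrow> real ^ 'm" where
    "\<And>t j. (\<Sum>i\<in>UNIV. of_int (A t i) * s j $ i) = (if t = j then 1 else 0)"
    "\<And>i j. (\<Sum>t\<in>UNIV. s t $ i * of_int (A t j)) = (if i = j then 1 else 0)"
proof -
  define M :: "real ^ 'm ^ 'm" where "M = (\<chi> t i. of_int (A t i))"
  have "v = 0" if v: "M *v v = 0" for v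
  proof -
    have "quad_form A (($) v) = (\<Sum>j\<in>UNIV. v $ j * (M *v v) $ j)"
      by (simp add: quad_form_def M_def matrix_vector_mult_def sum_distrib_left mult_ac)
    then have "quad_form A (($) v) = 0" by (simp add: v)
    moreover have "\<delta> * (\<Sum>j\<in>UNIV. (v $ j)\<^sup>2) \<le> quad_form A (($) v)" "\<delta> > 0"
      using pos by (auto simp: posdef_by_def)
    ultimately have "\<delta> * (\<Sum>j\<in>UNIV. (v $ j)\<^sup>2) \<le> 0" "\<delta> > 0" by auto
    then have "(\<Sum>j\<in>UNIV. (v $ j)\<^sup>2) \<le> 0" by (simp add: mult_le_0_iff)
    then have "(\<Sum>j\<in>UNIV. (v $ j)\<^sup>2) = 0" by (intro antisym sum_nonneg) auto
    then show "v = 0" by (simp add: sum_nonneg_eq_0_iff vec_eq_iff)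
  qed
  then obtain B where B: "B ** M = mat 1" using matrix_left_invertible_ker by blast
  then have B': "M ** B = mat 1" by (simp add: matrix_left_right_inverse)
  show ?thesis
  proof (rule that[of "\<lambda>j. \<chi> i. B $ i $ j"])
    show "(\<Sum>i\<in>UNIV. of_int (A t i) * (\<chi> i. B $ i $ j) $ i) = (if t = j then 1 else 0)" for t j
      using arg_cong[OF B', of "\<lambda>X. X $ t $ j"] by (simp add: matrix_matrix_mult_def M_def mat_def)
    show "(\<Sum>t\<in>UNIV. (\<chi> i. B $ i $ t) $ i * of_int (A t j)) = (if i = j then 1 else 0)" for i j
      using arg_cong[OF B, of "\<lambda>X. X $ i $ j"] by (simp add: matrix_matrix_mult_def M_def mat_def)
  qed
qed

end

section \<open>Independence of frequency classes and of characters\<close>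

definition int_box :: "int \<Rightarrow> ('m::finite \<Rightarrow> int) set" where
  "int_box L = {p. \<forall>j. p j \<in> {0..L}}"

lemma finite_int_box: "finite (int_box L :: ('m::finite \<Rightarrow> int) set)"
  and card_int_box: "card (int_box L :: ('m::finite \<Rightarrow> int) set) = nat (L + 1) ^ CARD('m)"
proof -
  have "int_box L = (PiE UNIV (\<lambda>_. {0..L}) :: ('m \<Rightarrow> int) set)"
    by (auto simp: int_box_def PiE_UNIV_domain)
  then show "finite (int_box L :: ('m \<Rightarrow> int) set)"
    and "card (int_box L :: ('m \<Rightarrow> int) set) = nat (L + 1) ^ CARD('m)"
    by (simp_all add: card_PiE finite_PiE)
qed

text \<open>Pairing p - p' = 2 b A with \<open>b\<close> bounds 2 \<delta> times the sum of the
  squares of the b_j by L times the sum of the |b_j|. An integer is at most its square in absolute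
  value, so L < 2 \<delta> leaves only b = 0: the box meets each class modulo 2 A at most
  once.\<close>

lemma int_box_incongruent:
  assumes pos: "posdef_by A \<delta>" and L: "of_int L < 2 * \<delta>"
    and p: "p \<in> int_box L" "p' \<in> int_box L"
    and b: "\<And>i. p i - p' i = 2 * (\<Sum>j\<in>UNIV. b j * A j i)"
  shows "p = p'"
proof -
  define b1 where "b1 = (\<Sum>j\<in>UNIV. \<bar>real_of_int (b j)\<bar>)"
  have diff: "\<bar>p i - p' i\<bar> \<le> L" for i
  proof -
    have "p i \<in> {0..L}" "p' i \<in> {0..L}" using p by (auto simp: int_box_def)
    then show ?thesis by auto
  qed
  have sq: "\<bar>real_of_int n\<bar> \<le> (of_int n)\<^sup>2" for n :: int
  proof (cases "n = 0")
    case False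
    then have "1 \<le> \<bar>real_of_int n\<bar>" by linarith
    then have "1 * \<bar>real_of_int n\<bar> \<le> \<bar>real_of_int n\<bar> * \<bar>real_of_int n\<bar>" by (intro mult_right_mono) auto
    then show ?thesis by (simp add: power2_eq_square)
  qed simp
  have "2 * \<delta> * b1 \<le> 2 * (\<delta> * (\<Sum>j\<in>UNIV. (of_int (b j))\<^sup>2))"
    using pos unfolding b1_def posdef_by_def by (simp add: sum_mono sq)
  also have "\<dots> \<le> 2 * quad_form A (\<lambda>j. of_int (b j))"
    using pos unfolding posdef_by_def by simp
  also have "2 * quad_form A (\<lambda>j. of_int (b j)) = (\<Sum>i\<in>UNIV. of_int (b i) * of_int (p i - p' i))"
    unfolding quad_form_def b by (subst sum.swap) (simp add: sum_distrib_left mult_ac)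
  also have "\<dots> \<le> (\<Sum>i\<in>UNIV. \<bar>of_int (b i)\<bar> * of_int L)"
  proof (rule sum_mono)
    fix i
    have "of_int (b i) * of_int (p i - p' i) \<le> \<bar>of_int (b i)\<bar> * \<bar>real_of_int (p i - p' i)\<bar>"
      by (metis abs_ge_self abs_mult)
    also have "\<dots> \<le> \<bar>of_int (b i)\<bar> * of_int L"
      using diff[of i] by (intro mult_left_mono) linarith+
    finally show "of_int (b i) * of_int (p i - p' i) \<le> \<bar>of_int (b i)\<bar> * real_of_int L" .
  qed
  also have "\<dots> = of_int L * b1" by (simp add: b1_def sum_distrib_left mult.commute)
  finally have "(2 * \<delta> - of_int L) * b1 \<le> 0" by (simp add: algebra_simps)
  then have "b1 \<le> 0" using L by (simp add: mult_le_0_iff)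
  then have "b1 = 0" unfolding b1_def by (intro antisym sum_nonneg) auto
  then have "b j = 0" for j unfolding b1_def by (simp add: sum_nonneg_eq_0_iff)
  then show ?thesis using b by (auto simp: fun_eq_iff)
qed

text \<open>Subtracting \<open>ev s l\<close> times a relation from its translate under
  \<open>T s\<close> removes the term \<open>l\<close>, and the induction hypothesis applies to the
  rest. It suffices that each pair of indices is separated by some \<open>s\<close>.\<close>

lemma eigenfunctions_independent:
  fixes h :: "'i \<Rightarrow> 'x \<Rightarrow> complex"
  assumes "finite I" "\<And>i. i \<in> I \<Longrightarrow> \<exists>x. h i x \<noteq> 0"
    and "\<And>s i x. i \<in> I \<Longrightarrow> h i (T s x) = ev s i * h i x"
    and "\<And>i l. i \<in> I \<Longrightarrow> l \<in> I \<Longrightarrow> i \<noteq> l \<Longrightarrow> \<exists>s. ev s i \<noteq> ev s l"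
    and "\<And>x. (\<Sum>i\<in>I. c i * h i x) = 0" and "i \<in> I"
  shows "c i = 0"
  using assms
proof (induction I arbitrary: c i rule: finite_induct)
  case (insert l I)
  have cI: "c i = 0" if i: "i \<in> I" for i
  proof -
    have "i \<noteq> l" using insert.hyps i by auto
    then obtain s where s: "ev s i \<noteq> ev s l" using insert.prems(3)[of i l] i by auto
    have "c i * (ev s i - ev s l) = 0"
    proof (rule insert.IH[where c = "\<lambda>i. c i * (ev s i - ev s l)"])
      fix x
      have "(\<Sum>i\<in>insert l I. c i * (ev s i - ev s l) * h i x)
          = (\<Sum>i\<in>insert l I. c i * h i (T s x)) - ev s l * (\<Sum>i\<in>insert l I. c i * h i x)"
        unfolding sum_distrib_left sum_subtractf[symmetric]
        by (intro sum.cong refl) (simp add: insert.prems(2) algebra_simps)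
      also have "\<dots> = 0" by (simp only: insert.prems(4)) simp
      finally show "(\<Sum>i\<in>I. c i * (ev s i - ev s l) * h i x) = 0"
        using insert.hyps by simp
    qed (use insert.prems i in auto)
    then show ?thesis using s by simp
  qed
  have "c l = 0"
  proof -
    obtain x where "h l x \<noteq> 0" using insert.prems(1) by blast
    moreover have "c l * h l x = 0"
      using insert.prems(4)[of x] insert.hyps cI by simp
    ultimately show ?thesis by simp
  qed
  with cI insert.prems(5) show ?case by auto
qed simp

lemma exp_functions_independent:
  assumes "finite I" "\<And>\<theta>::real. (\<Sum>m\<in>I. d m * exp (2 * \<i> * of_int m * of_real \<theta>)) = 0" "m \<in> I"
  shows "d m = 0"
proof (rule eigenfunctions_independent[where h = "\<lambda>m \<theta>. exp (2 * \<i> * of_int m * of_real \<theta>)" and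
      T = "\<lambda>s \<theta>. \<theta> + s" and ev = "\<lambda>s m. exp (2 * \<i> * of_int m * of_real s)" and I = I])
  show "exp (2 * \<i> * of_int m * of_real (\<theta> + s)) = exp (2 * \<i> * of_int m * of_real s) * exp (2 * \<i> * of_int m * of_real \<theta>)"
    for m :: int and \<theta> s :: real
    by (simp add: exp_add[symmetric] algebra_simps)
  fix m l :: int assume "m \<noteq> l"
  \<comment> \<open>A rotation under which the eigenvalues of the two characters differ by the
    factor exp (i pi) = - 1.\<close>
  define s where "s = pi / (2 * of_int (m - l))"
  have "2 * \<i> * of_int m * of_real s = 2 * \<i> * of_int l * of_real s + \<i> * of_real pi"
    using \<open>m \<noteq> l\<close> by (simp add: s_def field_simps)
  then have "exp (2 * \<i> * of_int m * of_real s) = - exp (2 * \<i> * of_int l * of_real s)"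
    by (simp add: exp_add)
  then have "exp (2 * \<i> * of_int m * of_real s) \<noteq> exp (2 * \<i> * of_int l * of_real s)"
    by simp
  then show "\<exists>s::real. exp (2 * \<i> * of_int m * of_real s) \<noteq> exp (2 * \<i> * of_int l * of_real s)" by blast
qed (use assms in auto)

lemma theta_series_independent:
  assumes sym: "\<And>j t. A j t = A t j" and pos: "posdef_by A \<delta>" and L: "of_int L < 2 * \<delta>"
    and 0: "\<And>z. (\<Sum>p\<in>int_box L. c p * theta_series A p z) = 0" and p: "p \<in> int_box L"
  shows "c p = 0"
proof -
  obtain s :: "'a \<Rightarrow> real ^ 'a" where
    s: "\<And>t j. (\<Sum>i\<in>UNIV. of_int (A t i) * s j $ i) = (if t = j then 1 else 0)"
      "\<And>i j. (\<Sum>t\<in>UNIV. s t $ i * of_int (A t j)) = (if i = j then 1 else 0)"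
    using posdef_inverse_columns[OF pos] by blast
  \<comment> \<open>The vector with entries \<open>r j p\<close> is the inverse of \<open>A\<close>
    applied to \<open>p\<close>. Equal eigenvalues mean that those of p and p' differ by 2 b, and
    applying \<open>A\<close> yields p - p' = 2 b A.\<close>
  define r where "r j p = (\<Sum>i\<in>UNIV. of_int (p i) * s j $ i)" for j and p :: "'a \<Rightarrow> int"
  show ?thesis
  proof (rule eigenfunctions_independent[where h = "theta_series A" and
      T = "\<lambda>j z. z + of_real (heis_period / 2) *s (\<chi> i. of_real (s j $ i))"
      and ev = "\<lambda>j p. exp (\<i> * of_real pi * of_real (r j p))", OF finite_int_box _ _ _ 0 p])
    show "\<exists>z. theta_series A p z \<noteq> 0" for p using theta_series_0_nonzero[OF pos] by blast
    show "theta_series A p (z + of_real (heis_period / 2) *s (\<chi> i. of_real (s j $ i)))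
        = exp (\<i> * of_real pi * of_real (r j p)) * theta_series A p z" for j p z
      unfolding r_def by (rule theta_series_eigenfunction[OF pos s(1)])
    fix p p' :: "'a \<Rightarrow> int" assume pp': "p \<in> int_box L" "p' \<in> int_box L" "p \<noteq> p'"
    show "\<exists>j. exp (\<i> * of_real pi * of_real (r j p)) \<noteq> exp (\<i> * of_real pi * of_real (r j p'))"
    proof (rule ccontr)
      assume "\<not> ?thesis"
      then have "\<exists>n::int. \<i> * of_real pi * of_real (r j p) = \<i> * of_real pi * of_real (r j p') + of_int (2 * n) * of_real pi * \<i>" for j
        by (auto simp: exp_eq)
      then obtain b where "\<And>j. \<i> * of_real pi * of_real (r j p) = \<i> * of_real pi * of_real (r j p') + of_int (2 * b j) * of_real pi * \<i>"
        by metis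
      then have "\<i> * of_real pi * of_real (r j p) = \<i> * of_real pi * (of_real (r j p' + 2 * of_int (b j)))" for j
        by (simp add: algebra_simps)
      then have b: "r j p = r j p' + 2 * of_int (b j)" for j
        by (simp only: mult_cancel_left of_real_eq_iff) simp
      have rA: "(\<Sum>j\<in>UNIV. r j q * of_int (A j i)) = of_int (q i)" for q i
      proof -
        have "(\<Sum>j\<in>UNIV. r j q * of_int (A j i)) = (\<Sum>t\<in>UNIV. of_int (q t) * (\<Sum>j\<in>UNIV. s j $ t * of_int (A j i)))"
          unfolding r_def sum_distrib_left sum_distrib_right by (subst sum.swap) (simp add: mult_ac)
        also have "\<dots> = of_int (q i)"
          unfolding s(2) by (subst sum_only_one[of i]) auto
        finally show ?thesis .
      qed
      have "real_of_int (p i - p' i) = of_int (2 * (\<Sum>j\<in>UNIV. b j * A j i))" for i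
        using rA[of p i] rA[of p' i]
        by (simp add: b distrib_right sum.distrib sum_distrib_left mult.assoc)
      then have "p i - p' i = 2 * (\<Sum>j\<in>UNIV. b j * A j i)" for i by (simp only: of_int_eq_iff)
      then have "p = p'" by (rule int_box_incongruent[OF pos L pp'(1,2)])
      with pp'(3) show False by contradiction
    qed
  qed
qed

section \<open>The theta sections and their independence\<close>

definition theta_section ::
    "('m::finite \<Rightarrow> int) \<Rightarrow> ('m \<Rightarrow> 'm \<Rightarrow> int) \<Rightarrow> nat \<Rightarrow> int \<times> ('m \<Rightarrow> int) \<Rightarrow> (complex ^ 'm) \<times> real \<Rightarrow> complex" where
  "theta_section lam mu k q x =
     exp (- mode_coeff k (fst q) * heis_w lam x) * theta_basis (mode_matrix lam mu k (fst q)) (snd q) (fst x)"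

lemma theta_section_in_CR_sections:
  assumes sym: "\<And>j t. mu j t = mu t j" and pos: "posdef_by (mode_matrix lam mu k m) \<delta>"
  shows "theta_section lam mu k (m, p) \<in> CR_sections lam mu k"
  unfolding CR_sections_iff[of mu, OF sym]
proof (intro conjI allI impI)
  let ?A = "mode_matrix lam mu k m"
  have eq: "theta_section lam mu k (m, p) = (\<lambda>x. exp (- mode_coeff k m * heis_w lam x) *
      (exp ((1 / 2) * bilin ?A (fst x) (fst x)) * theta_series ?A p (fst x)))"
    by (simp add: theta_section_def theta_basis_def fun_eq_iff)
  note sm = smooth_exp[OF smooth_cmult[OF smooth_heis_w]] smooth_exp[OF smooth_cmult[OF smooth_bilin]]
    smooth_theta_series[OF pos]
  show "smooth (theta_section lam mu k (m, p))"
    unfolding eq by (intro smooth_mult sm)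
  show "is_CR lam (theta_section lam mu k (m, p))"
    unfolding eq
    by (intro is_CR_mult smooth_mult sm is_CR_theta_series[OF pos] is_CR_exp is_CR_heis_w is_CR_bilin
        smooth_cmult smooth_heis_w smooth_bilin)
  fix x x' assume xx': "(x, x') \<in> heis_rel lam"
  have "theta_section lam mu k (m, p) x' = exp (- mode_coeff k m * heis_w lam x') *
      (theta_basis ?A p (fst x) * exp (theta_exponent ?A (fst x) (fst x' - fst x)))"
    using theta_basis_translate[of ?A \<delta> "fst x' - fst x" p "fst x", OF mode_matrix_commute[of mu, OF sym] pos] xx'
    by (simp add: theta_section_def heis_rel_iff)
  also have "exp (theta_exponent ?A (fst x) (fst x' - fst x))
      = sasaki_factor lam mu x x' ^ k * exp (mode_coeff k m * (heis_w lam x' - heis_w lam x))"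
    by (rule sasaki_factor_mode[OF xx', symmetric])
  also have "exp (- mode_coeff k m * heis_w lam x') *
      (theta_basis ?A p (fst x) * (sasaki_factor lam mu x x' ^ k * exp (mode_coeff k m * (heis_w lam x' - heis_w lam x))))
    = (exp (- mode_coeff k m * heis_w lam x') * exp (mode_coeff k m * (heis_w lam x' - heis_w lam x)))
      * theta_basis ?A p (fst x) * sasaki_factor lam mu x x' ^ k" by (simp add: mult_ac)
  also have "exp (- mode_coeff k m * heis_w lam x') * exp (mode_coeff k m * (heis_w lam x' - heis_w lam x))
      = exp (- mode_coeff k m * heis_w lam x)"
    by (simp add: exp_add[symmetric] algebra_simps)
  finally show "theta_section lam mu k (m, p) x' = theta_section lam mu k (m, p) x * sasaki_factor lam mu x x' ^ k"
    by (simp add: theta_section_def)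
qed

text \<open>For fixed \<open>z\<close> a section of mode m depends on \<theta> only through exp (- k
  \<theta>) exp (2 i m \<theta>). Independence of the characters isolates one mode, inside which the
  theta series are independent.\<close>

lemma theta_sections_independent:
  assumes sym: "\<And>j t. mu j t = mu t j" and fin: "finite I"
    and pos: "\<And>m. m \<in> I \<Longrightarrow> posdef_by (mode_matrix lam mu k m) \<delta>" and L: "of_int L < 2 * \<delta>"
    and 0: "\<And>x. (\<Sum>q\<in>I \<times> int_box L. c q * theta_section lam mu k q x) = 0"
    and q: "q \<in> I \<times> int_box L"
  shows "c q = 0"
proof -
  obtain m p where mp: "q = (m, p)" "m \<in> I" "p \<in> int_box L" using q by auto
  let ?A = "mode_matrix lam mu k"
  have "(\<Sum>p\<in>int_box L. c (m, p) * theta_series (?A m) p z) = 0" for z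
  proof -
    define w where "w = heis_w lam (z, 0)"
    define d where "d m = exp (- mode_coeff k m * w) * (\<Sum>p\<in>int_box L. c (m, p) * theta_basis (?A m) p z)" for m
    have "d m = 0"
    proof (rule exp_functions_independent[OF fin _ mp(2)])
      fix \<theta> :: real
      have "theta_section lam mu k (m, p) (z, \<theta>) = exp (- of_nat k * of_real \<theta>) *
          (exp (- mode_coeff k m * w) * theta_basis (?A m) p z * exp (2 * \<i> * of_int m * of_real \<theta>))" for m p
      proof -
        have "heis_w lam (z, \<theta>) = of_real \<theta> + w" by (simp add: heis_w_def w_def)
        then have "- mode_coeff k m * heis_w lam (z, \<theta>)
            = - of_nat k * of_real \<theta> + (- mode_coeff k m * w + 2 * \<i> * of_int m * of_real \<theta>)"
          by (simp add: mode_coeff_def algebra_simps)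
        then show ?thesis by (simp only: theta_section_def fst_conv snd_conv exp_add) (simp add: mult_ac)
      qed
      then have "exp (- of_nat k * of_real \<theta>) * (\<Sum>m\<in>I. d m * exp (2 * \<i> * of_int m * of_real \<theta>)) =
          (\<Sum>q\<in>I \<times> int_box L. c q * theta_section lam mu k q (z, \<theta>))"
        unfolding sum.cartesian_product[symmetric, where g = "\<lambda>m p. c (m, p) * theta_section lam mu k (m, p) (z, \<theta>)", simplified]
        by (simp add: d_def sum_distrib_left sum_distrib_right mult_ac)
      then show "(\<Sum>m\<in>I. d m * exp (2 * \<i> * of_int m * of_real \<theta>)) = 0"
        by (simp add: 0)
    qed
    then have "(\<Sum>p\<in>int_box L. c (m, p) * theta_basis (?A m) p z) = 0" by (simp add: d_def)
    then have "exp (bilin (?A m) z z / 2) * (\<Sum>p\<in>int_box L. c (m, p) * theta_series (?A m) p z) = 0"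
      by (simp add: theta_basis_def sum_distrib_left mult_ac)
    then show ?thesis by simp
  qed
  then show ?thesis
    unfolding mp(1)
    using theta_series_independent[of "?A m" \<delta> L "\<lambda>p. c (m, p)" p, OF mode_matrix_commute[of mu, OF sym] pos[OF mp(2)] L]
      mp(3) by blast
qed

lemma sum_fun_apply: "(\<Sum>i\<in>I. F i) x = (\<Sum>i\<in>I. F i x)" for F :: "'i \<Rightarrow> 'x \<Rightarrow> 'a::comm_monoid_add"
  by (induction I rule: infinite_finite_induct) auto

text \<open>A coincidence \<open>f i = f l\<close> would be a relation with coefficients 1 and - 1,
  so injectivity follows from the same hypothesis. It is needed to count the sections by their
  indices.\<close>

lemma cfun_independent_family:
  assumes fin: "finite I" and ind: "\<And>c i. (\<And>x. (\<Sum>i\<in>I. c i * f i x) = 0) \<Longrightarrow> i \<in> I \<Longrightarrow> c i = 0"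
  shows "inj_on f I" "cfun.independent (f ` I)"
proof -
  show inj: "inj_on f I"
  proof (rule inj_onI, rule ccontr)
    fix i l assume il: "i \<in> I" "l \<in> I" "f i = f l" "i \<noteq> l"
    define c where "c j = (if j = i then 1 else if j = l then - 1 else 0 :: complex)" for j
    have "(\<Sum>j\<in>I. c j * f j x) = (\<Sum>j\<in>{i, l}. c j * f j x)" for x
      using fin il by (intro sum.mono_neutral_right) (auto simp: c_def)
    also have "(\<Sum>j\<in>{i, l}. c j * f j x) = 0" for x using il by (simp add: c_def)
    finally have "c i = 0" using ind il(1) by blast
    then show False by (simp add: c_def)
  qed
  show "cfun.independent (f ` I)"
  proof
    assume "cfun.dependent (f ` I)"
    then obtain u where u: "\<exists>v\<in>f ` I. u v \<noteq> 0" "(\<Sum>v\<in>f ` I. scale_fun (u v) v) = 0"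
      using cfun.dependent_finite[of "f ` I"] fin by auto
    have "(\<Sum>i\<in>I. u (f i) * f i x) = 0" for x
    proof -
      have "(\<Sum>i\<in>I. u (f i) * f i x) = (\<Sum>i\<in>I. scale_fun (u (f i)) (f i)) x"
        by (simp add: sum_fun_apply scale_fun_def)
      also have "(\<Sum>i\<in>I. scale_fun (u (f i)) (f i)) = 0"
        using u(2) by (simp add: sum.reindex[OF inj])
      finally show ?thesis by simp
    qed
    then show False using ind[of "\<lambda>i. u (f i)"] u(1) by blast
  qed
qed


text \<open>The constant is the minimum of the form on the compact unit sphere; homogeneity does the
  rest.\<close>

lemma positive_definite_lower_bound:
  fixes mu :: "'m::finite \<Rightarrow> 'm \<Rightarrow> int"
  assumes "positive_definite (\<chi> j t. real_of_int (mu j t))"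
  obtains \<delta> where "posdef_by mu \<delta>"
proof -
  define M :: "real ^ 'm ^ 'm" where "M = (\<chi> j t. real_of_int (mu j t))"
  have quad: "quad_form mu (($) v) = v \<bullet> (M *v v)" for v
    by (simp add: quad_form_def M_def inner_vec_def matrix_vector_mult_def sum_distrib_left mult_ac)
  have "continuous_on (sphere 0 1) (\<lambda>v. v \<bullet> (M *v v))"
    by (intro continuous_intros linear_continuous_on matrix_vector_mul_bounded_linear)
  moreover have "sphere 0 1 \<noteq> ({} :: (real ^ 'm) set)"
  proof -
    obtain b :: "real ^ 'm" where "b \<in> Basis" using nonempty_Basis by blast
    then have "b \<in> sphere 0 1" by simp
    then show ?thesis by blast
  qed
  ultimately obtain v0 where v0: "v0 \<in> sphere 0 1" "\<And>v. v \<in> sphere 0 1 \<Longrightarrow> v0 \<bullet> (M *v v0) \<le> v \<bullet> (M *v v)"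
    using continuous_attains_inf[OF compact_sphere] by blast
  define \<delta> where "\<delta> = v0 \<bullet> (M *v v0)"
  have "v0 \<noteq> 0" using v0(1) by auto
  then have \<delta>: "\<delta> > 0" using assms by (simp add: positive_definite_def \<delta>_def M_def)
  have "\<delta> * (norm v)\<^sup>2 \<le> v \<bullet> (M *v v)" for v
  proof (cases "v = 0")
    case False
    define u where "u = v /\<^sub>R norm v"
    have "u \<in> sphere 0 1" using False by (simp add: u_def)
    then have "\<delta> \<le> u \<bullet> (M *v u)" unfolding \<delta>_def by (rule v0(2))
    moreover have "v = norm v *\<^sub>R u" using False by (simp add: u_def)
    then have "v \<bullet> (M *v v) = (norm v *\<^sub>R u) \<bullet> (M *v (norm v *\<^sub>R u))" by simp
    then have "v \<bullet> (M *v v) = (u \<bullet> (M *v u)) * (norm v)\<^sup>2"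
      by (simp add: matrix_vector_mult_scaleR power2_eq_square)
    ultimately show ?thesis by (simp add: mult_right_mono)
  qed simp
  moreover have "(norm v)\<^sup>2 = (\<Sum>j\<in>UNIV. (v $ j)\<^sup>2)" for v :: "real ^ 'm"
    by (simp add: norm_vec_def L2_set_def sum_nonneg)
  ultimately have "\<delta> * (\<Sum>j\<in>UNIV. (v $ j)\<^sup>2) \<le> quad_form mu (($) v)" for v
    unfolding quad by metis
  from this[of "\<chi> j. w j" for w] have "posdef_by mu \<delta>"
    using \<delta> by (simp add: posdef_by_def quad_form_def)
  then show ?thesis by (rule that)
qed

text \<open>The diagonal part lowers the form by at most 4 m times the sum of the |\<lambda>_j|
  times the squared norm. The bound on \<open>m\<close> lets it consume half of the lower bound k
  \<delta>.\<close>

lemma posdef_by_mode_matrix: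
  assumes mu: "posdef_by mu \<delta>" and k: "k > 0" and m: "0 \<le> m"
    and le: "4 * of_int m * (\<Sum>j\<in>UNIV. \<bar>of_int (lam j)\<bar>) \<le> \<delta> / 2 * of_nat k"
  shows "posdef_by (mode_matrix lam mu k m) (\<delta> / 2 * of_nat k)"
  unfolding posdef_by_def
proof (intro conjI allI)
  show "0 < \<delta> / 2 * of_nat k" using mu k by (simp add: posdef_by_def)
  fix v :: "'a \<Rightarrow> real"
  define V where "V = (\<Sum>j\<in>UNIV. (v j)\<^sup>2)"
  define \<Lambda> where "\<Lambda> = (\<Sum>j\<in>UNIV. \<bar>real_of_int (lam j)\<bar>)"
  have V: "V \<ge> 0" by (simp add: V_def sum_nonneg)
  have "(\<Sum>t\<in>UNIV. (if j = t then of_int (4 * m * lam j) else 0) * v j * v t) = 4 * of_int m * (of_int (lam j) * (v j)\<^sup>2)" for j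
    by (subst sum_only_one[of j]) (auto simp: power2_eq_square)
  moreover have "of_int (mode_matrix lam mu k m j t) * v j * v t
      = of_nat k * (of_int (mu j t) * v j * v t) + (if j = t then of_int (4 * m * lam j) else 0) * v j * v t" for j t
    by (simp add: mode_matrix_def algebra_simps)
  ultimately have quad: "quad_form (mode_matrix lam mu k m) v
      = of_nat k * quad_form mu v + 4 * of_int m * (\<Sum>j\<in>UNIV. of_int (lam j) * (v j)\<^sup>2)"
    unfolding quad_form_def by (simp only: sum.distrib sum_distrib_left[symmetric])
  have "- (\<Sum>j\<in>UNIV. of_int (lam j) * (v j)\<^sup>2) \<le> \<Lambda> * V"
    unfolding sum_negf[symmetric] \<Lambda>_def sum_distrib_right
  proof (rule sum_mono)
    fix j
    have "- (of_int (lam j) * (v j)\<^sup>2) \<le> \<bar>of_int (lam j)\<bar> * (v j)\<^sup>2"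
      by (simp only: mult_minus_left[symmetric]) (intro mult_right_mono, auto)
    also have "\<dots> \<le> \<bar>of_int (lam j)\<bar> * V"
      unfolding V_def by (intro mult_left_mono member_le_sum) auto
    finally show "- (of_int (lam j) * (v j)\<^sup>2) \<le> \<bar>of_int (lam j)\<bar> * V" .
  qed
  from mult_left_mono[OF this, of "4 * of_int m"] m
  have "- (4 * of_int m * (\<Sum>j\<in>UNIV. of_int (lam j) * (v j)\<^sup>2)) \<le> (4 * of_int m * \<Lambda>) * V"
    by (simp only: mult_minus_right mult.assoc)
  also have "\<dots> \<le> (\<delta> / 2 * of_nat k) * V" using le V unfolding \<Lambda>_def by (rule mult_right_mono)
  finally have "- (4 * of_int m * (\<Sum>j\<in>UNIV. of_int (lam j) * (v j)\<^sup>2)) \<le> (\<delta> / 2 * of_nat k) * V" .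
  moreover have "of_nat k * (\<delta> * V) \<le> of_nat k * quad_form mu v"
    using mu unfolding posdef_by_def V_def by (intro mult_left_mono) auto
  ultimately show "\<delta> / 2 * of_nat k * (\<Sum>j\<in>UNIV. (v j)\<^sup>2) \<le> quad_form (mode_matrix lam mu k m) v"
    unfolding quad V_def[symmetric] by (simp add: algebra_simps)
qed

section \<open>Signs of the Levi eigenvalues under condition Y(0)\<close>

lemma eigenspace_levi_matrix:
  "v \<in> eigenspace (levi_matrix lam p) x \<longleftrightarrow> (\<forall>j. of_int (lam j) * v $ j = of_real x * v $ j)"
proof -
  have "(levi_matrix lam p *v v) $ j = of_int (lam j) * v $ j" for j
    by (simp add: levi_matrix_def matrix_vector_mult_def sum_only_one[of j])
  then show ?thesis by (simp add: eigenspace_def vec_eq_iff)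
qed

text \<open>The eigenspace at \<open>x\<close> lies in the span of the coordinate vectors with lam j
  = x, and these index sets are disjoint for different \<open>x\<close>.\<close>

lemma eigenvalue_count_levi_matrix_le:
  "eigenvalue_count (levi_matrix lam p) X \<le> CARD('m)" for lam :: "'m::finite \<Rightarrow> int"
proof -
  let ?E = "eigenspace (levi_matrix lam p)"
  define S where "S = {x. x \<in> X \<and> ?E x \<noteq> {0}}"
  define J where "J x = {j. real_of_int (lam j) = x}" for x
  have dim: "vec.dim (?E x) \<le> card (J x)" for x
  proof -
    define W where "W = (\<lambda>j. axis j 1 :: complex ^ 'm) ` J x"
    have "?E x \<subseteq> vec.span W"
    proof
      fix v assume v: "v \<in> ?E x"
      have 0: "v $ j = 0" if "j \<notin> J x" for j
      proof -
        have "of_int (lam j) * v $ j = of_real x * v $ j" using v by (simp add: eigenspace_levi_matrix)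
        then have "of_real (of_int (lam j)) = complex_of_real x \<or> v $ j = 0" by auto
        then show ?thesis using that by (simp only: of_real_eq_iff J_def) simp
      qed
      have "v = (\<Sum>j\<in>J x. v $ j *s axis j 1)"
      proof (subst vec_eq_iff, rule allI)
        fix i
        have "(\<Sum>j\<in>J x. v $ j * axis j 1 $ i) = (\<Sum>j\<in>UNIV. v $ j * axis j 1 $ i)"
          by (rule sum.mono_neutral_left) (auto simp: 0)
        also have "\<dots> = v $ i" by (subst sum_only_one[of i]) (auto simp: axis_def)
        finally show "v $ i = (\<Sum>j\<in>J x. v $ j *s axis j 1) $ i" by simp
      qed
      also have "\<dots> \<in> vec.span W"
        by (intro vec.span_sum vec.span_scale vec.span_base) (auto simp: W_def)
      finally show "v \<in> vec.span W" .
    qed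
    then have "vec.dim (?E x) \<le> card W" by (intro vec.dim_le_card) (simp_all add: W_def)
    also have "\<dots> \<le> card (J x)" unfolding W_def by (rule card_image_le) simp
    finally show ?thesis .
  qed
  show ?thesis
  proof (cases "finite S")
    case True
    have "eigenvalue_count (levi_matrix lam p) X \<le> (\<Sum>x\<in>S. card (J x))"
      unfolding eigenvalue_count_def S_def by (intro sum_mono dim)
    also have "\<dots> = card (\<Union>x\<in>S. J x)"
      using True by (intro card_UN_disjoint[symmetric]) (auto simp: J_def)
    also have "\<dots> \<le> CARD('m)" by (rule card_mono) auto
    finally show ?thesis .
  \<comment> \<open>A sum over an infinite index set is 0 by convention.\<close>
  qed (simp add: eigenvalue_count_def S_def)
qed

lemma eigenvalue_count_levi_matrix_pos:
  assumes "eigenvalue_count (levi_matrix lam p) X > 0"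
  shows "\<exists>j. real_of_int (lam j) \<in> X"
proof -
  have "{x. x \<in> X \<and> eigenspace (levi_matrix lam p) x \<noteq> {0}} \<noteq> {}"
    using assms unfolding eigenvalue_count_def by (metis less_irrefl sum.empty)
  then obtain x where x: "x \<in> X" "eigenspace (levi_matrix lam p) x \<noteq> {0}" by blast
  moreover have "0 \<in> eigenspace (levi_matrix lam p) x" by (simp add: eigenspace_levi_matrix)
  ultimately obtain v where v: "v \<in> eigenspace (levi_matrix lam p) x" "v \<noteq> 0" by blast
  then obtain j where "v $ j \<noteq> 0" by (auto simp: vec_eq_iff)
  moreover have "of_int (lam j) * v $ j = of_real x * v $ j"
    using v(1) by (simp add: eigenspace_levi_matrix)
  ultimately have "of_real (of_int (lam j)) = complex_of_real x" by simp
  then show ?thesis using x(1) by (metis of_real_eq_iff)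
qed

text \<open>For q = 0 the alternatives with equal signs ask for n eigenvalues, but there are at most
  n - 1. What remains is at least one pair of opposite signs.\<close>

lemma condition_Y_0_both_signs:
  assumes "n \<ge> 2" "CARD('m) = n - 1" "condition_Y n 0 (levi_matrix (lam :: 'm::finite \<Rightarrow> int) p)"
  obtains i j where "lam i > 0" "lam j < 0"
proof -
  let ?c = "eigenvalue_count (levi_matrix lam p)"
  have "?c {0<..} < n" "?c {..<0} < n"
    using eigenvalue_count_levi_matrix_le[of lam p] assms(1,2) by (metis Suc_diff_1 le_imp_less_Suc less_le_trans pos2)+
  then have "?c {0<..} > 0" "?c {..<0} > 0"
    using assms(1,3) by (auto simp: condition_Y_def Let_def max_def min_def split: if_splits)
  then show ?thesis
    using eigenvalue_count_levi_matrix_pos[of lam p "{0<..}"] eigenvalue_count_levi_matrix_pos[of lam p "{..<0}"] that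
    by auto
qed

theorem theorem9p1:
  fixes n :: nat and lam :: "'m::finite \<Rightarrow> int" and mu :: "'m \<Rightarrow> 'm \<Rightarrow> int"
  assumes "n \<ge> 2" and "CARD('m) = n - 1"
    and "\<And>j. lam j \<noteq> 0"
    and "\<And>j t. mu j t = mu t j"
    and "positive_definite (\<chi> j t. real_of_int (mu j t))"
    and "\<And>p. p \<in> heis_manifold lam \<Longrightarrow> condition_Y n 0 (levi_matrix lam p)"
    and "\<And>p. p \<in> heis_manifold lam \<Longrightarrow> condition_Y n 1 (levi_matrix lam p)"
  shows "\<exists>c::real. c > 0 \<and> (\<exists>k0::nat. \<forall>k\<ge>k0.
           real (cfun.dim (CR_sections lam mu k)) \<ge> c * real k ^ n)"
proof -
  note sym = assms(4)
  \<comment> \<open>The manifold is non-empty, so there is a point at which condition Y(0) can be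
    applied.\<close>
  have "heis_rel lam `` {(0, 0)} \<in> heis_manifold lam"
    unfolding heis_manifold_def by (rule quotientI) simp
  then obtain i j where ij: "lam i > 0" "lam j < 0"
    using condition_Y_0_both_signs[OF assms(1,2) assms(6)] by blast
  obtain \<delta> where mu: "posdef_by mu \<delta>" using positive_definite_lower_bound[OF assms(5)] .
  then have \<delta>: "\<delta> > 0" by (simp add: posdef_by_def)
  define \<Lambda> where "\<Lambda> = (\<Sum>j\<in>UNIV. \<bar>real_of_int (lam j)\<bar>)"
  have "\<bar>real_of_int (lam i)\<bar> \<le> \<Lambda>" unfolding \<Lambda>_def by (rule member_le_sum) auto
  then have \<Lambda>: "\<Lambda> > 0" using ij(1) by linarith
  \<comment> \<open>Chosen so that m \<le> \<epsilon> k implies 4 m \<Lambda> \<le> \<delta> k / 2,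
    the bound required by \<open>posdef_by_mode_matrix\<close>.\<close>
  define \<epsilon> where "\<epsilon> = \<delta> / (8 * \<Lambda>)"
  \<comment> \<open>At least \<epsilon> k modes, each with at least (\<delta> k / 2)^(n - 1)
    frequencies.\<close>
  define c where "c = \<epsilon> * (\<delta> / 2) ^ (n - 1)"
  have "real (cfun.dim (CR_sections lam mu k)) \<ge> c * real k ^ n" if k: "k \<ge> 1" for k
  proof -
    \<comment> \<open>The forms are bounded below by \<delta> k / 2, so incongruence needs L <
      \<delta> k. With this \<open>L\<close> the box has L + 1 \<ge> \<delta> k / 2 points in each
      coordinate.\<close>
    define L where "L = \<lfloor>\<delta> / 2 * of_nat k\<rfloor>"
    define I where "I = {0..\<lfloor>\<epsilon> * of_nat k\<rfloor>}"
    have \<delta>k: "\<delta> / 2 * real k > 0" and \<epsilon>k: "\<epsilon> * real k > 0"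
      using \<delta> \<Lambda> k by (auto simp: \<epsilon>_def)
    have pos: "posdef_by (mode_matrix lam mu k m) (\<delta> / 2 * of_nat k)" if "m \<in> I" for m
    proof (rule posdef_by_mode_matrix[OF mu])
      have "of_int m \<le> \<epsilon> * of_nat k" using that by (simp add: I_def le_floor_iff)
      then have "4 * of_int m * \<Lambda> \<le> 4 * (\<epsilon> * of_nat k) * \<Lambda>"
        using \<Lambda> by (intro mult_right_mono) auto
      also have "\<dots> = \<delta> / 2 * of_nat k" using \<Lambda> by (simp add: \<epsilon>_def)
      finally show "4 * of_int m * (\<Sum>j\<in>UNIV. \<bar>of_int (lam j)\<bar>) \<le> \<delta> / 2 * of_nat k"
        by (simp add: \<Lambda>_def)
    qed (use k that in \<open>auto simp: I_def\<close>)
    have L: "of_int L < 2 * (\<delta> / 2 * of_nat k)"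
      using of_int_floor_le[of "\<delta> / 2 * real k"] \<delta>k unfolding L_def by linarith
    define S where "S = theta_section lam mu k ` (I \<times> int_box L)"
    have fin: "finite (I \<times> (int_box L :: ('m \<Rightarrow> int) set))" by (simp add: I_def finite_int_box)
    have finI: "finite I" by (simp add: I_def)
    have lin: "c q = 0" if "\<And>x. (\<Sum>q\<in>I \<times> int_box L. c q * theta_section lam mu k q x) = 0"
      "q \<in> I \<times> int_box L" for c q
      using that
      by (intro theta_sections_independent[where mu = mu and lam = lam and k = k and c = c, OF sym finI pos L])
    have "inj_on (theta_section lam mu k) (I \<times> int_box L)"
      by (rule cfun_independent_family(1)[OF fin]) (rule lin)
    moreover have "cfun.independent S"
      unfolding S_def by (rule cfun_independent_family(2)[OF fin]) (rule lin)
    ultimately have ind: "inj_on (theta_section lam mu k) (I \<times> int_box L)" "cfun.independent S" .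
    have "S \<subseteq> CR_sections lam mu k"
      unfolding S_def using theta_section_in_CR_sections[of mu lam k, OF sym pos] by auto
    then have "card S \<le> cfun.dim (CR_sections lam mu k)"
      by (intro dim_CR_sections_ge[of mu, OF sym ij] ind)
    moreover have "card S = card I * nat (L + 1) ^ (n - 1)"
      unfolding S_def card_image[OF ind(1)] by (simp add: card_cartesian_product card_int_box assms(2))
    moreover have "c * real k ^ n \<le> real (card I * nat (L + 1) ^ (n - 1))"
    proof -
      have "real k ^ n = real k * real k ^ (n - 1)"
        using assms(1) by (simp add: power_eq_if)
      then have "c * real k ^ n = (\<epsilon> * real k) * (\<delta> / 2 * real k) ^ (n - 1)"
        by (simp only: c_def power_mult_distrib mult_ac)
      also have "\<dots> \<le> real (card I) * real (nat (L + 1)) ^ (n - 1)"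
      proof (intro mult_mono power_mono)
        show "\<epsilon> * real k \<le> real (card I)" using \<epsilon>k by (simp add: I_def)
        show "\<delta> / 2 * real k \<le> real (nat (L + 1))" using \<delta>k unfolding L_def by linarith
      qed (use \<delta>k \<epsilon>k in auto)
      finally show ?thesis by simp
    qed
    ultimately show ?thesis by (metis of_nat_le_iff order_trans)
  qed
  moreover have "c > 0" using \<delta> \<Lambda> by (simp add: c_def \<epsilon>_def)
  ultimately show ?thesis by blast
qed

end
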